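(* Let $(X,\mathcal{B},\mu)$ be a standard Borel probability space (in the sense of the context). Let $(T_n)_{n\ge1}$ be a sequence of continuous transformations $T_n:X\to X$. Let $S:X\to X$ be a continuous ergodic $\mu$-preserving transformation. Let $\nu$ be a Borel probability measure on $X$. Assume: (1) $\frac1N\sum_{n=1}^N (T_n)_*\nu\to\mu$ in the weak-$*$ topology as $N\to\infty$; (2) for $\nu$-almost every $x\in X$, any (weak-$*$) limit point of the sequence of measures $\frac1N\sum_{n=1}^N\delta_{T_nx}$ is $S$-invariant; (3) there exists a Borel measurable, $\sigma$-compact set $Z\in\mathcal{B}$ such that $\mu(Z)=0$ and $\lambda(Z)=1$ for every ergodic $S$-invariant probability measure $\lambda\neq\mu$ on $X$. Then for $\nu$-almost every $x\in X$ there exists a set (sequence) $A(x)\subseteq\mathbb{N}$ of upper density equal to $1$ such that for all $\psi\in C_c(X)$, $$\lim_{\substack{N\to\infty\\ N\in A(x)}}\frac1N\sum_{n=1}^{N}\psi(T_nx)=\int\psi\,d\mu .$$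
   Context: "Standard Borel space" $(X,\mathcal{B})$ here means: $X$ is a locally compact (Hausdorff), second countable topological space and $\mathcal{B}$ is its Borel $\sigma$-algebra; $(X,\mathcal B,\mu)$ is a standard Borel probability space if moreover $\mu$ is a probability measure on $\mathcal B$. $C_c(X)$ is the space of continuous compactly supported functions. Weak-$*$ convergence of measures means convergence of integrals of every $\psi\in C_c(X)$. $(T_n)_*\nu$ is the pushforward of $\nu$ under $T_n$, and $\delta_y$ is the Dirac measure at $y$. The upper density of $A\subseteq\mathbb{N}$ is $\overline d(A)=\limsup_{N\to\infty}\frac{\#(A\cap[1,N])}{N}$. *)

theory Defs
  imports "HOL-Probability.Probability"
begin

text \<open>
  The locally compact, second countable Hausdorff space \<open>X\<close> is a type: the Hausdorff property and
  second countability come from the type classes, local compactness is part of the predicate below.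
  All measures are measures on \<open>borel\<close>.
\<close>

definition standard_borel_prob_space ::
    "'a::{t2_space, second_countable_topology} measure \<Rightarrow> bool" where
  "standard_borel_prob_space M \<longleftrightarrow>
     locally_compact_space (euclidean :: 'a topology) \<and> sets M = sets borel \<and> prob_space M"

definition Cc :: "('a::topological_space \<Rightarrow> real) set" where
  "Cc = {\<psi>. continuous_on UNIV \<psi> \<and> compact (closure {x. \<psi> x \<noteq> 0})}"

definition weak_star_conv :: "(nat \<Rightarrow> 'a::topological_space measure) \<Rightarrow> 'a measure \<Rightarrow> bool" where
  "weak_star_conv M L \<longleftrightarrow> (\<forall>\<psi>\<in>Cc. (\<lambda>N. \<integral>x. \<psi> x \<partial>M N) \<longlonglongrightarrow> (\<integral>x. \<psi> x \<partial>L))"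

text \<open>
  Limit points are taken among all finite Borel measures, not only among probability measures, as
  mass may escape to infinity along a weak-* convergent sequence. Finiteness excludes measures
  for which test functions fail to be integrable (the Bochner integral is then \<open>0\<close> by convention).
  On measures of total mass at most \<open>1\<close> over a locally compact second countable Hausdorff space the
  weak-* topology is metrizable, so limit points are the limits of subsequences.
\<close>

definition weak_star_limit_point ::
    "(nat \<Rightarrow> 'a::topological_space measure) \<Rightarrow> 'a measure \<Rightarrow> bool" where
  "weak_star_limit_point M L \<longleftrightarrow>
     sets L = sets borel \<and> finite_measure L \<and>
     (\<exists>r :: nat \<Rightarrow> nat. strict_mono r \<and> weak_star_conv (M \<circ> r) L)"

text \<open>The measure \<open>1/N (M 1 + ... + M N)\<close>; for \<open>N = 0\<close> it is the zero measure.\<close>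

definition cesaro_measure :: "(nat \<Rightarrow> 'a::topological_space measure) \<Rightarrow> nat \<Rightarrow> 'a measure" where
  "cesaro_measure M N =
     measure_of UNIV (sets borel) (\<lambda>A. (\<Sum>n=1..N. emeasure (M n) A) / of_nat N)"

lemma space_cesaro_measure [simp]: "space (cesaro_measure M N) = UNIV"
  by (simp add: cesaro_measure_def)

lemma sets_cesaro_measure [simp, measurable_cong]: "sets (cesaro_measure M N) = sets borel"
  using sets.sigma_sets_eq[of borel] by (simp add: cesaro_measure_def)

lemma emeasure_cesaro_measure:
  assumes M: "\<And>n. 1 \<le> n \<Longrightarrow> n \<le> N \<Longrightarrow> sets (M n) = sets borel" and A: "A \<in> sets borel"
  shows "emeasure (cesaro_measure M N) A = (\<Sum>n=1..N. emeasure (M n) A) / of_nat N"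
proof (rule emeasure_measure_of[OF cesaro_measure_def])
  show "positive (sets (cesaro_measure M N)) (\<lambda>A. (\<Sum>n=1..N. emeasure (M n) A) / of_nat N)"
    by (simp add: positive_def)
  show "countably_additive (sets (cesaro_measure M N))
      (\<lambda>A. (\<Sum>n=1..N. emeasure (M n) A) / of_nat N)"
  proof (rule countably_additiveI)
    fix F :: "nat \<Rightarrow> 'a set"
    assume F: "range F \<subseteq> sets (cesaro_measure M N)" "disjoint_family F"
    have "(\<Sum>i. (\<Sum>n=1..N. emeasure (M n) (F i)) / of_nat N) =
        (\<Sum>i. \<Sum>n=1..N. emeasure (M n) (F i)) / of_nat N"
      by (simp add: divide_ennreal_def ennreal_suminf_multc)
    also have "(\<Sum>i. \<Sum>n=1..N. emeasure (M n) (F i)) =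
        (\<Sum>n=1..N. \<Sum>i. emeasure (M n) (F i))"
      by (rule suminf_sum) auto
    also have "\<dots> = (\<Sum>n=1..N. emeasure (M n) (\<Union>i. F i))"
      using F M by (intro sum.cong refl suminf_emeasure) auto
    finally show "(\<Sum>i. (\<Sum>n=1..N. emeasure (M n) (F i)) / of_nat N) =
        (\<Sum>n=1..N. emeasure (M n) (\<Union>i. F i)) / of_nat N" .
  qed
qed (use A in auto)

definition invariant_measure :: "('a::topological_space \<Rightarrow> 'a) \<Rightarrow> 'a measure \<Rightarrow> bool" where
  "invariant_measure S M \<longleftrightarrow>
     sets M = sets borel \<and> S \<in> borel_measurable borel \<and> distr M borel S = M"

definition ergodic_prob_measure :: "('a::topological_space \<Rightarrow> 'a) \<Rightarrow> 'a measure \<Rightarrow> bool" where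
  "ergodic_prob_measure S M \<longleftrightarrow>
     prob_space M \<and> invariant_measure S M \<and>
     (\<forall>A\<in>sets borel. S -` A = A \<longrightarrow> measure M A = 0 \<or> measure M A = 1)"

definition sigma_compact :: "'a::topological_space set \<Rightarrow> bool" where
  "sigma_compact Z \<longleftrightarrow> (\<exists>K :: nat \<Rightarrow> 'a set. (\<forall>i. compact (K i)) \<and> Z = (\<Union>i. K i))"

definition upper_density :: "nat set \<Rightarrow> ereal" where
  "upper_density A = limsup (\<lambda>N. ereal (real (card (A \<inter> {1..N})) / real N))"

end

theory Submission
  imports Defs
begin

text \<open>
  Choose \<open>F i \<in> Cc\<close> equal to \<open>1\<close> on the \<open>i\<close>-th compact piece of \<open>Z\<close> and \<open>g i \<in> Cc\<close> close to \<open>1\<close>, such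
  that \<open>F i + (1 - g i)\<close> has \<open>\<mu>\<close>-integral below \<open>4^-i\<close>. By (1) its ergodic averages at late times have
  small \<open>\<nu>\<close>-integral, and Fatou's lemma provides, for almost every \<open>x\<close>, infinitely many times \<open>N\<close> at
  which the averages along \<open>x\<close> are \<open>O(2^-i)\<close> for all \<open>i\<close> up to a level tending to infinity. For fixed
  \<open>l\<close> the same bound, up to the factor \<open>l\<close>, holds on the whole window \<open>[N / l, N]\<close>. Hence every weak-*
  limit point along such windows is an \<open>S\<close>-invariant probability measure that is null on \<open>Z\<close>; by the
  ergodic decomposition and (3) it equals \<open>\<mu>\<close>. Letting \<open>l\<close> grow slowly, the union of the windows has
  upper density \<open>1\<close>.

  The part of the ergodic decomposition that is needed comes from the mean ergodic theorem: along a
  subsequence, orbit averages of countably many test functions converge almost everywhere, and the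
  limits are the integrals of an ergodic measure.
\<close>

subsection \<open>Test functions on locally compact spaces\<close>

text \<open>Assumption (1) is convergence of expectations over \<open>\<nu>\<close>, which leaves a
  single orbit free to misbehave at most times. What survives for almost every orbit is a bound at
  infinitely many times, and these depend on the orbit; hence upper density in the conclusion.

  Assumption (2) makes limit points invariant but admits two failures: mass on Z, where the other
  ergodic measures live, and mass lost at infinity, down to the zero measure. \<open>F i\<close>
  guards against the first and \<open>1 - g i\<close> against the second. Both are nonnegative, and
  this sign carries a bound from one time to a whole window. Sigma-compactness makes
  \<open>F i\<close> possible: a compact null set is dominated by a test function of small integral,
  whereas a null set Z may be dense, and then a continuous function that is at least 1 on Z is at
  least 1 everywhere.

  In the ergodic decomposition only almost every fibre matters. Convergence of orbit averages along
  one subsequence is enough to identify the fibres, so the Hilbert space argument can take the place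
  of a pointwise ergodic theorem.\<close>

lemma Hausdorff_euclidean: "Hausdorff_space (euclidean :: 'a::t2_space topology)"
  unfolding Hausdorff_space_def disjnt_def
  by (metis hausdorff open_openin topspace_euclidean)

lemma locally_compact_nbhd:
  fixes U :: "'a::t2_space set"
  assumes lc: "locally_compact_space (euclidean :: 'a topology)" and "open U" "x \<in> U"
  obtains W where "open W" "x \<in> W" "compact (closure W)" "closure W \<subseteq> U"
proof -
  have "neighbourhood_base_of (\<lambda>C. compactin euclidean C \<and> closedin euclidean C) (euclidean :: 'a topology)"
    using lc locally_compact_space_neighbourhood_base_closedin[of "euclidean :: 'a topology"] Hausdorff_euclidean by blast
  moreover have "openin euclidean U \<and> x \<in> U" using assms(2,3) by simp
  ultimately obtain V C where "openin euclidean V" "compactin euclidean C \<and> closedin euclidean C"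
      "x \<in> V" "V \<subseteq> C" "C \<subseteq> U"
    unfolding neighbourhood_base_of by metis
  then have *: "open V" "compact C" "closed C" "x \<in> V" "V \<subseteq> C" "C \<subseteq> U" by simp_all
  have "closure V \<subseteq> C"
    using * by (intro closure_minimal)
  then have "compact (closure V)"
    using * compact_Int_closed[of C "closure V"] by (simp add: Int_absorb1)
  with * \<open>closure V \<subseteq> C\<close> that show ?thesis by blast
qed

text \<open>Restricting the intermediate set to finite unions from a basis leaves, for a countable
  basis, only countably many candidates. The choice of one subsequence in
  \<open>weak_star_sequentially_compact\<close> depends on this.\<close>

lemma compact_open_sandwich_basis:
  fixes U :: "'a::t2_space set"
  assumes lc: "locally_compact_space (euclidean :: 'a topology)" and B: "topological_basis B"
    and K: "compact K" "open U" "K \<subseteq> U"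
  obtains F where "finite F" "F \<subseteq> B" "K \<subseteq> \<Union>F" "compact (closure (\<Union>F))" "closure (\<Union>F) \<subseteq> U"
proof -
  have "\<exists>W\<in>B. x \<in> W \<and> compact (closure W) \<and> closure W \<subseteq> U" if x: "x \<in> K" for x
  proof -
    obtain V where V: "open V" "x \<in> V" "compact (closure V)" "closure V \<subseteq> U"
      using locally_compact_nbhd[OF lc K(2)] K(3) x by blast
    obtain W where W: "W \<in> B" "x \<in> W" "W \<subseteq> V"
      by (rule topological_basisE[OF B V(1,2)])
    have "closure W \<subseteq> closure V" using W closure_mono by blast
    then show ?thesis
      using W V compact_Int_closed[of "closure V" "closure W"] by (auto simp: Int_absorb1 intro!: bexI[of _ W])
  qed
  then obtain f where f: "\<And>x. x \<in> K \<Longrightarrow> f x \<in> B \<and> x \<in> f x \<and> compact (closure (f x)) \<and> closure (f x) \<subseteq> U"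
    by metis
  obtain K' where K': "K' \<subseteq> K" "finite K'" "K \<subseteq> (\<Union>x\<in>K'. f x)"
    using compactE_image[OF K(1), of K f] f topological_basis_open[OF B] by blast
  let ?C = "\<Union>x\<in>K'. closure (f x)"
  have C: "compact ?C" "?C \<subseteq> U" using K' f by (auto intro!: compact_UN)
  have sub: "closure (\<Union>(f ` K')) \<subseteq> ?C"
    using K'(2) closure_subset by (intro closure_minimal closed_UN) blast+
  then have "compact (closure (\<Union>(f ` K')))"
    using compact_Int_closed[OF C(1), of "closure (\<Union>(f ` K'))"] by (simp add: Int_absorb1)
  with K' f C(2) sub show ?thesis
    by (intro that[of "f ` K'"]) auto
qed

lemma CcI_dominated:
  fixes f :: "'a::t2_space \<Rightarrow> real"
  assumes "continuous_on UNIV f" "g \<in> Cc" "\<And>x. g x = 0 \<Longrightarrow> f x = 0"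
  shows "f \<in> Cc"
proof -
  have "closure {x. f x \<noteq> 0} \<subseteq> closure {x. g x \<noteq> 0}"
    using assms(3) by (intro closure_mono) auto
  then have "closure {x. f x \<noteq> 0} = closure {x. g x \<noteq> 0} \<inter> closure {x. f x \<noteq> 0}"
    by auto
  with assms(1,2) show ?thesis
    unfolding Cc_def using compact_Int_closed[of "closure {x. g x \<noteq> 0}" "closure {x. f x \<noteq> 0}"]
    by simp
qed

text \<open>Complete regularity alone does not control the support. Separating \<open>K\<close> from
  the complement of the relatively compact set \<open>\<Union>F\<close>, rather than from that of
  \<open>U\<close>, forces the support into a compact set.\<close>

lemma Urysohn_Cc:
  fixes K :: "'a::{t2_space, second_countable_topology} set"
  assumes lc: "locally_compact_space (euclidean :: 'a topology)"
    and K: "compact K" "open U" "K \<subseteq> U"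
  shows "\<exists>f\<in>Cc. (\<forall>x. 0 \<le> f x \<and> f x \<le> (1::real)) \<and> (\<forall>x\<in>K. f x = 1) \<and> (\<forall>x. x \<notin> U \<longrightarrow> f x = 0)"
proof -
  obtain B :: "'a set set" where B: "topological_basis B" using ex_countable_basis by blast
  obtain F where F: "F \<subseteq> B" "K \<subseteq> \<Union>F" "compact (closure (\<Union>F))" "closure (\<Union>F) \<subseteq> U"
    using compact_open_sandwich_basis[OF lc B K] by metis
  have op: "open (\<Union>F)" using F B by (auto intro: topological_basis_open)
  have cr: "completely_regular_space (euclidean :: 'a topology)"
    using lc Hausdorff_euclidean
    by (intro locally_compact_regular_imp_completely_regular_space) auto
  obtain f :: "'a \<Rightarrow> real" where f: "continuous_map euclidean (top_of_set {0..1}) f"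
      "f ` (- \<Union>F) \<subseteq> {0}" "f ` K \<subseteq> {1}"
    by (rule Urysohn_completely_regular_compact_closed[of 0 1 euclidean K "- \<Union>F"])
       (use cr K F op in \<open>auto simp: disjnt_def simp flip: closed_closedin\<close>)
  have cont: "continuous_on UNIV f" and range: "\<And>x. f x \<in> {0..1}"
    using f(1) by (auto simp: continuous_map_in_subtopology)
  have supp: "{x. f x \<noteq> 0} \<subseteq> \<Union>F" using f(2) by auto
  then have "closure {x. f x \<noteq> 0} = closure (\<Union>F) \<inter> closure {x. f x \<noteq> 0}"
    using closure_mono by blast
  then have "compact (closure {x. f x \<noteq> 0})"
    using compact_Int_closed[OF F(3), of "closure {x. f x \<noteq> 0}"] by simp
  with cont have "f \<in> Cc" by (simp add: Cc_def)
  moreover have "f x = 0" if "x \<notin> U" for x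
    using that F(4) closure_subset[of "\<Union>F"] supp by blast
  ultimately show ?thesis
    using range f(3) by (intro bexI[of _ f]) auto
qed

text \<open>An open set is a countable union of basis sets whose closures are compact and still
  inside it; the n-th function is a Urysohn function for an initial segment of these. Monotonicity
  is not claimed, as the bound by 1 is what dominated convergence asks for.\<close>

lemma open_indicator_limit_Cc:
  fixes U :: "'a::{t2_space, second_countable_topology} set"
  assumes lc: "locally_compact_space (euclidean :: 'a topology)" and U: "open U"
  shows "\<exists>f :: nat \<Rightarrow> 'a \<Rightarrow> real. (\<forall>n. f n \<in> Cc) \<and> (\<forall>n x. 0 \<le> f n x \<and> f n x \<le> 1) \<and>
    (\<forall>n x. x \<notin> U \<longrightarrow> f n x = 0) \<and> (\<forall>x. (\<lambda>n. f n x) \<longlonglongrightarrow> indicator U x)"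
proof -
  obtain B :: "'a set set" where B: "countable B" "topological_basis B" using ex_countable_basis by blast
  \<comment> \<open>The empty set keeps \<open>B'\<close> nonempty even for empty \<open>U\<close>,
    so that \<open>from_nat_into\<close> enumerates it.\<close>
  define B' where "B' = insert {} {W\<in>B. compact (closure W) \<and> closure W \<subseteq> U}"
  have B': "countable B'" "B' \<noteq> {}" using B by (auto simp: B'_def)
  define W where "W = from_nat_into B'"
  have W: "compact (closure (W n))" "closure (W n) \<subseteq> U" for n
    using from_nat_into[OF B'(2), of n] by (auto simp: W_def B'_def)
  have WU: "\<exists>n. x \<in> W n" if x: "x \<in> U" for x
  proof -
    obtain V where V: "open V" "x \<in> V" "compact (closure V)" "closure V \<subseteq> U"
      by (rule locally_compact_nbhd[OF lc U x])
    obtain V' where V': "V' \<in> B" "x \<in> V'" "V' \<subseteq> V"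
      by (rule topological_basisE[OF B(2) V(1,2)])
    have "closure V' \<subseteq> closure V" using V' closure_mono by blast
    then have "V' \<in> B'"
      using V V' compact_Int_closed[of "closure V" "closure V'"] by (auto simp: B'_def Int_absorb1)
    then show ?thesis using V'(2) B'(1) from_nat_into_surj[of B' V'] by (auto simp: W_def)
  qed
  have "\<exists>f. f \<in> Cc \<and> (\<forall>x. 0 \<le> f x \<and> f x \<le> (1::real)) \<and> (\<forall>i\<le>n. \<forall>x\<in>W i. f x = 1) \<and> (\<forall>x. x \<notin> U \<longrightarrow> f x = 0)" for n
  proof -
    have "compact (\<Union>i\<in>{..n}. closure (W i))" using W by (intro compact_UN) auto
    moreover have "(\<Union>i\<in>{..n}. closure (W i)) \<subseteq> U" using W(2) by blast
    ultimately obtain f :: "'a \<Rightarrow> real" where f: "f \<in> Cc" "\<forall>x. 0 \<le> f x \<and> f x \<le> 1"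
      "\<forall>x\<in>(\<Union>i\<in>{..n}. closure (W i)). f x = 1" "\<forall>x. x \<notin> U \<longrightarrow> f x = 0"
      using Urysohn_Cc[OF lc _ U] by metis
    have "x \<in> (\<Union>i\<in>{..n}. closure (W i))" if "i \<le> n" "x \<in> W i" for i x
      using that closure_subset by blast
    then have "\<forall>i\<le>n. \<forall>x\<in>W i. f x = 1" using f(3) by blast
    with f(1,2,4) show ?thesis by (intro exI[of _ f]) simp
  qed
  then obtain f :: "nat \<Rightarrow> 'a \<Rightarrow> real" where f: "\<And>n. f n \<in> Cc" "\<And>n x. 0 \<le> f n x \<and> f n x \<le> 1"
      "\<And>n i x. i \<le> n \<Longrightarrow> x \<in> W i \<Longrightarrow> f n x = 1" "\<And>n x. x \<notin> U \<Longrightarrow> f n x = 0"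
    by metis
  have "(\<lambda>n. f n x) \<longlonglongrightarrow> indicator U x" for x
  proof (cases "x \<in> U")
    case True
    with WU obtain i where "x \<in> W i" by blast
    then have "\<forall>\<^sub>F n in sequentially. f n x = 1"
      using f(3) by (auto simp: eventually_sequentially)
    with True show ?thesis by (simp add: tendsto_eventually)
  qed (simp add: f(4))
  with f show ?thesis by (intro exI[of _ f]) auto
qed

section \<open>Integrability of test functions and families that determine a measure\<close>

lemma Cc_measurable: "f \<in> Cc \<Longrightarrow> f \<in> borel_measurable borel"
  by (auto simp: Cc_def intro: borel_measurable_continuous_onI)

lemma Cc_bounded:
  assumes "f \<in> Cc"
  obtains C :: real where "0 < C" "\<And>x. \<bar>f x\<bar> \<le> C"
proof -
  let ?K = "closure {x. f x \<noteq> 0}"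
  have "compact (f ` ?K)"
    using assms continuous_on_subset by (intro compact_continuous_image) (auto simp: Cc_def)
  then obtain C where "0 < C" and C: "\<forall>y\<in>f ` ?K. norm y \<le> C"
    using compact_imp_bounded bounded_pos by metis
  have "\<bar>f x\<bar> \<le> C" for x
    using C \<open>0 < C\<close> closure_subset[of "{x. f x \<noteq> 0}"] by (cases "f x = 0") auto
  with \<open>0 < C\<close> that show ?thesis by blast
qed

lemma Cc_integrable:
  assumes "f \<in> Cc" "finite_measure M" "sets M = sets borel"
  shows "integrable M f"
proof -
  obtain C where "\<And>x. \<bar>f x\<bar> \<le> C" using Cc_bounded[OF assms(1)] by blast
  then show ?thesis
    using Cc_measurable[OF assms(1)] assms(2)
    by (intro finite_measure.integrable_const_bound[where B = C])
       (auto simp: measurable_cong_sets[OF assms(3) refl])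
qed

text \<open>Closing a countable basis under finite intersections keeps it countable and makes it a
  pi-system. The empty intersection contributes \<open>UNIV\<close>, so measures that agree on the
  system also agree in total mass.\<close>

lemma countable_pi_basis:
  obtains U :: "nat \<Rightarrow> 'a::second_countable_topology set" where
    "\<And>i. open (U i)" "Int_stable (range U)" "UNIV \<in> range U" "sets borel = sigma_sets UNIV (range U)"
proof -
  obtain B :: "'a set set" where B: "countable B" "topological_basis B" using ex_countable_basis by blast
  define P where "P = Inter ` {F. finite F \<and> F \<subseteq> B}"
  have P: "countable P" "UNIV \<in> P"
    using B by (auto simp: P_def intro!: countable_Collect_finite_subset image_eqI[of _ _ "{}"])
  have op: "open A" if "A \<in> P" for A
    using that topological_basis_open[OF B(2)] by (auto simp: P_def intro!: open_Inter)
  have BP: "B \<subseteq> P"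
  proof
    fix b assume "b \<in> B"
    then show "b \<in> P" unfolding P_def by (intro image_eqI[of _ _ "{b}"]) auto
  qed
  have st: "Int_stable P"
  proof (rule Int_stableI)
    fix a b assume "a \<in> P" "b \<in> P"
    then obtain F G where "a = \<Inter>F" "finite F" "F \<subseteq> B" "b = \<Inter>G" "finite G" "G \<subseteq> B"
      by (auto simp: P_def)
    then show "a \<inter> b \<in> P" unfolding P_def by (intro image_eqI[of _ _ "F \<union> G"]) auto
  qed
  have tb: "topological_basis P"
  proof (rule topological_basisI)
    fix O' and x :: 'a assume "open O'" "x \<in> O'"
    then obtain b where "b \<in> B" "x \<in> b" "b \<subseteq> O'" by (rule topological_basisE[OF B(2)])
    with BP show "\<exists>B'\<in>P. x \<in> B' \<and> B' \<subseteq> O'" by blast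
  qed (rule op)
  have "range (from_nat_into P) = P" using P by (intro range_from_nat_into) auto
  moreover have "sets borel = sigma_sets UNIV P"
    by (subst borel_eq_countable_basis[OF P(1) tb]) simp
  ultimately show ?thesis
    using that[of "from_nat_into P"] st P op by auto
qed

text \<open>A countable substitute for a dense subset of C_c(X): the integrals of the
  \<open>f i n\<close> determine a finite Borel measure because they determine its values on the
  pi-system of the \<open>U i\<close>. Countability lets exceptional null sets be united and one
  subsequence serve all test functions.\<close>

locale determining_Cc_family =
  fixes U :: "nat \<Rightarrow> 'a::{t2_space, second_countable_topology} set"
    and f :: "nat \<Rightarrow> nat \<Rightarrow> 'a \<Rightarrow> real"
  assumes open_U: "\<And>i. open (U i)" and Int_stable_U: "Int_stable (range U)"
    and UNIV_U: "UNIV \<in> range U" and sets_borel_U: "sets borel = sigma_sets UNIV (range U)"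
    and f_Cc: "\<And>i n. f i n \<in> Cc" and f_nonneg: "\<And>i n x. 0 \<le> f i n x"
    and f_le_1: "\<And>i n x. f i n x \<le> 1"
    and f_tendsto: "\<And>i x. (\<lambda>n. f i n x) \<longlonglongrightarrow> indicator (U i) x"

lemma determining_Cc_family_exists:
  assumes lc: "locally_compact_space (euclidean :: 'a::{t2_space, second_countable_topology} topology)"
  shows "\<exists>(U :: nat \<Rightarrow> 'a set) f. determining_Cc_family U f"
proof -
  obtain U :: "nat \<Rightarrow> 'a set" where U:
    "\<And>i. open (U i)" "Int_stable (range U)" "UNIV \<in> range U" "sets borel = sigma_sets UNIV (range U)"
    using countable_pi_basis by metis
  have "\<exists>f :: nat \<Rightarrow> 'a \<Rightarrow> real. (\<forall>n. f n \<in> Cc) \<and> (\<forall>n x. 0 \<le> f n x \<and> f n x \<le> 1) \<and>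
    (\<forall>x. (\<lambda>n. f n x) \<longlonglongrightarrow> indicator (U i) x)" for i
    using open_indicator_limit_Cc[OF lc U(1)[of i]] by metis
  then obtain f :: "nat \<Rightarrow> nat \<Rightarrow> 'a \<Rightarrow> real" where
    "\<And>i n. f i n \<in> Cc" "\<And>i n x. 0 \<le> f i n x \<and> f i n x \<le> 1"
    "\<And>i x. (\<lambda>n. f i n x) \<longlonglongrightarrow> indicator (U i) x"
    by metis
  with U have "determining_Cc_family U f" by unfold_locales auto
  then show ?thesis by (intro exI)
qed

lemma tendsto_integral_indicator:
  fixes f :: "nat \<Rightarrow> 'a \<Rightarrow> real"
  assumes "finite_measure M" "A \<in> sets M" "\<And>n. f n \<in> borel_measurable M"
    "\<And>n x. \<bar>f n x\<bar> \<le> 1" "\<And>x. (\<lambda>n. f n x) \<longlonglongrightarrow> indicator A x"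
  shows "(\<lambda>n. \<integral>x. f n x \<partial>M) \<longlonglongrightarrow> measure M A"
proof -
  interpret finite_measure M by fact
  have "(\<lambda>n. \<integral>x. f n x \<partial>M) \<longlonglongrightarrow> (\<integral>x. indicator A x \<partial>M)"
    using assms(2-) by (intro integral_dominated_convergence[where w="\<lambda>_. 1"]) auto
  then show ?thesis using assms(2) by simp
qed

context determining_Cc_family
begin

lemma f_measurable [measurable]: "f i n \<in> borel_measurable borel"
  by (rule Cc_measurable[OF f_Cc])

lemma abs_f_le_1: "\<bar>f i n x\<bar> \<le> 1"
  using f_nonneg f_le_1 by simp

lemma tendsto_measure_U:
  assumes "finite_measure M" and M: "sets M = sets borel"
  shows "(\<lambda>n. \<integral>x. f i n x \<partial>M) \<longlonglongrightarrow> measure M (U i)"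
  using assms open_U f_tendsto abs_f_le_1
  by (intro tendsto_integral_indicator) (auto simp: measurable_cong_sets[OF M refl])

lemma measure_eqI_f:
  assumes M: "finite_measure M" "sets M = sets borel" and N: "finite_measure N" "sets N = sets borel"
    and eq: "\<And>i n. (\<integral>x. f i n x \<partial>M) = (\<integral>x. f i n x \<partial>N)"
  shows "M = N"
proof -
  interpret M: finite_measure M by fact
  interpret N: finite_measure N by fact
  have "measure M (U i) = measure N (U i)" for i
    using LIMSEQ_unique[OF tendsto_measure_U[OF M, of i]] tendsto_measure_U[OF N, of i] by (simp add: eq)
  then have "emeasure M A = emeasure N A" if "A \<in> range U" for A
    using that by (auto simp: M.emeasure_eq_measure N.emeasure_eq_measure)
  moreover obtain i where "U i = UNIV" using UNIV_U by fastforce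
  ultimately show ?thesis
    using UNIV_U Int_stable_U sets_borel_U M N
    by (intro measure_eqI_generator_eq[where E="range U" and \<Omega>=UNIV and A="\<lambda>_. UNIV"])
       (auto simp: M.emeasure_eq_measure)
qed

end

subsection \<open>Measures from contents\<close>

text \<open>The diagonal argument is hidden in topology: the points \<open>\<lambda>i. a i n\<close>
  lie in a countable power of the unit interval, which is compact by Tychonoff and, being first
  countable, sequentially compact.\<close>

lemma diagonal_convergent_subsequence:
  fixes a :: "nat \<Rightarrow> nat \<Rightarrow> real"
  assumes "\<And>i n. a i n \<in> {0..1}"
  obtains r l where "strict_mono r" "\<And>i. (\<lambda>n. a i (r n)) \<longlonglongrightarrow> l i"
proof -
  have "compactin (product_topology (\<lambda>_::nat. euclideanreal) UNIV) (PiE UNIV (\<lambda>_. {0..1}))"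
    by (subst compactin_PiE) auto
  then have "compact (PiE UNIV (\<lambda>_::nat. {0..1::real}))"
    by (metis compactin_euclidean_iff euclidean_product_topology)
  moreover have "\<And>n. (\<lambda>i. a i n) \<in> PiE UNIV (\<lambda>_::nat. {0..1::real})"
    using assms by auto
  ultimately obtain l r where "strict_mono r" "((\<lambda>n. (\<lambda>i. a i n)) \<circ> r) \<longlonglongrightarrow> l"
    using compact_imp_seq_compact seq_compactE by metis
  have "(\<lambda>n. a i (r n)) \<longlonglongrightarrow> l i" for i
  proof -
    have "isCont (\<lambda>x::nat \<Rightarrow> real. x i) l"
      using continuous_on_eq_continuous_at[OF open_UNIV, of "\<lambda>x::nat \<Rightarrow> real. x i"] by simp
    from isCont_tendsto_compose[OF this \<open>_ \<longlonglongrightarrow> l\<close>] show ?thesis by (simp add: o_def)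
  qed
  with \<open>strict_mono r\<close> show ?thesis by (rule that)
qed

text \<open>Halmos's passage from a content to a measure, with the content given on relatively
  compact open sets. In the proof \<beta> is the inner content of open sets, \<gamma> the induced
  outer measure, and Caratheodory's theorem finishes. Since \<open>m W\<close> counts only for open
  sets that contain \<open>closure W\<close>, the measure of \<open>W\<close> may be smaller than
  \<open>m W\<close>; this repairs a finitely additive \<open>m\<close> that arises as a
  limit.\<close>

lemma measure_of_content:
  fixes m :: "'a::t2_space set \<Rightarrow> ennreal"
  assumes op: "\<And>W. W \<in> B \<Longrightarrow> open W" and cpt: "\<And>W. W \<in> B \<Longrightarrow> compact (closure W)"
    and empty: "{} \<in> B" and Un: "\<And>V W. V \<in> B \<Longrightarrow> W \<in> B \<Longrightarrow> V \<union> W \<in> B"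
    and nbhd: "\<And>x U. open U \<Longrightarrow> x \<in> U \<Longrightarrow> \<exists>W\<in>B. x \<in> W \<and> closure W \<subseteq> U"
    and m0: "m {} = 0" and mono: "\<And>V W. V \<in> B \<Longrightarrow> W \<in> B \<Longrightarrow> V \<subseteq> W \<Longrightarrow> m V \<le> m W"
    and sub: "\<And>V W. V \<in> B \<Longrightarrow> W \<in> B \<Longrightarrow> m (V \<union> W) \<le> m V + m W"
    and add: "\<And>V W. V \<in> B \<Longrightarrow> W \<in> B \<Longrightarrow> V \<inter> W = {} \<Longrightarrow> m (V \<union> W) = m V + m W"
  shows "\<exists>\<kappa>. sets \<kappa> = sets borel \<and>
    (\<forall>G. open G \<longrightarrow> emeasure \<kappa> G = (SUP W\<in>{W\<in>B. closure W \<subseteq> G}. m W)) \<and>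
    (\<forall>E\<in>sets borel. emeasure \<kappa> E = (INF G\<in>{G. open G \<and> E \<subseteq> G}. emeasure \<kappa> G))"
proof -
  define \<beta> where "\<beta> G = (SUP W\<in>{W\<in>B. closure W \<subseteq> G}. m W)" for G
  define \<gamma> where "\<gamma> E = (INF G\<in>{G. open G \<and> E \<subseteq> G}. \<beta> G)" for E
  have \<beta>_mono: "\<beta> G \<le> \<beta> H" if "G \<subseteq> H" for G H
    unfolding \<beta>_def by (rule SUP_subset_mono) (use that in auto)
  have \<gamma>_open: "\<gamma> G = \<beta> G" if "open G" for G
    unfolding \<gamma>_def by (rule antisym) (use that in \<open>auto intro!: INF_lower INF_greatest \<beta>_mono\<close>)
  have \<gamma>_mono: "\<gamma> E \<le> \<gamma> F" if "E \<subseteq> F" for E F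
    unfolding \<gamma>_def by (rule INF_superset_mono) (use that in auto)
  have \<gamma>_le: "\<gamma> E \<le> \<beta> G" if "open G" "E \<subseteq> G" for E G
    unfolding \<gamma>_def by (rule INF_lower) (use that in auto)
  have \<beta>_empty: "\<beta> {} = 0"
  proof -
    have "{W\<in>B. closure W \<subseteq> {}} = {{}}" using empty closure_subset by fastforce
    then show ?thesis by (simp add: \<beta>_def m0)
  qed
  have UnF: "(\<Union>i\<in>F. V i) \<in> B \<and> m (\<Union>i\<in>F. V i) \<le> (\<Sum>i\<in>F. m (V i))"
    if "finite F" "\<And>i. i \<in> F \<Longrightarrow> V i \<in> B" for F and V :: "'b \<Rightarrow> 'a set"
    using that
  proof (induction F)
    case (insert i F)
    then show ?case using Un sub order_trans[OF sub add_left_mono] by (simp add: insert)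
  qed (simp add: empty m0)
  have \<beta>_sub: "\<beta> (\<Union>n. G n) \<le> (\<Sum>n. \<beta> (G n))" if G: "\<And>n. open (G n)" for G :: "nat \<Rightarrow> 'a set"
    unfolding \<beta>_def[of "\<Union>n. G n"]
  proof (rule SUP_least)
    fix W assume W: "W \<in> {W \<in> B. closure W \<subseteq> (\<Union>n. G n)}"
    have "\<exists>V n. V \<in> B \<and> x \<in> V \<and> closure V \<subseteq> G n" if "x \<in> closure W" for x
      using that W nbhd[OF G] by blast
    then obtain V n where V: "\<And>x. x \<in> closure W \<Longrightarrow> V x \<in> B \<and> x \<in> V x \<and> closure (V x) \<subseteq> G (n x)"
      by metis
    obtain F where F: "F \<subseteq> closure W" "finite F" "closure W \<subseteq> (\<Union>x\<in>F. V x)"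
      using compactE_image[of "closure W" "closure W" V] cpt W V op by blast
    \<comment> \<open>The finite subcover is sorted by the index of the \<open>G k\<close> that
      contains each piece, so that every \<open>W' k\<close> is a single member of \<open>B\<close>
      with closure inside \<open>G k\<close>.\<close>
    define W' where "W' k = (\<Union>x\<in>{x\<in>F. n x = k}. V x)" for k
    have W'B: "W' k \<in> B" for k
      unfolding W'_def using UnF[of "{x\<in>F. n x = k}" V] F V by auto
    have W'G: "closure (W' k) \<subseteq> G k" for k
    proof -
      have "closure (W' k) \<subseteq> (\<Union>x\<in>{x\<in>F. n x = k}. closure (V x))"
      proof (rule closure_minimal)
        show "W' k \<subseteq> (\<Union>x\<in>{x\<in>F. n x = k}. closure (V x))"
          unfolding W'_def by (intro UN_mono order_refl closure_subset)
      qed (use F(2) in auto)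
      also have "\<dots> \<subseteq> G k"
        using V F(1) by (intro UN_least) blast
      finally show ?thesis .
    qed
    have "(\<Union>x\<in>F. V x) \<subseteq> (\<Union>k\<in>n ` F. W' k)"
      unfolding W'_def by blast
    with F(3) closure_subset[of W] have "W \<subseteq> (\<Union>k\<in>n ` F. W' k)"
      by simp
    then have "m W \<le> m (\<Union>k\<in>n ` F. W' k)"
      using W W'B UnF[of "n ` F" W'] F(2) by (intro mono) auto
    also have "\<dots> \<le> (\<Sum>k\<in>n ` F. m (W' k))"
      using W'B UnF[of "n ` F" W'] F(2) by auto
    also have "\<dots> \<le> (\<Sum>k\<in>n ` F. \<beta> (G k))"
      using W'B W'G by (intro sum_mono) (auto simp: \<beta>_def intro!: SUP_upper)
    also have "\<dots> \<le> (\<Sum>k. \<beta> (G k))"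
      using F(2) by (intro sum_le_suminf) auto
    finally show "m W \<le> (\<Sum>k. \<beta> (G k))" .
  qed
  have csub: "countably_subadditive UNIV \<gamma>"
    unfolding countably_subadditive_def
  proof (intro allI impI)
    fix A :: "nat \<Rightarrow> 'a set"
    show "\<gamma> (\<Union>i. A i) \<le> (\<Sum>n. \<gamma> (A n))"
    proof (rule ennreal_le_epsilon)
      fix e :: real assume e: "0 < e" "(\<Sum>n. \<gamma> (A n)) < top"
      have "\<exists>G. open G \<and> A n \<subseteq> G \<and> \<beta> G \<le> \<gamma> (A n) + e * (1/2)^Suc n" for n
      proof -
        have "\<gamma> (A n) < \<gamma> (A n) + e * (1/2)^Suc n"
          using e by (auto simp add: less_top dest!: ennreal_suminf_lessD)
        then show ?thesis
          unfolding \<gamma>_def[of "A n"] INF_less_iff by (auto intro: less_imp_le)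
      qed
      then obtain G where G: "\<And>n. open (G n)" "\<And>n. A n \<subseteq> G n" "\<And>n. \<beta> (G n) \<le> \<gamma> (A n) + e * (1/2)^Suc n"
        by metis
      have "\<gamma> (\<Union>i. A i) \<le> \<beta> (\<Union>i. G i)"
        using G(1,2) by (intro \<gamma>_le) blast+
      also have "\<dots> \<le> (\<Sum>n. \<beta> (G n))" by (rule \<beta>_sub[OF G(1)])
      also have "\<dots> \<le> (\<Sum>n. \<gamma> (A n) + e * (1/2) ^ Suc n)"
        using G(3) by (intro suminf_le) auto
      also have "\<dots> = (\<Sum>n. \<gamma> (A n)) + (\<Sum>n. ennreal e * ennreal ((1/2) ^ Suc n))"
        using e by (subst suminf_add[symmetric])
                   (auto simp del: ennreal_suminf_cmult simp add: ennreal_mult[symmetric])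
      also have "\<dots> = (\<Sum>n. \<gamma> (A n)) + e"
        unfolding ennreal_suminf_cmult
        by (subst suminf_ennreal_eq[OF zero_le_power power_half_series]) auto
      finally show "\<gamma> (\<Union>i. A i) \<le> (\<Sum>n. \<gamma> (A n)) + e" .
    qed
  qed
  have oms: "outer_measure_space UNIV \<gamma>"
    using csub \<gamma>_mono \<gamma>_open[of "{}"] \<beta>_empty
    by (auto simp: outer_measure_space_def positive_def increasing_def)
  interpret U: sigma_algebra UNIV "UNIV :: 'a set set"
    using sigma_algebra_Pow[of UNIV] by simp
  have ms: "measure_space UNIV (lambda_system UNIV UNIV \<gamma>) \<gamma>"
    by (rule U.caratheodory_lemma[OF oms])
  have \<gamma>_subadd: "\<gamma> (E \<union> F) \<le> \<gamma> E + \<gamma> F" if "E \<inter> F = {}" for E F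
    using U.countably_subadditive_subadditive[of \<gamma>] oms that
    by (auto simp: outer_measure_space_def intro: subadditiveD)
  have open_ls: "G \<in> lambda_system UNIV UNIV \<gamma>" if G: "open G" for G
  proof -
    \<comment> \<open>Any \<open>V\<close> whose closure avoids \<open>closure W\<close> is disjoint
      from \<open>W\<close>, so \<open>m W + m V\<close> is the content of one set admissible for
      \<open>H\<close>. Additivity of \<open>m\<close> enters here, and it is what makes open sets
      Caratheodory measurable.\<close>
    have split: "\<beta> (G \<inter> H) + \<gamma> (H - G) \<le> \<beta> H" if H: "open H" for H
    proof -
      have "m W + \<gamma> (H - G) \<le> \<beta> H" if W: "W \<in> B" "closure W \<subseteq> G \<inter> H" for W
      proof -
        have "\<gamma> (H - G) \<le> \<beta> (H - closure W)"
          using W H by (intro \<gamma>_le) auto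
        then have "m W + \<gamma> (H - G) \<le> m W + \<beta> (H - closure W)"
          by (rule add_left_mono)
        also have "\<dots> = (SUP V\<in>{V\<in>B. closure V \<subseteq> H - closure W}. m W + m V)"
          unfolding \<beta>_def using empty by (intro ennreal_SUP_add_right) auto
        also have "\<dots> \<le> \<beta> H"
        proof (rule SUP_least)
          fix V assume V: "V \<in> {V\<in>B. closure V \<subseteq> H - closure W}"
          have "W \<inter> V = {}" using V closure_subset by blast
          then have "m W + m V = m (W \<union> V)" using add V W by simp
          also have "\<dots> \<le> \<beta> H"
            unfolding \<beta>_def using V W Un by (intro SUP_upper) (auto simp: closure_Un)
          finally show "m W + m V \<le> \<beta> H" .
        qed
        finally show ?thesis .
      qed
      then have "(SUP W\<in>{W\<in>B. closure W \<subseteq> G \<inter> H}. m W + \<gamma> (H - G)) \<le> \<beta> H"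
        by (intro SUP_least) auto
      moreover have "(SUP W\<in>{W\<in>B. closure W \<subseteq> G \<inter> H}. m W + \<gamma> (H - G)) = \<beta> (G \<inter> H) + \<gamma> (H - G)"
        unfolding \<beta>_def using empty by (intro ennreal_SUP_add_left) (auto intro: exI[of _ "{}"])
      ultimately show ?thesis by simp
    qed
    have "\<gamma> (G \<inter> E) + \<gamma> (- G \<inter> E) = \<gamma> E" for E
    proof (rule antisym)
      have "\<gamma> (G \<inter> E) + \<gamma> (- G \<inter> E) \<le> \<beta> H" if "open H" "E \<subseteq> H" for H
      proof -
        have "\<gamma> (G \<inter> E) + \<gamma> (- G \<inter> E) \<le> \<beta> (G \<inter> H) + \<gamma> (H - G)"
          using that G by (intro add_mono \<gamma>_le \<gamma>_mono) auto
        also have "\<dots> \<le> \<beta> H" using split that by blast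
        finally show ?thesis .
      qed
      then show "\<gamma> (G \<inter> E) + \<gamma> (- G \<inter> E) \<le> \<gamma> E"
        unfolding \<gamma>_def[of E] by (intro INF_greatest) auto
      have "G \<inter> E \<union> (- G \<inter> E) = E" by auto
      then show "\<gamma> E \<le> \<gamma> (G \<inter> E) + \<gamma> (- G \<inter> E)"
        using \<gamma>_subadd[of "G \<inter> E" "- G \<inter> E"] by auto
    qed
    then show ?thesis by (simp add: lambda_system_def Compl_eq_Diff_UNIV)
  qed
  have borel_ls: "sets borel \<subseteq> lambda_system UNIV UNIV \<gamma>"
  proof -
    interpret L: sigma_algebra UNIV "lambda_system UNIV UNIV \<gamma>"
      using ms by (simp add: measure_space_def)
    show ?thesis
      unfolding borel_def using open_ls by (auto intro!: L.sigma_sets_subset)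
  qed
  have ca: "countably_additive (sets borel) \<gamma>" "positive (sets borel) \<gamma>"
    using ms borel_ls unfolding measure_space_def countably_additive_def positive_def
    by (auto simp: subset_eq)
  define \<kappa> where "\<kappa> = measure_of UNIV (sets borel) \<gamma>"
  have sets: "sets \<kappa> = sets borel"
    using sets.sigma_sets_eq[of borel] by (simp add: \<kappa>_def)
  have em: "emeasure \<kappa> E = \<gamma> E" if "E \<in> sets borel" for E
    using that ca by (intro emeasure_measure_of[OF \<kappa>_def]) (auto simp: sets)
  show ?thesis
  proof (intro exI[of _ \<kappa>] conjI allI impI ballI sets)
    show "emeasure \<kappa> G = (SUP W\<in>{W\<in>B. closure W \<subseteq> G}. m W)" if "open G" for G
      using that em \<gamma>_open by (simp add: \<beta>_def)
    show "emeasure \<kappa> E = (INF G\<in>{G. open G \<and> E \<subseteq> G}. emeasure \<kappa> G)" if "E \<in> sets borel" for E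
      unfolding em[OF that] \<gamma>_def by (rule INF_cong) (auto simp: em \<gamma>_open)
  qed
qed

subsection \<open>Weak-* compactness\<close>

lemma layer_count_bounds:
  assumes "0 \<le> s" "s \<le> real k"
  shows "(\<Sum>i=1..k. of_bool (real i < s)) \<le> s" "s \<le> (\<Sum>i=1..k. of_bool (real i < s)) + 1"
    "(\<Sum>i=1..k. of_bool (real i \<le> s)) \<le> s" "s \<le> (\<Sum>i=1..k. of_bool (real i \<le> s)) + 1"
proof -
  have "{1..k} \<inter> {i. real i < s} = {1..nat (\<lceil>s\<rceil> - 1)}" "{1..k} \<inter> {i. real i \<le> s} = {1..nat \<lfloor>s\<rfloor>}"
    using assms by (auto; linarith)+
  then have "(\<Sum>i=1..k. of_bool (real i < s)) = real (nat (\<lceil>s\<rceil> - 1))"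
    "(\<Sum>i=1..k. of_bool (real i \<le> s)) = real (nat \<lfloor>s\<rfloor>)"
    by simp_all
  with assms show "(\<Sum>i=1..k. of_bool (real i < s)) \<le> s" "s \<le> (\<Sum>i=1..k. of_bool (real i < s)) + 1"
    "(\<Sum>i=1..k. of_bool (real i \<le> s)) \<le> s" "s \<le> (\<Sum>i=1..k. of_bool (real i \<le> s)) + 1"
    by linarith+
qed

text \<open>A discrete layer-cake formula with error \<open>1 / k\<close>. Strict and non-strict
  superlevel sets both appear because weak-* limits control open sets from below and compact sets
  from above.\<close>

lemma integral_layer_bounds:
  fixes f :: "'a::topological_space \<Rightarrow> real"
  assumes f: "f \<in> Cc" "\<And>x. 0 \<le> f x" "\<And>x. f x \<le> 1" and k: "k > 0"
    and M: "sets M = sets borel" "finite_measure M" "measure M UNIV \<le> 1"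
  shows "(\<Sum>i=1..k. measure M {x. real i / k < f x}) / k \<le> (\<integral>x. f x \<partial>M)"
    "(\<integral>x. f x \<partial>M) \<le> (\<Sum>i=1..k. measure M {x. real i / k < f x}) / k + 1 / k"
    "(\<Sum>i=1..k. measure M {x. real i / k \<le> f x}) / k \<le> (\<integral>x. f x \<partial>M)"
    "(\<integral>x. f x \<partial>M) \<le> (\<Sum>i=1..k. measure M {x. real i / k \<le> f x}) / k + 1 / k"
proof -
  interpret finite_measure M by fact
  have [simp]: "space M = UNIV" using sets_eq_imp_space_eq[OF M(1)] by simp
  note [measurable] = Cc_measurable[OF f(1)]
  have fM [measurable]: "f \<in> borel_measurable M" by (simp add: measurable_cong_sets[OF M(1) refl])
  have fint: "integrable M f" by (rule Cc_integrable[OF f(1) M(2,1)])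
  have bnd: "0 \<le> real k * f x" "real k * f x \<le> real k" for x
    using f(2,3)[of x] by (auto simp: mult_left_le)
  define P Q :: "'a \<Rightarrow> real" where "P x = (\<Sum>i=1..k. of_bool (real i < k * f x))"
    and "Q x = (\<Sum>i=1..k. of_bool (real i \<le> k * f x))" for x
  have PQ: "P x \<le> k * f x" "k * f x \<le> P x + 1" "Q x \<le> k * f x" "k * f x \<le> Q x + 1" for x
    unfolding P_def Q_def using layer_count_bounds[OF bnd] by auto
  have P': "P = (\<lambda>x. \<Sum>i=1..k. indicator {x. real i / k < f x} x)"
    and Q': "Q = (\<lambda>x. \<Sum>i=1..k. indicator {x. real i / k \<le> f x} x)"
    unfolding P_def Q_def using k by (auto simp: fun_eq_iff field_simps indicator_def intro!: sum.cong)
  have s: "{x. real i / k < f x} \<in> sets M" "{x. real i / k \<le> f x} \<in> sets M" for i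
    by (simp_all add: M(1))
  have int: "integrable M P" "integrable M Q"
    unfolding P' Q' using s by (auto intro!: Bochner_Integration.integrable_sum integrable_real_indicator simp: less_top[symmetric])
  have val: "(\<integral>x. P x \<partial>M) = (\<Sum>i=1..k. measure M {x. real i / k < f x})"
    "(\<integral>x. Q x \<partial>M) = (\<Sum>i=1..k. measure M {x. real i / k \<le> f x})"
    unfolding P' Q' using s
    by (subst Bochner_Integration.integral_sum; auto intro!: integrable_real_indicator simp: less_top[symmetric])+
  have "(\<integral>x. P x \<partial>M) \<le> (\<integral>x. k * f x \<partial>M)" "(\<integral>x. Q x \<partial>M) \<le> (\<integral>x. k * f x \<partial>M)"
    using int fint PQ by (intro integral_mono; simp)+
  moreover have "(\<integral>x. k * f x \<partial>M) \<le> (\<integral>x. P x + 1 \<partial>M)" "(\<integral>x. k * f x \<partial>M) \<le> (\<integral>x. Q x + 1 \<partial>M)"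
    using int fint PQ by (intro integral_mono; simp)+
  moreover have "(\<integral>x. P x + 1 \<partial>M) \<le> (\<integral>x. P x \<partial>M) + 1" "(\<integral>x. Q x + 1 \<partial>M) \<le> (\<integral>x. Q x \<partial>M) + 1"
    using int M(3) by auto
  ultimately show "(\<Sum>i=1..k. measure M {x. real i / k < f x}) / k \<le> (\<integral>x. f x \<partial>M)"
    "(\<integral>x. f x \<partial>M) \<le> (\<Sum>i=1..k. measure M {x. real i / k < f x}) / k + 1 / k"
    "(\<Sum>i=1..k. measure M {x. real i / k \<le> f x}) / k \<le> (\<integral>x. f x \<partial>M)"
    "(\<integral>x. f x \<partial>M) \<le> (\<Sum>i=1..k. measure M {x. real i / k \<le> f x}) / k + 1 / k"
    unfolding val[symmetric] using k by (simp_all add: field_simps)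
qed

lemma weak_star_convI_unit:
  fixes M :: "nat \<Rightarrow> 'a::t2_space measure"
  assumes "\<And>f. f \<in> Cc \<Longrightarrow> (\<And>x. 0 \<le> f x) \<Longrightarrow> (\<And>x. f x \<le> 1) \<Longrightarrow> (\<lambda>n. \<integral>x. f x \<partial>M n) \<longlonglongrightarrow> (\<integral>x. f x \<partial>L)"
    and M: "\<And>n. sets (M n) = sets borel" "\<And>n. finite_measure (M n)"
    and L: "sets L = sets borel" "finite_measure L"
  shows "weak_star_conv M L"
  unfolding weak_star_conv_def
proof
  fix f :: "'a \<Rightarrow> real" assume f: "f \<in> Cc"
  obtain C where C: "0 < C" "\<And>x. \<bar>f x\<bar> \<le> C" using Cc_bounded[OF f] by blast
  define p q where "p x = max (f x) 0 / C" and "q x = max (- f x) 0 / C" for x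
  have cont: "continuous_on UNIV f" using f by (simp add: Cc_def)
  have pq: "p \<in> Cc" "q \<in> Cc"
    using C(1) by (auto intro!: CcI_dominated[OF _ f] continuous_intros cont simp: p_def q_def)
  have bnd: "0 \<le> p x" "p x \<le> 1" "0 \<le> q x" "q x \<le> 1" for x
    using C(1) C(2)[of x] by (auto simp: p_def q_def)
  have eq: "f x = C * p x - C * q x" for x
    using C(1) by (auto simp: p_def q_def max_def)
  have int: "(\<integral>x. f x \<partial>N) = C * (\<integral>x. p x \<partial>N) - C * (\<integral>x. q x \<partial>N)"
    if "sets N = sets borel" "finite_measure N" for N
    unfolding eq using Cc_integrable[OF pq(1) that(2,1)] Cc_integrable[OF pq(2) that(2,1)] by simp
  show "(\<lambda>n. \<integral>x. f x \<partial>M n) \<longlonglongrightarrow> (\<integral>x. f x \<partial>L)"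
    unfolding int[OF M] int[OF L] by (intro tendsto_intros assms(1) pq bnd)
qed

lemma compact_superlevel_Cc:
  fixes f :: "'a::t2_space \<Rightarrow> real"
  assumes "f \<in> Cc" "0 < c"
  shows "compact {x. c \<le> f x}"
proof -
  have "closed {x. c \<le> f x}"
    using assms(1) by (intro closed_Collect_le) (auto simp: Cc_def)
  moreover have "{x. c \<le> f x} \<subseteq> closure {x. f x \<noteq> 0}"
    using assms(2) closure_subset[of "{x. f x \<noteq> 0}"] by auto
  ultimately show ?thesis
    using assms(1) compact_Int_closed[of "closure {x. f x \<noteq> 0}" "{x. c \<le> f x}"]
    by (simp add: Cc_def Int_absorb1)
qed

lemma weak_star_convI_portmanteau:
  fixes M :: "nat \<Rightarrow> 'a::t2_space measure"
  assumes M: "\<And>n. sets (M n) = sets borel" "\<And>n. finite_measure (M n)" "\<And>n. measure (M n) UNIV \<le> 1"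
    and L: "sets L = sets borel" "finite_measure L" "measure L UNIV \<le> 1"
    and op: "\<And>G e. open G \<Longrightarrow> 0 < e \<Longrightarrow> \<forall>\<^sub>F n in sequentially. measure L G - e < measure (M n) G"
    and cpt: "\<And>K e. compact K \<Longrightarrow> 0 < e \<Longrightarrow> \<forall>\<^sub>F n in sequentially. measure (M n) K < measure L K + e"
  shows "weak_star_conv M L"
proof (rule weak_star_convI_unit[OF _ M(1,2) L(1,2)])
  fix f :: "'a \<Rightarrow> real" assume f: "f \<in> Cc" "\<And>x. 0 \<le> f x" "\<And>x. f x \<le> 1"
  show "(\<lambda>n. \<integral>x. f x \<partial>M n) \<longlonglongrightarrow> (\<integral>x. f x \<partial>L)"
  proof (rule tendstoI)
    fix e :: real assume e: "0 < e"
    obtain k where k: "k > 0" "1 / real k < e / 2"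
      using e by (metis half_gt_zero nat_approx_posE of_nat_Suc zero_less_Suc)
    have "\<forall>\<^sub>F n in sequentially. \<forall>i\<in>{1..k}. measure L {x. real i / k < f x} - e/2 < measure (M n) {x. real i / k < f x}"
      using f(1) e by (intro eventually_ball_finite ballI op open_Collect_less) (auto simp: Cc_def)
    \<comment> \<open>The levels start at \<open>i = 1\<close>, hence are positive, and the
      superlevel sets at positive levels are compact.\<close>
    moreover have "\<forall>\<^sub>F n in sequentially. \<forall>i\<in>{1..k}. measure (M n) {x. real i / k \<le> f x} < measure L {x. real i / k \<le> f x} + e/2"
      using f(1) e k by (intro eventually_ball_finite ballI cpt compact_superlevel_Cc) auto
    ultimately show "\<forall>\<^sub>F n in sequentially. dist (\<integral>x. f x \<partial>M n) (\<integral>x. f x \<partial>L) < e"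
    proof eventually_elim
      case (elim n)
      note bM = integral_layer_bounds[OF f k(1) M]
      note bL = integral_layer_bounds[OF f k(1) L]
      have "(\<Sum>i=1..k. measure L {x. real i / k < f x} - e/2) \<le> (\<Sum>i=1..k. measure (M n) {x. real i / k < f x})"
        using elim(1) by (intro sum_mono less_imp_le) auto
      then have 1: "(\<Sum>i=1..k. measure L {x. real i / k < f x}) / k - e/2 \<le> (\<Sum>i=1..k. measure (M n) {x. real i / k < f x}) / k"
        using k(1) by (auto simp: sum_subtractf diff_divide_distrib dest: divide_right_mono[of _ _ "real k"])
      have "(\<Sum>i=1..k. measure (M n) {x. real i / k \<le> f x}) \<le> (\<Sum>i=1..k. measure L {x. real i / k \<le> f x} + e/2)"
        using elim(2) by (intro sum_mono less_imp_le) auto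
      then have 2: "(\<Sum>i=1..k. measure (M n) {x. real i / k \<le> f x}) / k \<le> (\<Sum>i=1..k. measure L {x. real i / k \<le> f x}) / k + e/2"
        using k(1) by (auto simp: sum.distrib add_divide_distrib dest: divide_right_mono[of _ _ "real k"])
      show ?case
        using 1 2 bM(1)[of n] bM(4)[of n] bL(2,3) k(2) by (simp add: dist_real_def)
    qed
  qed
qed

text \<open>The limit is built from its values on countably many relatively compact open sets
  instead of through a representation theorem for functionals on C_c(X). Only such sets contribute
  to \<open>L\<close>, so mass that moves to infinity is lost and the total mass may drop.\<close>

theorem weak_star_sequentially_compact:
  fixes M :: "nat \<Rightarrow> 'a::{t2_space, second_countable_topology} measure"
  assumes lc: "locally_compact_space (euclidean :: 'a topology)"
    and M: "\<And>n. sets (M n) = sets borel" "\<And>n. finite_measure (M n)" "\<And>n. measure (M n) UNIV \<le> 1"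
  obtains r L where "strict_mono r" "sets L = sets borel" "finite_measure L" "measure L UNIV \<le> 1"
    "weak_star_conv (M \<circ> r) L"
proof -
  obtain B0 :: "'a set set" where B0: "countable B0" "topological_basis B0" using ex_countable_basis by blast
  define B where "B = {\<Union>F | F. finite F \<and> F \<subseteq> B0 \<and> compact (closure (\<Union>F))}"
  have "B \<subseteq> Union ` {F. finite F \<and> F \<subseteq> B0}" by (auto simp: B_def)
  then have cB: "countable B"
    by (rule countable_subset) (intro countable_image countable_Collect_finite_subset B0(1))
  have op: "open W" if "W \<in> B" for W
    using that topological_basis_open[OF B0(2)] by (auto simp: B_def)
  have cpt: "compact (closure W)" if "W \<in> B" for W
    using that by (auto simp: B_def)
  have empty: "{} \<in> B" unfolding B_def by (intro CollectI exI[of _ "{}"]) auto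
  have Un: "V \<union> W \<in> B" if VW: "V \<in> B" "W \<in> B" for V W
  proof -
    obtain F G where "V = \<Union>F" "finite F" "F \<subseteq> B0" "W = \<Union>G" "finite G" "G \<subseteq> B0"
      using VW by (auto simp: B_def)
    then show ?thesis unfolding B_def
      using cpt[OF VW(1)] cpt[OF VW(2)] by (intro CollectI exI[of _ "F \<union> G"]) (auto simp: closure_Un)
  qed
  have sandwich: "\<exists>W\<in>B. K \<subseteq> W \<and> closure W \<subseteq> U" if "compact K" "open U" "K \<subseteq> U" for K U
    by (rule compact_open_sandwich_basis[OF lc B0(2) that]) (auto simp: B_def)
  have nbhd: "\<exists>W\<in>B. x \<in> W \<and> closure W \<subseteq> U" if "open U" "x \<in> U" for x U
    using sandwich[of "{x}" U] that by auto
  define W where "W = from_nat_into B"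
  have rangeW: "range W = B" unfolding W_def using cB empty by (intro range_from_nat_into) auto
  have [simp]: "space (M n) = UNIV" for n using sets_eq_imp_space_eq[OF M(1)] by simp
  have le1M: "measure (M n) A \<le> 1" for n A
    using finite_measure.bounded_measure[OF M(2)[of n], of A] M(3)[of n] by simp
  have "measure (M n) (W i) \<in> {0..1}" for i n using le1M by simp
  from diagonal_convergent_subsequence[of "\<lambda>i n. measure (M n) (W i)", OF this]
  obtain r l where r: "strict_mono r" and l: "\<And>i. (\<lambda>n. measure (M (r n)) (W i)) \<longlonglongrightarrow> l i"
    by blast
  define m' where "m' V = lim (\<lambda>n. measure (M (r n)) V)" for V
  have lim: "(\<lambda>n. measure (M (r n)) V) \<longlonglongrightarrow> m' V" if "V \<in> B" for V
  proof -
    obtain i where "V = W i" using \<open>V \<in> B\<close> rangeW by blast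
    then show ?thesis using l[of i] limI[OF l[of i]] by (simp add: m'_def)
  qed
  have m'_nonneg: "0 \<le> m' V" if "V \<in> B" for V
    by (rule LIMSEQ_le_const[OF lim[OF that]]) auto
  have m'_le: "m' V \<le> 1" if "V \<in> B" for V
    using le1M by (intro LIMSEQ_le_const2[OF lim[OF that]]) auto
  have inM: "V \<in> sets (M n)" if "V \<in> B" for V n using op[OF that] by (simp add: M(1))
  have "\<exists>\<kappa>. sets \<kappa> = sets borel \<and>
    (\<forall>G. open G \<longrightarrow> emeasure \<kappa> G = (SUP W\<in>{W\<in>B. closure W \<subseteq> G}. ennreal (m' W))) \<and>
    (\<forall>E\<in>sets borel. emeasure \<kappa> E = (INF G\<in>{G. open G \<and> E \<subseteq> G}. emeasure \<kappa> G))"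
  proof (rule measure_of_content[of B "\<lambda>V. ennreal (m' V)", OF op cpt empty Un nbhd])
    show "ennreal (m' {}) = 0" by (simp add: m'_def)
    show "ennreal (m' V) \<le> ennreal (m' W)" if "V \<in> B" "W \<in> B" "V \<subseteq> W" for V W
      using that inM by (intro ennreal_leI LIMSEQ_le[OF lim lim] exI[of _ 0] allI impI
          finite_measure.finite_measure_mono[OF M(2)]) auto
    show "ennreal (m' (V \<union> W)) \<le> ennreal (m' V) + ennreal (m' W)" if "V \<in> B" "W \<in> B" for V W
      unfolding ennreal_plus[OF m'_nonneg[OF that(1)] m'_nonneg[OF that(2)], symmetric]
      using that inM
      by (intro ennreal_leI LIMSEQ_le[OF lim tendsto_add[OF lim lim]] exI[of _ 0] allI impI Un measure_Un_le) auto
    show "ennreal (m' (V \<union> W)) = ennreal (m' V) + ennreal (m' W)" if "V \<in> B" "W \<in> B" "V \<inter> W = {}" for V W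
    proof -
      have "(\<lambda>n. measure (M (r n)) (V \<union> W)) = (\<lambda>n. measure (M (r n)) V + measure (M (r n)) W)"
        using that inM by (intro ext finite_measure.finite_measure_Union[OF M(2)]) auto
      then have "m' (V \<union> W) = m' V + m' W"
        using LIMSEQ_unique[OF lim[OF Un[OF that(1,2)]]] tendsto_add[OF lim[OF that(1)] lim[OF that(2)]] by simp
      then show ?thesis using that m'_nonneg by simp
    qed
  qed
  then obtain L where L': "sets L = sets borel"
      "\<forall>G. open G \<longrightarrow> emeasure L G = (SUP W\<in>{W\<in>B. closure W \<subseteq> G}. ennreal (m' W))"
      "\<forall>E\<in>sets borel. emeasure L E = (INF G\<in>{G. open G \<and> E \<subseteq> G}. emeasure L G)"
    by (elim exE conjE) (rule that)
  note L = L'(1) L'(2)[rule_format] L'(3)[rule_format]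
  have [simp]: "space L = UNIV" using sets_eq_imp_space_eq[OF L(1)] by simp
  have le1: "emeasure L UNIV \<le> 1"
    unfolding L(2)[OF open_UNIV] by (intro SUP_least) (auto intro!: m'_le)
  have fin: "finite_measure L"
    using le1 by (intro finite_measureI) (auto simp: top_unique)
  interpret L: finite_measure L by (rule fin)
  have L1: "measure L UNIV \<le> 1"
    using le1 by (simp add: L.emeasure_eq_measure)
  have "weak_star_conv (M \<circ> r) L"
  proof (rule weak_star_convI_portmanteau)
    fix G :: "'a set" and e :: real assume G: "open G" and e: "0 < e"
    show "\<forall>\<^sub>F n in sequentially. measure L G - e < measure ((M \<circ> r) n) G"
    proof (cases "measure L G - e < 0")
      case True
      then show ?thesis by (intro always_eventually allI) (rule less_le_trans[OF _ measure_nonneg])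
    next
      case False
      have "ennreal (measure L G - e) < emeasure L G"
        using e False by (simp add: L.emeasure_eq_measure ennreal_less_iff)
      then obtain V where V: "V \<in> B" "closure V \<subseteq> G" "ennreal (measure L G - e) < ennreal (m' V)"
        unfolding L(2)[OF G] less_SUP_iff by auto
      have "measure L G - e < m' V"
        using V(3) False by (simp add: ennreal_less_iff)
      then have "\<forall>\<^sub>F n in sequentially. measure L G - e < measure (M (r n)) V"
        by (rule order_tendstoD(1)[OF lim[OF V(1)]])
      then show ?thesis
      proof eventually_elim
        case (elim n)
        have "V \<subseteq> G" using V closure_subset by blast
        then have "measure (M (r n)) V \<le> measure (M (r n)) G"
          using G by (intro finite_measure.finite_measure_mono[OF M(2)]) (auto simp: M(1))
        with elim show ?case by simp
      qed
    qed
  next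
    fix K :: "'a set" and e :: real assume K: "compact K" and e: "0 < e"
    have Kb: "K \<in> sets borel" using K by (simp add: borel_compact)
    have "emeasure L K < ennreal (measure L K + e)"
      using e by (simp add: L.emeasure_eq_measure ennreal_less_iff)
    then obtain G where G: "open G" "K \<subseteq> G" "emeasure L G < ennreal (measure L K + e)"
      unfolding L(3)[OF Kb] INF_less_iff by auto
    \<comment> \<open>Convergence along \<open>r\<close> is known on members of \<open>B\<close>
      only, so \<open>K\<close> is enclosed in such a \<open>V\<close>; its closure stays in
      \<open>G\<close>, which gives \<open>m' V \<le> L G\<close>.\<close>
    obtain V where V: "V \<in> B" "K \<subseteq> V" "closure V \<subseteq> G" using sandwich[OF K G(1,2)] by auto
    have "ennreal (m' V) \<le> emeasure L G"
      unfolding L(2)[OF G(1)] using V by (intro SUP_upper) auto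
    also note G(3)
    finally have "m' V < measure L K + e" using m'_nonneg[OF V(1)] by (simp add: ennreal_less_iff)
    then have "\<forall>\<^sub>F n in sequentially. measure (M (r n)) V < measure L K + e"
      by (rule order_tendstoD(2)[OF lim[OF V(1)]])
    then show "\<forall>\<^sub>F n in sequentially. measure ((M \<circ> r) n) K < measure L K + e"
    proof eventually_elim
      case (elim n)
      have "measure (M (r n)) K \<le> measure (M (r n)) V"
        using V inM by (intro finite_measure.finite_measure_mono[OF M(2)]) auto
      with elim show ?case by simp
    qed
  qed (use M L fin L1 in auto)
  with r L(1) fin L1 show ?thesis by (intro that)
qed

subsection \<open>The mean ergodic theorem\<close>

definition birkhoff_average :: "('a \<Rightarrow> 'a) \<Rightarrow> ('a \<Rightarrow> real) \<Rightarrow> nat \<Rightarrow> 'a \<Rightarrow> real" where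
  "birkhoff_average S f n x = (\<Sum>i<n. f ((S ^^ i) x)) / n"

lemma birkhoff_average_bounded:
  assumes "\<And>x. \<bar>f x\<bar> \<le> C"
  shows "\<bar>birkhoff_average S f n x\<bar> \<le> C"
proof (cases "n = 0")
  case True
  then show ?thesis using assms[of x] by (simp add: birkhoff_average_def)
next
  case False
  have "\<bar>\<Sum>i<n. f ((S ^^ i) x)\<bar> \<le> (\<Sum>i<n. C)"
    by (rule order_trans[OF sum_abs sum_mono]) (rule assms)
  with False show ?thesis by (simp add: birkhoff_average_def field_simps)
qed

lemma birkhoff_average_shift:
  assumes "\<And>x. \<bar>f x\<bar> \<le> C"
  shows "\<bar>birkhoff_average S f N ((S ^^ j) x) - birkhoff_average S f N x\<bar> \<le> 2 * real j * C / N"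
proof (induction j)
  case (Suc j)
  let ?y = "(S ^^ j) x"
  have eq: "(\<Sum>i<N. f ((S ^^ i) (S ?y))) - (\<Sum>i<N. f ((S ^^ i) ?y)) = f ((S ^^ N) ?y) - f ?y"
    by (induction N) (auto simp: funpow_swap1)
  have "\<bar>f ((S ^^ N) ?y) - f ?y\<bar> \<le> 2 * C"
    using assms[of "(S ^^ N) ?y"] assms[of ?y] by linarith
  then have "\<bar>birkhoff_average S f N (S ?y) - birkhoff_average S f N ?y\<bar> \<le> 2 * C / N"
    unfolding birkhoff_average_def diff_divide_distrib[symmetric] eq
    by (simp add: abs_divide divide_right_mono)
  with Suc.IH have "\<bar>birkhoff_average S f N (S ?y) - birkhoff_average S f N x\<bar> \<le> 2 * real j * C / N + 2 * C / N"
    by linarith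
  then show ?case by (simp add: algebra_simps add_divide_distrib)
qed simp

text \<open>Both averaging operators are polynomials in composition with \<open>S\<close> and
  therefore commute. An average of length \<open>N\<close> of a short average thereby becomes a mean
  of shifts of the long average.\<close>

lemma birkhoff_average_twice:
  "birkhoff_average S (birkhoff_average S f n) N x = birkhoff_average S (birkhoff_average S f N) n x"
proof -
  have "(\<Sum>i<N. \<Sum>j<n. f ((S ^^ (j + i)) x)) = (\<Sum>i<n. \<Sum>j<N. f ((S ^^ (j + i)) x))"
    by (subst sum.swap) (simp add: add.commute)
  then show ?thesis
    by (simp add: birkhoff_average_def funpow_add sum_divide_distrib[symmetric])
qed

lemma birkhoff_average_diff_const:
  assumes "0 < n"
  shows "birkhoff_average S g n x - c = (\<Sum>i<n. g ((S ^^ i) x) - c) / n"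
  using assms by (simp add: birkhoff_average_def sum_subtractf diff_divide_distrib)

text \<open>After commuting, the first term is a mean of \<open>n\<close> shifts of the average of
  length \<open>N\<close>, and each such shift moves that average by at most
  \<open>2 * n * C / N\<close>. Short averages are thus absorbed by long ones.\<close>

lemma birkhoff_average_absorb:
  assumes C: "\<And>x. \<bar>f x\<bar> \<le> C" and n: "0 < n"
  shows "\<bar>birkhoff_average S (birkhoff_average S f n) N x - birkhoff_average S f N x\<bar> \<le> 2 * real n * C / N"
proof -
  have C0: "0 \<le> C" using C[of undefined] by simp
  have "\<bar>\<Sum>i<n. birkhoff_average S f N ((S ^^ i) x) - birkhoff_average S f N x\<bar> \<le> (\<Sum>i<n. 2 * real n * C / N)"
  proof (rule order_trans[OF sum_abs sum_mono])
    fix i assume "i \<in> {..<n}"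
    then have "2 * real i * C / N \<le> 2 * real n * C / N"
      using C0 by (intro divide_right_mono mult_right_mono mult_left_mono) auto
    then show "\<bar>birkhoff_average S f N ((S ^^ i) x) - birkhoff_average S f N x\<bar> \<le> 2 * real n * C / N"
      using birkhoff_average_shift[where S=S and f=f and N=N and j=i and x=x, OF C] by linarith
  qed
  then have "\<bar>\<Sum>i<n. birkhoff_average S f N ((S ^^ i) x) - birkhoff_average S f N x\<bar> \<le> n * (2 * real n * C / N)"
    by simp
  then show ?thesis
    unfolding birkhoff_average_twice[of S f n] birkhoff_average_diff_const[OF n] abs_divide
    using n by (simp add: pos_divide_le_eq mult.commute)
qed

lemma birkhoff_average_measurable:
  assumes "S \<in> measurable M M" "f \<in> borel_measurable M"
  shows "birkhoff_average S f n \<in> borel_measurable M"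
proof -
  have [measurable]: "(S ^^ i) \<in> measurable M M" for i
    using assms(1) by (rule measurable_compose_n)
  note assms(2)[measurable]
  show ?thesis unfolding birkhoff_average_def[abs_def] by measurable
qed

lemma birkhoff_average_square_le:
  "(birkhoff_average S f n x)\<^sup>2 \<le> birkhoff_average S (\<lambda>x. (f x)\<^sup>2) n x"
proof (cases "n = 0")
  case False
  have "(\<Sum>i<n. f ((S ^^ i) x))\<^sup>2 \<le> (\<Sum>i<n. (f ((S ^^ i) x))\<^sup>2) * real n"
    using sum_squared_le_sum_of_squares[of "\<lambda>i. f ((S ^^ i) x)" "{..<n}"] by (simp add: mult.commute)
  then show ?thesis
    using False by (simp add: birkhoff_average_def power_divide field_simps power2_eq_square)
qed (simp add: birkhoff_average_def)

section \<open>Orbit averages under a probability-preserving map\<close>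

locale measure_preserving = prob_space M for M :: "'a measure" +
  fixes S :: "'a \<Rightarrow> 'a"
  assumes S_measurable [measurable]: "S \<in> measurable M M" and distr_S: "distr M M S = M"
begin

lemma funpow_measurable [measurable]: "(S ^^ i) \<in> measurable M M"
  using S_measurable by (rule measurable_compose_n)

lemma distr_funpow: "distr M M (S ^^ i) = M"
proof (induction i)
  case (Suc i)
  have "distr M M (S \<circ> S ^^ i) = distr (distr M M (S ^^ i)) M S"
    by (rule distr_distr[symmetric]) auto
  then show ?case by (simp add: Suc distr_S o_def)
qed (simp add: distr_id2)

lemma average_measurable [measurable (raw)]:
  "f \<in> borel_measurable M \<Longrightarrow> birkhoff_average S f n \<in> borel_measurable M"
  by (rule birkhoff_average_measurable[OF S_measurable])

lemma bounded_integrable: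
  fixes f :: "'a \<Rightarrow> real"
  assumes "f \<in> borel_measurable M" "\<And>x. \<bar>f x\<bar> \<le> C"
  shows "integrable M f"
  using assms by (intro integrable_const_bound[where B=C]) auto

lemma average_integrable:
  fixes f :: "'a \<Rightarrow> real"
  assumes "f \<in> borel_measurable M" "\<And>x. \<bar>f x\<bar> \<le> C"
  shows "integrable M (birkhoff_average S f n)"
  by (rule bounded_integrable[OF average_measurable[OF assms(1)]
      birkhoff_average_bounded[where f=f and C=C, OF assms(2)]])

lemma integral_funpow:
  fixes f :: "'a \<Rightarrow> real"
  assumes "f \<in> borel_measurable M"
  shows "(\<integral>x. f ((S ^^ i) x) \<partial>M) = (\<integral>x. f x \<partial>M)"
  using integral_distr[OF funpow_measurable[of i] assms] by (simp add: distr_funpow)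

lemma integral_average:
  fixes f :: "'a \<Rightarrow> real"
  assumes f[measurable]: "f \<in> borel_measurable M" and C: "\<And>x. \<bar>f x\<bar> \<le> C" and "0 < n"
  shows "(\<integral>x. birkhoff_average S f n x \<partial>M) = (\<integral>x. f x \<partial>M)"
proof -
  have "integrable M (\<lambda>x. f ((S ^^ i) x))" for i
    by (rule bounded_integrable[where C=C]) (use C in auto)
  then have "(\<integral>x. birkhoff_average S f n x \<partial>M) = (\<Sum>i<n. \<integral>x. f ((S ^^ i) x) \<partial>M) / n"
    by (simp add: birkhoff_average_def)
  then show ?thesis using \<open>0 < n\<close> by (simp add: integral_funpow)
qed

text \<open>An invariant weight passes through the averaging operator. In the limit of long averages
  this becomes the defining identity of the conditional expectation given the invariant
  sets.\<close>

lemma integral_invariant_mult_average: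
  fixes f w :: "'a \<Rightarrow> real"
  assumes f[measurable]: "f \<in> borel_measurable M" and C: "\<And>x. \<bar>f x\<bar> \<le> C" and "0 < n"
    and w[measurable]: "w \<in> borel_measurable M" and D: "\<And>x. \<bar>w x\<bar> \<le> D" and inv: "\<And>x. w (S x) = w x"
  shows "(\<integral>x. w x * birkhoff_average S f n x \<partial>M) = (\<integral>x. w x * f x \<partial>M)"
proof -
  have inv': "w ((S ^^ i) x) = w x" for i x by (induction i) (auto simp: inv)
  have "w x * birkhoff_average S f n x = birkhoff_average S (\<lambda>x. w x * f x) n x" for x
    by (simp add: birkhoff_average_def inv' sum_distrib_left)
  moreover have "\<bar>w x * f x\<bar> \<le> D * C" for x
    unfolding abs_mult using C[of x] D[of x] by (intro mult_mono) auto
  ultimately show ?thesis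
    using integral_average[of "\<lambda>x. w x * f x" "D * C" n] \<open>0 < n\<close> by simp
qed

lemma integral_average_square_le:
  fixes f :: "'a \<Rightarrow> real"
  assumes f[measurable]: "f \<in> borel_measurable M" and C: "\<And>x. \<bar>f x\<bar> \<le> C" and n: "0 < n"
  shows "(\<integral>x. (birkhoff_average S f n x)\<^sup>2 \<partial>M) \<le> (\<integral>x. (f x)\<^sup>2 \<partial>M)"
proof -
  have sq: "\<bar>(f x)\<^sup>2\<bar> \<le> C\<^sup>2" for x using power_mono[OF C[of x], of 2] by simp
  have "\<bar>(birkhoff_average S f n x)\<^sup>2\<bar> \<le> C\<^sup>2" for x
    using power_mono[OF birkhoff_average_bounded[where f=f, OF C], of S n x 2] by simp
  then have "(\<integral>x. (birkhoff_average S f n x)\<^sup>2 \<partial>M) \<le> (\<integral>x. birkhoff_average S (\<lambda>x. (f x)\<^sup>2) n x \<partial>M)"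
    using sq by (intro integral_mono bounded_integrable[of _ "C\<^sup>2"] average_integrable[of _ "C\<^sup>2"]
        birkhoff_average_square_le) auto
  also have "\<dots> = (\<integral>x. (f x)\<^sup>2 \<partial>M)"
    using sq n by (intro integral_average[where C="C\<^sup>2"]) auto
  finally show ?thesis .
qed

text \<open>Averaging once more over a long window turns any convex combination of averages of \<open>f\<close> into
  an average of \<open>f\<close> up to a uniformly small error. Hence no such combination can have a much smaller
  \<open>L\<^sup>2\<close> norm than the long averages, and the parallelogram identity yields the Cauchy property.\<close>

lemma integral_square_average_le:
  fixes f g :: "'a \<Rightarrow> real"
  assumes f[measurable]: "f \<in> borel_measurable M" and C: "\<And>x. \<bar>f x\<bar> \<le> C"
    and g[measurable]: "g \<in> borel_measurable M" and gC: "\<And>x. \<bar>g x\<bar> \<le> C"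
    and N: "0 < N" and near: "\<And>x. \<bar>birkhoff_average S g N x - birkhoff_average S f N x\<bar> \<le> e"
  shows "(\<integral>x. (birkhoff_average S f N x)\<^sup>2 \<partial>M) \<le> (\<integral>x. (g x)\<^sup>2 \<partial>M) + 2 * C * e"
proof -
  let ?F = "birkhoff_average S f N" and ?G = "birkhoff_average S g N"
  have FG: "\<bar>?F x\<bar> \<le> C" "\<bar>?G x\<bar> \<le> C" for x
    by (rule birkhoff_average_bounded[where f=f, OF C] birkhoff_average_bounded[where f=g, OF gC])+
  have bd: "\<bar>(?F x)\<^sup>2\<bar> \<le> C\<^sup>2" "\<bar>(?G x)\<^sup>2\<bar> \<le> C\<^sup>2" for x
    using power_mono[OF FG(1)[of x], of 2] power_mono[OF FG(2)[of x], of 2] by auto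
  have *: "(?F x)\<^sup>2 \<le> (?G x)\<^sup>2 + 2 * C * e" for x
  proof -
    have "(?F x)\<^sup>2 - (?G x)\<^sup>2 = (?F x + ?G x) * (?F x - ?G x)"
      by (simp add: power2_eq_square algebra_simps)
    also have "\<dots> \<le> \<bar>?F x + ?G x\<bar> * \<bar>?F x - ?G x\<bar>"
      by (metis abs_ge_self abs_mult)
    also have "\<dots> \<le> (2 * C) * e"
      using FG[of x] near[of x] by (intro mult_mono) auto
    finally show ?thesis by simp
  qed
  have int: "integrable M (\<lambda>x. (?F x)\<^sup>2)" "integrable M (\<lambda>x. (?G x)\<^sup>2)"
    using bd by (auto intro!: bounded_integrable[where C="C\<^sup>2"])
  have "(\<integral>x. (?F x)\<^sup>2 \<partial>M) \<le> (\<integral>x. (?G x)\<^sup>2 + 2 * C * e \<partial>M)"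
    using int by (intro integral_mono * Bochner_Integration.integrable_add) auto
  also have "\<dots> = (\<integral>x. (?G x)\<^sup>2 \<partial>M) + 2 * C * e"
    using int by (simp add: prob_space)
  also have "(\<integral>x. (?G x)\<^sup>2 \<partial>M) \<le> (\<integral>x. (g x)\<^sup>2 \<partial>M)"
    by (rule integral_average_square_le[OF g gC N])
  finally show ?thesis by simp
qed

theorem mean_ergodic_Cauchy:
  fixes f :: "'a \<Rightarrow> real"
  assumes f[measurable]: "f \<in> borel_measurable M" and C: "\<And>x. \<bar>f x\<bar> \<le> C" and "0 < e"
  shows "\<exists>N. \<forall>n\<ge>N. \<forall>m\<ge>N. (\<integral>x. (birkhoff_average S f n x - birkhoff_average S f m x)\<^sup>2 \<partial>M) \<le> e"
proof -
  let ?A = "birkhoff_average S f"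
  define q where "q n = (\<integral>x. (?A n x)\<^sup>2 \<partial>M)" for n
  have C0: "0 \<le> C" using C[of undefined] by simp
  have AC: "\<bar>?A n x\<bar> \<le> C" for n x by (rule birkhoff_average_bounded[where f=f, OF C])
  have q0: "0 \<le> q n" for n by (simp add: q_def)
  define L where "L = (INF n\<in>{1..}. q n)"
  have bdd: "bdd_below (q ` {1..})" using q0 by (intro bdd_belowI[of _ 0]) auto
  have Lq: "L \<le> q n" if "1 \<le> n" for n
    unfolding L_def using bdd that by (intro cINF_lower) auto
  have L_le: "L \<le> (\<integral>x. (g x)\<^sup>2 \<partial>M)"
    if g[measurable]: "g \<in> borel_measurable M" and gC: "\<And>x. \<bar>g x\<bar> \<le> C"
      and near: "\<And>N x. \<bar>birkhoff_average S g N x - ?A N x\<bar> \<le> D / N" for g D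
  proof (rule LIMSEQ_le_const)
    show "(\<lambda>N. (\<integral>x. (g x)\<^sup>2 \<partial>M) + 2 * C * (D / real N)) \<longlonglongrightarrow> (\<integral>x. (g x)\<^sup>2 \<partial>M)"
      by (rule tendsto_eq_intros lim_const_over_n | simp)+
    show "\<exists>N. \<forall>n\<ge>N. L \<le> (\<integral>x. (g x)\<^sup>2 \<partial>M) + 2 * C * (D / real n)"
    proof (intro exI[of _ 1] allI impI)
      fix n :: nat assume "1 \<le> n"
      then show "L \<le> (\<integral>x. (g x)\<^sup>2 \<partial>M) + 2 * C * (D / real n)"
        using Lq[of n] integral_square_average_le[OF f C g gC _ near, of n] by (simp add: q_def)
    qed
  qed
  have "\<exists>N. \<forall>n\<ge>N. q n \<le> L + e / 4"
  proof -
    \<comment> \<open>One share \<open>e / 8\<close> pays for choosing \<open>n0\<close> near the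
      infimum, the other for absorbing the average of length \<open>n0\<close> into longer ones. So
      \<open>q\<close> is close to its infimum at all late times, not just at some.\<close>
    have "L < L + e / 8" using \<open>0 < e\<close> by simp
    then obtain n0 where n0: "1 \<le> n0" "q n0 < L + e / 8"
      unfolding L_def using cINF_less_iff[OF _ bdd] by (metis atLeast_iff empty_iff order_refl)
    have q_le: "q N \<le> q n0 + 2 * C * (2 * real n0 * C / N)" if "1 \<le> N" for N
      unfolding q_def
      by (rule integral_square_average_le[OF f C average_measurable[OF f] AC _ birkhoff_average_absorb[where f=f, OF C]])
         (use that n0 in auto)
    have "(\<lambda>N. 2 * C * (2 * real n0 * C / real N)) \<longlonglongrightarrow> 0"
      by (rule tendsto_eq_intros lim_const_over_n | simp)+
    then have "\<forall>\<^sub>F N in sequentially. 2 * C * (2 * real n0 * C / real N) < e / 8"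
      using \<open>0 < e\<close> by (intro order_tendstoD) auto
    then obtain N1 where N1: "\<And>N. N1 \<le> N \<Longrightarrow> 2 * C * (2 * real n0 * C / real N) < e / 8"
      unfolding eventually_sequentially by auto
    show ?thesis
    proof (intro exI[of _ "max 1 N1"] allI impI)
      fix n assume "max 1 N1 \<le> n"
      then show "q n \<le> L + e / 4"
        using q_le[of n] N1[of n] n0 by auto
    qed
  qed
  then obtain N where N: "\<And>n. N \<le> n \<Longrightarrow> q n \<le> L + e / 4" by blast
  show ?thesis
  proof (intro exI[of _ "max 1 N"] allI impI)
    fix n m assume n: "max 1 N \<le> n" and m: "max 1 N \<le> m"
    \<comment> \<open>The midpoint of two late averages: its squared norm is at least
      \<open>L\<close>, theirs are at most \<open>L + e / 4\<close>, and the parallelogram identity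
      leaves 4 (L + e/4) - 4 L = e.\<close>
    define g where "g x = (?A n x + ?A m x) / 2" for x
    have g[measurable]: "g \<in> borel_measurable M" unfolding g_def by measurable
    have gC: "\<bar>g x\<bar> \<le> C" for x using AC[of n x] AC[of m x] by (simp add: g_def)
    have near: "\<bar>birkhoff_average S g K x - ?A K x\<bar> \<le> (2 * real (n + m) * C) / K" for K x
    proof -
      have "birkhoff_average S g K x = (birkhoff_average S (?A n) K x + birkhoff_average S (?A m) K x) / 2"
        by (simp add: birkhoff_average_def[of S g] birkhoff_average_def[of S "?A n"] birkhoff_average_def[of S "?A m"]
            g_def sum.distrib add_divide_distrib flip: sum_divide_distrib)
      moreover have "\<bar>birkhoff_average S (?A n) K x - ?A K x\<bar> \<le> 2 * real n * C / K"
        "\<bar>birkhoff_average S (?A m) K x - ?A K x\<bar> \<le> 2 * real m * C / K"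
        using n m by (auto intro!: birkhoff_average_absorb[where f=f, OF C])
      moreover have "2 * real (n + m) * C / K = 2 * real n * C / K + 2 * real m * C / K"
        by (simp add: algebra_simps add_divide_distrib)
      moreover have "0 \<le> 2 * real n * C / K" "0 \<le> 2 * real m * C / K" using C0 by auto
      ultimately show ?thesis by (simp add: abs_le_iff field_simps)
    qed
    have Lg: "L \<le> (\<integral>x. (g x)\<^sup>2 \<partial>M)" by (rule L_le[OF g gC near])
    have sq: "\<bar>(h x)\<^sup>2\<bar> \<le> C\<^sup>2" if "\<And>x. \<bar>h x\<bar> \<le> C" for h :: "'a \<Rightarrow> real" and x
      using power_mono[OF that[of x], of 2] by simp
    have int: "integrable M (\<lambda>x. (?A n x)\<^sup>2)" "integrable M (\<lambda>x. (?A m x)\<^sup>2)" "integrable M (\<lambda>x. (g x)\<^sup>2)"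
      by (auto intro!: bounded_integrable[where C="C\<^sup>2"] sq AC gC)
    have "(\<integral>x. (?A n x - ?A m x)\<^sup>2 \<partial>M) = (\<integral>x. 2 * (?A n x)\<^sup>2 + 2 * (?A m x)\<^sup>2 - 4 * (g x)\<^sup>2 \<partial>M)"
      by (intro Bochner_Integration.integral_cong) (auto simp: g_def power2_eq_square field_simps)
    also have "\<dots> = 2 * q n + 2 * q m - 4 * (\<integral>x. (g x)\<^sup>2 \<partial>M)"
      using int by (simp add: q_def)
    also have "\<dots> \<le> e" using N[of n] N[of m] Lg n m by simp
    finally show "(\<integral>x. (?A n x - ?A m x)\<^sup>2 \<partial>M) \<le> e" .
  qed
qed

end

subsection \<open>Empirical measures\<close>

text \<open>Read as a mixture over a uniformly chosen index, the measure inherits the integration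
  formula for \<open>\<bind>\<close>; its definition gives only a set function.\<close>

lemma cesaro_measure_eq_bind:
  assumes M: "\<And>n. 1 \<le> n \<Longrightarrow> n \<le> N \<Longrightarrow> sets (M n) = sets borel \<and> prob_space (M n)" and N: "0 < N"
  shows "cesaro_measure M N = uniform_count_measure {1..N} \<bind> M"
proof -
  have K: "M \<in> measurable (uniform_count_measure {1..N}) (subprob_algebra borel)"
    using M by (auto simp: measurable_cong_sets[OF sets_uniform_count_measure_count_space refl]
        space_subprob_algebra prob_space_imp_subprob_space)
  have ne: "space (uniform_count_measure {1..N}) \<noteq> {}"
    using N by (simp add: space_uniform_count_measure)
  show ?thesis
  proof (rule measure_eqI)
    show "sets (cesaro_measure M N) = sets (uniform_count_measure {1..N} \<bind> M)"
      using sets_bind[OF _ ne, of M borel] M by (simp add: space_uniform_count_measure)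
    fix A assume "A \<in> sets (cesaro_measure M N)"
    then have A: "A \<in> sets borel" by simp
    have "emeasure (uniform_count_measure {1..N} \<bind> M) A = (\<integral>\<^sup>+n. emeasure (M n) A \<partial>uniform_count_measure {1..N})"
      by (rule emeasure_bind[OF ne K A])
    also have "\<dots> = (\<Sum>n=1..N. emeasure (M n) A / N)"
      using N by (simp add: uniform_count_measure_def nn_integral_point_measure_finite ennreal_of_nat_eq_real_of_nat
          divide_ennreal_def inverse_ennreal inverse_eq_divide mult.commute)
    also have "\<dots> = (\<Sum>n=1..N. emeasure (M n) A) / N"
      by (simp add: divide_ennreal_def sum_distrib_right)
    finally show "emeasure (cesaro_measure M N) A = emeasure (uniform_count_measure {1..N} \<bind> M) A"
      using M A by (simp add: emeasure_cesaro_measure)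
  qed
qed

lemma integral_cesaro_measure:
  fixes f :: "'a::topological_space \<Rightarrow> real"
  assumes M: "\<And>n. 1 \<le> n \<Longrightarrow> n \<le> N \<Longrightarrow> sets (M n) = sets borel \<and> prob_space (M n)"
    and f: "f \<in> borel_measurable borel" "\<And>x. \<bar>f x\<bar> \<le> C" and N: "0 < N"
  shows "(\<integral>x. f x \<partial>cesaro_measure M N) = (\<Sum>n=1..N. \<integral>x. f x \<partial>M n) / N"
proof -
  have K: "M \<in> measurable (uniform_count_measure {1..N}) (subprob_algebra borel)"
    using M by (auto simp: measurable_cong_sets[OF sets_uniform_count_measure_count_space refl]
        space_subprob_algebra prob_space_imp_subprob_space)
  interpret prob_space "uniform_count_measure {1..N}"
    using N by (intro prob_space_uniform_count_measure) auto
  have ae: "AE n in uniform_count_measure {1..N}. emeasure (M n) (space (M n)) \<le> ennreal 1"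
    using M by (intro AE_I2) (auto simp: space_uniform_count_measure prob_space.emeasure_space_1)
  have "(\<integral>x. f x \<partial>(uniform_count_measure {1..N} \<bind> M)) = (\<integral>n. (\<integral>x. f x \<partial>M n) \<partial>uniform_count_measure {1..N})"
    by (rule integral_bind[OF f(1) f(2) K finite_measure_axioms ae])
  moreover have "cesaro_measure M N = uniform_count_measure {1..N} \<bind> M"
    by (rule cesaro_measure_eq_bind) (use M N in auto)
  ultimately show ?thesis by (simp only: integral_uniform_count_measure finite_atLeastAtMost card_atLeastAtMost) simp
qed

lemma emeasure_cesaro_measure_UNIV_le:
  assumes "\<And>n. 1 \<le> n \<Longrightarrow> n \<le> N \<Longrightarrow> sets (M n) = sets borel \<and> prob_space (M n)"
  shows "emeasure (cesaro_measure M N) UNIV \<le> 1"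
proof -
  have "emeasure (M n) UNIV = 1" if "1 \<le> n" "n \<le> N" for n
    using assms[OF that] prob_space.emeasure_space_1[of "M n"] sets_eq_imp_space_eq[of "M n" borel] by simp
  then have "emeasure (cesaro_measure M N) UNIV = (of_nat N / of_nat N :: ennreal)"
    using assms by (simp add: emeasure_cesaro_measure)
  then show ?thesis
    by (cases "N = 0") (auto simp: ennreal_of_nat_eq_real_of_nat divide_ennreal)
qed

lemma finite_cesaro_measure:
  assumes "\<And>n. 1 \<le> n \<Longrightarrow> n \<le> N \<Longrightarrow> sets (M n) = sets borel \<and> prob_space (M n)"
  shows "finite_measure (cesaro_measure M N)" "measure (cesaro_measure M N) UNIV \<le> 1"
proof -
  have le1: "emeasure (cesaro_measure M N) UNIV \<le> 1"
    by (rule emeasure_cesaro_measure_UNIV_le) (rule assms)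
  show "finite_measure (cesaro_measure M N)"
    using le1 by (intro finite_measureI) (auto simp: top_unique)
  then interpret finite_measure "cesaro_measure M N" .
  show "measure (cesaro_measure M N) UNIV \<le> 1"
    using le1 by (simp add: emeasure_eq_measure)
qed

lemma
  fixes f :: "'a::topological_space \<Rightarrow> real"
  shows integral_empirical_measure: "\<lbrakk>f \<in> borel_measurable borel; \<And>x. \<bar>f x\<bar> \<le> C; 0 < N\<rbrakk> \<Longrightarrow>
      (\<integral>x. f x \<partial>cesaro_measure (\<lambda>n. return borel (y n)) N) = (\<Sum>n=1..N. f (y n)) / N"
    and finite_empirical_measure: "finite_measure (cesaro_measure (\<lambda>n. return borel (y n)) N)"
    and empirical_measure_UNIV_le: "measure (cesaro_measure (\<lambda>n. return borel (y n)) N) UNIV \<le> 1"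
proof -
  have M: "sets (return borel (y n)) = sets borel \<and> prob_space (return borel (y n))" for n
    by (simp add: prob_space_return)
  show "(\<integral>x. f x \<partial>cesaro_measure (\<lambda>n. return borel (y n)) N) = (\<Sum>n=1..N. f (y n)) / N"
    if f: "f \<in> borel_measurable borel" "\<And>x. \<bar>f x\<bar> \<le> C" and "0 < N"
    using integral_cesaro_measure[of N "\<lambda>n. return borel (y n)", OF M f \<open>0 < N\<close>] f(1)
    by (simp add: integral_return)
  show "finite_measure (cesaro_measure (\<lambda>n. return borel (y n)) N)"
    "measure (cesaro_measure (\<lambda>n. return borel (y n)) N) UNIV \<le> 1"
    by (rule finite_cesaro_measure[OF M])+
qed

text \<open>Along a subsequence with rapid L2 rates the consecutive differences are summable in L1,
  so almost everywhere their series converges absolutely. The same subsequence must serve all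
  \<open>\<phi> j\<close>, since the empirical measures are later taken along it.\<close>

lemma (in measure_preserving) average_AE_convergent_subsequence:
  fixes \<phi> :: "nat \<Rightarrow> 'a \<Rightarrow> real"
  assumes \<phi>[measurable]: "\<And>j. \<phi> j \<in> borel_measurable M" and bd: "\<And>j x. \<bar>\<phi> j x\<bar> \<le> 1"
  shows "\<exists>r. strict_mono r \<and> (AE x in M. \<forall>j. convergent (\<lambda>k. birkhoff_average S (\<phi> j) (r k) x))"
proof -
  let ?A = "\<lambda>j. birkhoff_average S (\<phi> j)"
  have "\<exists>N. \<forall>n\<ge>N. \<forall>m\<ge>N. (\<integral>x. (?A j n x - ?A j m x)\<^sup>2 \<partial>M) \<le> (1/4)^k" for j k :: nat
    by (rule mean_ergodic_Cauchy[OF \<phi> bd]) simp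
  then obtain N where N: "\<And>j k n m. N j k \<le> n \<Longrightarrow> N j k \<le> m \<Longrightarrow> (\<integral>x. (?A j n x - ?A j m x)\<^sup>2 \<partial>M) \<le> (1/4)^k"
    by metis
  \<comment> \<open>Sums replace maxima: \<open>r k\<close> dominates every \<open>N j k\<close>
    with \<open>j \<le> k\<close>, and the summand \<open>k\<close> makes \<open>r\<close> strictly
    increasing.\<close>
  define r where "r k = k + (\<Sum>i\<le>k. \<Sum>j\<le>i. N j i)" for k
  have r: "strict_mono r" by (intro strict_mono_Suc_iff[THEN iffD2]) (simp add: r_def)
  have Nr: "N j k \<le> r k" if "j \<le> k" for j k
  proof -
    have "N j k \<le> (\<Sum>j\<le>k. N j k)" using that by (intro member_le_sum) auto
    also have "\<dots> \<le> (\<Sum>i\<le>k. \<Sum>j\<le>i. N j i)" by (intro member_le_sum[where f="\<lambda>i. \<Sum>j\<le>i. N j i"]) auto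
    finally show ?thesis by (simp add: r_def)
  qed
  have "AE x in M. convergent (\<lambda>k. ?A j (r k) x)" for j
  proof -
    \<comment> \<open>The differences begin at index \<open>j\<close>, because \<open>r k\<close>
      respects the rate of \<open>\<phi> j\<close> only for \<open>j \<le> k\<close>; convergence
      ignores the initial segment.\<close>
    define d where "d k x = ?A j (r (Suc (k + j))) x - ?A j (r (k + j)) x" for k x
    have [measurable]: "d k \<in> borel_measurable M" for k unfolding d_def by measurable
    have Ab: "\<bar>?A j n x\<bar> \<le> 1" for n x by (rule birkhoff_average_bounded[where f="\<phi> j", OF bd])
    have db: "\<bar>d k x\<bar> \<le> 2" for k x
      unfolding d_def using Ab[of "r (Suc (k + j))" x] Ab[of "r (k + j)" x] by linarith
    have dsq: "\<bar>(d k x)\<^sup>2\<bar> \<le> 4" for k x using power_mono[OF db[of k x], of 2] by simp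
    have int: "integrable M (\<lambda>x. \<bar>d k x\<bar>)" "integrable M (\<lambda>x. (d k x)\<^sup>2)" for k
      using db dsq by (auto intro: bounded_integrable[where C=2] bounded_integrable[where C=4])
    have bound: "(\<integral>x. \<bar>d k x\<bar> \<partial>M) \<le> (1/2)^k" for k
    proof -
      let ?t = "(1/2::real)^(k + j)"
      have tt: "?t * ?t = (1/4)^(k + j)" by (simp flip: power_mult_distrib)
      have "(\<integral>x. (d k x)\<^sup>2 \<partial>M) \<le> ?t * ?t"
        unfolding d_def tt using Nr[of j "k + j"] strict_monoD[OF r, of "k + j" "Suc (k + j)"] by (intro N) auto
      \<comment> \<open>The inequality of arithmetic and geometric means with scale
        \<open>?t\<close>, the bound for the L2 norm, plays the role of Cauchy-Schwarz.\<close>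
      moreover have "\<bar>d k x\<bar> \<le> (?t + (d k x)\<^sup>2 / ?t) / 2" for x
        using sum_squares_bound[of "\<bar>d k x\<bar>" ?t] by (simp add: field_simps power2_eq_square)
      then have "(\<integral>x. \<bar>d k x\<bar> \<partial>M) \<le> (\<integral>x. (?t + (d k x)\<^sup>2 / ?t) / 2 \<partial>M)"
        using int by (intro integral_mono) auto
      then have "(\<integral>x. \<bar>d k x\<bar> \<partial>M) \<le> (?t + (\<integral>x. (d k x)\<^sup>2 \<partial>M) / ?t) / 2"
        using int by (simp add: prob_space)
      moreover have "(?t * ?t) / ?t = ?t" by simp
      ultimately have "(\<integral>x. \<bar>d k x\<bar> \<partial>M) \<le> ?t"
        using divide_right_mono[of "\<integral>x. (d k x)\<^sup>2 \<partial>M" "?t * ?t" ?t] by simp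
      also have "\<dots> \<le> (1/2)^k" by (intro power_decreasing) auto
      finally show ?thesis .
    qed
    have "(\<integral>\<^sup>+x. (\<Sum>k. ennreal \<bar>d k x\<bar>) \<partial>M) = (\<Sum>k. \<integral>\<^sup>+x. ennreal \<bar>d k x\<bar> \<partial>M)"
      by (intro nn_integral_suminf) auto
    also have "\<dots> = (\<Sum>k. ennreal (\<integral>x. \<bar>d k x\<bar> \<partial>M))"
      using int by (simp add: nn_integral_eq_integral)
    also have "\<dots> \<le> (\<Sum>k. ennreal ((1/2)^k))"
      using bound by (intro suminf_le ennreal_leI) auto
    also have "\<dots> = ennreal (\<Sum>k. (1/2)^k)"
      by (intro suminf_ennreal2) auto
    finally have "(\<integral>\<^sup>+x. (\<Sum>k. ennreal \<bar>d k x\<bar>) \<partial>M) \<noteq> \<infinity>"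
      by (auto simp: top_unique)
    then have "AE x in M. (\<Sum>k. ennreal \<bar>d k x\<bar>) \<noteq> \<infinity>"
      by (intro nn_integral_noteq_infinite) auto
    then show ?thesis
    proof eventually_elim
      case (elim x)
      then have "summable (\<lambda>k. \<bar>d k x\<bar>)" by (intro summable_suminf_not_top) auto
      then have "summable (\<lambda>k. d k x)" by (rule summable_rabs_cancel)
      then have "convergent (\<lambda>n. (\<Sum>k<n. d k x) + ?A j (r j) x)"
        by (intro convergent_add convergent_const) (simp add: summable_iff_convergent)
      moreover have "(\<Sum>k<n. d k x) = ?A j (r (n + j)) x - ?A j (r j) x" for n
        using sum_lessThan_telescope[of "\<lambda>k. ?A j (r (k + j)) x" n] by (simp add: d_def)
      ultimately show ?case
        using convergent_ignore_initial_segment[of "\<lambda>k. ?A j (r k) x" j] by simp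
    qed
  qed
  with r show ?thesis by (auto simp: AE_all_countable)
qed

subsection \<open>Disintegration over the invariant sets\<close>

text \<open>\<open>K\<close> is a conditional distribution of \<open>\<kappa>\<close> given the \<open>S\<close>-invariant sets; almost surely \<open>K x\<close> is the
  weak-* limit of empirical measures along the orbit of \<open>x\<close>.\<close>

locale invariant_disintegration = determining_Cc_family U f + measure_preserving \<kappa> S
  for U :: "nat \<Rightarrow> 'a::{t2_space, second_countable_topology} set" and f and \<kappa> :: "'a measure" and S +
  fixes K :: "'a \<Rightarrow> 'a measure" and r :: "nat \<Rightarrow> nat"
  assumes sets_\<kappa>: "sets \<kappa> = sets borel"
    and K_measurable [measurable]: "K \<in> measurable borel (subprob_algebra borel)"
    and K_S: "\<And>x. K (S x) = K x"
    and r_mono: "strict_mono r"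
    and average_tendsto: "AE x in \<kappa>. \<forall>i n. (\<lambda>k. birkhoff_average S (f i n) (r k) x) \<longlonglongrightarrow> (\<integral>y. f i n y \<partial>K x)"
    and disintegration: "\<And>(w :: 'a \<Rightarrow> real) (g :: 'a \<Rightarrow> real) C D. w \<in> borel_measurable borel \<Longrightarrow> g \<in> borel_measurable borel \<Longrightarrow>
      (\<And>x. \<bar>w x\<bar> \<le> C) \<Longrightarrow> (\<And>x. \<bar>g x\<bar> \<le> D) \<Longrightarrow> (\<And>x. w (S x) = w x) \<Longrightarrow>
      (\<integral>x. w x * (\<integral>y. g y \<partial>K x) \<partial>\<kappa>) = (\<integral>x. w x * g x \<partial>\<kappa>)"

lemma subprob_integral_abs_le:
  fixes g :: "'a \<Rightarrow> real"
  assumes "subprob_space M" "g \<in> borel_measurable M" "\<And>x. \<bar>g x\<bar> \<le> D"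
  shows "integrable M g" "\<bar>\<integral>x. g x \<partial>M\<bar> \<le> D"
proof -
  interpret subprob_space M by fact
  show int: "integrable M g" using assms by (intro integrable_const_bound[where B=D]) auto
  have D0: "0 \<le> D" using assms(3)[of undefined] by simp
  have "\<bar>\<integral>x. g x \<partial>M\<bar> \<le> (\<integral>x. \<bar>g x\<bar> \<partial>M)" by (rule integral_abs_bound)
  also have "\<dots> \<le> (\<integral>x. D \<partial>M)" using int assms(3) by (intro integral_mono) auto
  also have "\<dots> \<le> D" using D0 subprob_measure_le_1 by (simp add: mult_left_le_one_le)
  finally show "\<bar>\<integral>x. g x \<partial>M\<bar> \<le> D" .
qed

context determining_Cc_family
begin

text \<open>For a fixed weight \<open>v\<close> with values in [0,1], the two sides are integrals of
  \<open>g\<close> against the measures \<open>L \<bind> K\<close> and \<open>L\<close>, where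
  \<open>L\<close> has density \<open>v\<close>. They agree on the determining family, so the
  measures coincide and \<open>g\<close> may be arbitrary. A signed bounded \<open>w\<close> is an
  affine function of such a \<open>v\<close>.\<close>

lemma disintegration_of_determining:
  assumes \<kappa>: "prob_space \<kappa>" and sets_\<kappa>: "sets \<kappa> = sets borel"
    and K: "K \<in> measurable borel (subprob_algebra borel)"
    and base: "\<And>(w :: 'a \<Rightarrow> real) i n. w \<in> borel_measurable borel \<Longrightarrow> (\<And>x. 0 \<le> w x) \<Longrightarrow> (\<And>x. w x \<le> 1) \<Longrightarrow>
      (\<And>x. w (S x) = w x) \<Longrightarrow> (\<integral>x. w x * (\<integral>y. f i n y \<partial>K x) \<partial>\<kappa>) = (\<integral>x. w x * f i n x \<partial>\<kappa>)"
    and w: "(w :: 'a \<Rightarrow> real) \<in> borel_measurable borel" "\<And>x. \<bar>w x\<bar> \<le> C" "\<And>x. w (S x) = w x"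
    and g: "(g :: 'a \<Rightarrow> real) \<in> borel_measurable borel" "\<And>x. \<bar>g x\<bar> \<le> D"
  shows "(\<integral>x. w x * (\<integral>y. g y \<partial>K x) \<partial>\<kappa>) = (\<integral>x. w x * g x \<partial>\<kappa>)"
proof -
  interpret prob_space \<kappa> by fact
  note [measurable_cong] = sets_\<kappa>
  note [measurable] = K g(1)
  have space_\<kappa>: "space \<kappa> = UNIV" using sets_eq_imp_space_eq[OF sets_\<kappa>] by simp
  have Ksub: "subprob_space (K x)" and Ksets: "sets (K x) = sets borel" for x
    using measurable_space[OF K, of x] by (auto simp: space_subprob_algebra)
  have Kg: "\<bar>\<integral>y. g y \<partial>K x\<bar> \<le> D" for x
    using g Ksets by (intro subprob_integral_abs_le Ksub) (auto simp: measurable_cong_sets[OF Ksets refl])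
  have unit: "(\<integral>x. v x * (\<integral>y. g y \<partial>K x) \<partial>\<kappa>) = (\<integral>x. v x * g x \<partial>\<kappa>)"
    if v[measurable]: "v \<in> borel_measurable borel" and v01: "\<And>x. 0 \<le> v x" "\<And>x. v x \<le> 1"
      and inv: "\<And>x. v (S x) = v x" for v :: "'a \<Rightarrow> real"
  proof -
    define L where "L = density \<kappa> (\<lambda>x. ennreal (v x))"
    have vint: "integrable \<kappa> v" using v01 by (intro integrable_const_bound[where B=1]) auto
    have L: "sets L = sets borel" "space L = UNIV" by (simp_all add: L_def sets_\<kappa> space_\<kappa>)
    have "emeasure L UNIV = ennreal (\<integral>x. v x \<partial>\<kappa>)"
      using vint v01 by (simp add: L_def emeasure_density space_\<kappa> nn_integral_eq_integral)
    also have "\<dots> \<le> ennreal 1"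
      using integral_mono[OF vint, of "\<lambda>_. 1"] v01 by (intro ennreal_leI) (simp add: prob_space)
    finally have L1: "emeasure L UNIV \<le> 1" by simp
    then have subL: "subprob_space L" by (intro subprob_spaceI) (auto simp: L(2))
    then interpret L: subprob_space L .
    have KL: "K \<in> measurable L (subprob_algebra borel)" using K by (simp add: measurable_cong_sets[OF L(1) refl])
    have bd: "AE x in L. emeasure (K x) (space (K x)) \<le> ennreal 1"
      using subprob_space.emeasure_space_le_1[OF Ksub] by (intro AE_I2) simp
    have int_bind: "(\<integral>x. h x \<partial>(L \<bind> K)) = (\<integral>x. v x * (\<integral>y. h y \<partial>K x) \<partial>\<kappa>)"
      if h[measurable]: "h \<in> borel_measurable borel" and "\<And>x. \<bar>h x\<bar> \<le> c" for h :: "'a \<Rightarrow> real" and c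
    proof -
      have "(\<integral>x. h x \<partial>(L \<bind> K)) = (\<integral>x. (\<integral>y. h y \<partial>K x) \<partial>L)"
        by (rule integral_bind[OF h that(2) KL L.finite_measure_axioms bd])
      also have "\<dots> = (\<integral>x. v x * (\<integral>y. h y \<partial>K x) \<partial>\<kappa>)"
        unfolding L_def using v01 by (subst integral_density) auto
      finally show ?thesis .
    qed
    have int_L: "(\<integral>x. h x \<partial>L) = (\<integral>x. v x * h x \<partial>\<kappa>)" if [measurable]: "h \<in> borel_measurable borel" for h :: "'a \<Rightarrow> real"
      unfolding L_def using v01 by (subst integral_density) auto
    interpret LK: subprob_space "L \<bind> K" by (rule subprob_space_bind[OF subL KL])
    have "L \<bind> K = L"
    proof (rule measure_eqI_f)
      show "sets (L \<bind> K) = sets borel"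
        using sets_bind[of L K borel] Ksets L(2) by simp
      show "(\<integral>x. f i n x \<partial>(L \<bind> K)) = (\<integral>x. f i n x \<partial>L)" for i n
        using int_bind[OF f_measurable abs_f_le_1, of i n] int_L[OF f_measurable, of i n]
          base[OF v v01 inv, of i n] by simp
    qed (use L L.finite_measure_axioms LK.finite_measure_axioms in auto)
    then show ?thesis using int_bind[OF g] int_L[OF g(1)] by simp
  qed
  have C0: "0 \<le> C" using w(2)[of undefined] by simp
  \<comment> \<open>The added 1 keeps the divisor \<open>2 * c\<close> positive when
    \<open>C = 0\<close>.\<close>
  define c where "c = C + 1"
  have c: "0 < c" using C0 by (simp add: c_def)
  define v where "v x = (w x + c) / (2 * c)" for x
  have v: "v \<in> borel_measurable borel" "\<And>x. 0 \<le> v x" "\<And>x. v x \<le> 1" "\<And>x. v (S x) = v x"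
  proof -
    show "v \<in> borel_measurable borel" unfolding v_def using w(1) by measurable
    show "0 \<le> v x" "v x \<le> 1" "v (S x) = v x" for x
      using c w(2)[of x] w(3)[of x] by (auto simp: v_def c_def abs_le_iff field_simps)
  qed
  have weq: "w x = 2 * c * v x - c * 1" for x
    using c by (simp add: v_def field_simps)
  note [measurable] = v(1) w(1)
  have split: "(\<integral>x. w x * h x \<partial>\<kappa>) = 2 * c * (\<integral>x. v x * h x \<partial>\<kappa>) - c * (\<integral>x. 1 * h x \<partial>\<kappa>)"
    if [measurable]: "h \<in> borel_measurable borel" and hD: "\<And>x. \<bar>h x\<bar> \<le> D" for h :: "'a \<Rightarrow> real"
  proof -
    have "\<bar>v x * h x\<bar> \<le> 1 * D" for x
      unfolding abs_mult using v(2,3) hD by (intro mult_mono) auto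
    then have "integrable \<kappa> (\<lambda>x. v x * h x)" "integrable \<kappa> h"
      using hD by (auto intro!: integrable_const_bound[where B=D])
    moreover have "(\<integral>x. w x * h x \<partial>\<kappa>) = (\<integral>x. 2 * c * (v x * h x) - c * h x \<partial>\<kappa>)"
      by (simp add: weq left_diff_distrib mult.assoc)
    ultimately show ?thesis by simp
  qed
  have "(\<lambda>x. \<integral>y. g y \<partial>K x) \<in> borel_measurable borel" by measurable
  then have "(\<integral>x. w x * (\<integral>y. g y \<partial>K x) \<partial>\<kappa>) =
      2 * c * (\<integral>x. v x * (\<integral>y. g y \<partial>K x) \<partial>\<kappa>) - c * (\<integral>x. 1 * (\<integral>y. g y \<partial>K x) \<partial>\<kappa>)"
    using Kg by (rule split)
  also have "\<dots> = 2 * c * (\<integral>x. v x * g x \<partial>\<kappa>) - c * (\<integral>x. 1 * g x \<partial>\<kappa>)"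
    using unit[OF v] unit[of "\<lambda>_. 1"] by simp
  also have "\<dots> = (\<integral>x. w x * g x \<partial>\<kappa>)"
    using g by (rule split[symmetric])
  finally show ?thesis .
qed

text \<open>Compactness gives a limit measure only along a further subsequence \<open>s\<close>. As
  the averages converge along all of \<open>r\<close>, their limits are already decided by
  \<open>s\<close> and hence are the integrals of that measure.\<close>

lemma empirical_limits_exist:
  assumes lc: "locally_compact_space (euclidean :: 'a topology)" and r: "strict_mono (r :: nat \<Rightarrow> nat)"
    and conv: "\<And>i n. convergent (\<lambda>k. birkhoff_average S (f i n) (r k) x)"
  shows "\<exists>L. sets L = sets borel \<and> subprob_space L \<and>
    (\<forall>i n. (\<lambda>k. birkhoff_average S (f i n) (r k) x) \<longlonglongrightarrow> (\<integral>y. f i n y \<partial>L))"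
proof -
  \<comment> \<open>The Cesaro measure counts from 1 while the orbit averages start at time 0, hence
    the exponent \<open>n - 1\<close>.\<close>
  define M where "M k = cesaro_measure (\<lambda>n. return borel ((S ^^ (n - 1)) x)) (r k)" for k
  have M: "sets (M k) = sets borel" "finite_measure (M k)" "measure (M k) UNIV \<le> 1" for k
    by (simp_all add: M_def finite_empirical_measure empirical_measure_UNIV_le)
  obtain s L where sL: "strict_mono s" "sets L = sets borel" "finite_measure L" "measure L UNIV \<le> 1"
    "weak_star_conv (M \<circ> s) L"
    using weak_star_sequentially_compact[where M=M, OF lc M] by metis
  have "subprob_space L"
    using sL(2-4) sets_eq_imp_space_eq[OF sL(2)]
    by (intro subprob_spaceI) (auto simp: finite_measure.emeasure_eq_measure)
  moreover have "(\<lambda>k. birkhoff_average S (f i n) (r k) x) \<longlonglongrightarrow> (\<integral>y. f i n y \<partial>L)" for i n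
  proof -
    let ?a = "\<lambda>k. birkhoff_average S (f i n) (r k) x"
    have "(\<integral>y. f i n y \<partial>M k) = ?a k" if "0 < k" for k
    proof -
      have rk: "0 < r k" using strict_mono_imp_increasing[OF r, of k] that by linarith
      have "(\<Sum>m=1..r k. f i n ((S ^^ (m - 1)) x)) = (\<Sum>m<r k. f i n ((S ^^ m) x))"
        by (simp add: sum.atLeast1_atMost_eq)
      then show ?thesis
        unfolding M_def integral_empirical_measure[OF f_measurable abs_f_le_1 rk] by (simp add: birkhoff_average_def)
    qed
    moreover have "\<forall>\<^sub>F k in sequentially. 0 < s k"
      using eventually_subseq[OF sL(1) eventually_gt_at_top[of 0]] .
    ultimately have "\<forall>\<^sub>F k in sequentially. (\<integral>y. f i n y \<partial>(M \<circ> s) k) = (?a \<circ> s) k"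
      by (auto elim: eventually_mono)
    moreover have "(\<lambda>k. \<integral>y. f i n y \<partial>(M \<circ> s) k) \<longlonglongrightarrow> (\<integral>y. f i n y \<partial>L)"
      using sL(5) f_Cc by (auto simp: weak_star_conv_def)
    ultimately have "(?a \<circ> s) \<longlonglongrightarrow> (\<integral>y. f i n y \<partial>L)"
      by (rule Lim_transform_eventually[rotated])
    moreover obtain l where "?a \<longlonglongrightarrow> l" using conv by (auto simp: convergent_def)
    ultimately show ?thesis
      using LIMSEQ_unique LIMSEQ_subseq_LIMSEQ[OF _ sL(1)] by metis
  qed
  ultimately show ?thesis using sL(2) by blast
qed

text \<open>The kernel is not obtained from conditional expectations but read off the orbits, as the
  weak-* limit of empirical measures. The disintegration identity then follows by letting the
  averages in \<open>integral_invariant_mult_average\<close> converge under the integral.\<close>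

theorem invariant_disintegration_exists:
  assumes lc: "locally_compact_space (euclidean :: 'a topology)"
    and mp: "measure_preserving \<kappa> S" and sets_\<kappa>: "sets \<kappa> = sets borel"
  shows "\<exists>K r. invariant_disintegration U f \<kappa> S K r"
proof -
  interpret measure_preserving \<kappa> S by fact
  note [measurable_cong] = sets_\<kappa>
  have S[measurable]: "S \<in> measurable borel borel"
    using S_measurable by (simp add: measurable_cong_sets[OF sets_\<kappa> sets_\<kappa>])
  have space_\<kappa>: "space \<kappa> = UNIV" using sets_eq_imp_space_eq[OF sets_\<kappa>] by simp
  define \<phi> where "\<phi> j = f (fst (prod_decode j)) (snd (prod_decode j))" for j
  have \<phi>: "\<phi> j \<in> borel_measurable \<kappa>" "\<bar>\<phi> j x\<bar> \<le> 1" for j x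
    unfolding \<phi>_def using abs_f_le_1 by (auto simp: measurable_cong_sets[OF sets_\<kappa> refl])
  obtain r where r: "strict_mono r" and
      ae: "AE x in \<kappa>. \<forall>j. convergent (\<lambda>k. birkhoff_average S (\<phi> j) (r k) x)"
    using average_AE_convergent_subsequence[of \<phi>, OF \<phi>] by (elim exE conjE) (rule that)
  let ?a = "\<lambda>i n k x. birkhoff_average S (f i n) (r k) x"
  have avg[measurable]: "birkhoff_average S (f i n) k \<in> borel_measurable borel" for i n k
    by (rule birkhoff_average_measurable[OF S f_measurable])
  define G where "G = {x. \<forall>i n. convergent (\<lambda>k. ?a i n k x)}"
  have G[measurable]: "G \<in> sets borel"
  proof -
    have [measurable]: "Measurable.pred borel (\<lambda>x. convergent (\<lambda>k. ?a i n k x))" for i n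
      unfolding Cauchy_convergent_iff[symmetric] pred_def by (rule sets_Collect_Cauchy) (rule avg)
    have "{x \<in> space borel. \<forall>i n. convergent (\<lambda>k. ?a i n k x)} \<in> sets borel" by measurable
    then show ?thesis by (simp add: G_def)
  qed
  have aeG: "AE x in \<kappa>. x \<in> G"
    using ae
  proof eventually_elim
    case (elim x)
    show ?case unfolding G_def
    proof (intro CollectI allI)
      fix i n show "convergent (\<lambda>k. ?a i n k x)"
        using elim[rule_format, of "prod_encode (i, n)"] by (simp add: \<phi>_def)
    qed
  qed
  have shift: "(\<lambda>k. ?a i n k (S x) - ?a i n k x) \<longlonglongrightarrow> 0" for i n x
  proof (rule Lim_null_comparison)
    have "(\<lambda>k. 2 / real k) \<longlonglongrightarrow> 0" by (rule lim_const_over_n)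
    from LIMSEQ_subseq_LIMSEQ[OF this r] show "(\<lambda>k. 2 / real (r k)) \<longlonglongrightarrow> 0" by (simp add: o_def)
    show "\<forall>\<^sub>F k in sequentially. norm (?a i n k (S x) - ?a i n k x) \<le> 2 / real (r k)"
      using birkhoff_average_shift[where f="f i n" and C=1 and j=1 and S=S and x=x, OF abs_f_le_1] by simp
  qed
  have lim_S: "(\<lambda>k. ?a i n k (S x)) \<longlonglongrightarrow> l \<longleftrightarrow> (\<lambda>k. ?a i n k x) \<longlonglongrightarrow> l" for i n x l
    using tendsto_add[OF shift[of i n x], of "\<lambda>k. ?a i n k x" l]
      tendsto_diff[OF _ shift[of i n x], of "\<lambda>k. ?a i n k (S x)" l] by auto
  have GS: "S x \<in> G \<longleftrightarrow> x \<in> G" for x by (simp add: G_def convergent_def lim_S)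
  have "\<forall>x\<in>G. \<exists>L. sets L = sets borel \<and> subprob_space L \<and> (\<forall>i n. (\<lambda>k. ?a i n k x) \<longlonglongrightarrow> (\<integral>y. f i n y \<partial>L))"
    by (intro ballI empirical_limits_exist[OF lc r]) (simp add: G_def)
  then obtain K0 where K0: "\<And>x. x \<in> G \<Longrightarrow> sets (K0 x) = sets borel" "\<And>x. x \<in> G \<Longrightarrow> subprob_space (K0 x)"
      "\<And>x i n. x \<in> G \<Longrightarrow> (\<lambda>k. ?a i n k x) \<longlonglongrightarrow> (\<integral>y. f i n y \<partial>K0 x)"
    unfolding bchoice_iff by blast
  \<comment> \<open>The convergence set \<open>G\<close> is Borel and satisfies
    \<open>S x \<in> G\<close> iff \<open>x \<in> G\<close>, so the null measure as default value
    keeps \<open>K\<close> measurable and makes \<open>K (S x) = K x\<close> hold everywhere, not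
    only almost everywhere.\<close>
  define K where "K x = (if x \<in> G then K0 x else null_measure borel)" for x
  have Ksets: "sets (K x) = sets borel" for x using K0(1) by (simp add: K_def)
  have Ksub: "subprob_space (K x)" for x
    using K0(2) by (auto simp: K_def intro!: subprob_spaceI)
  have lim: "(\<lambda>k. ?a i n k x) \<longlonglongrightarrow> (\<integral>y. f i n y \<partial>K x)" if "x \<in> G" for i n x
    using K0(3)[OF that] that by (simp add: K_def)
  have K_S: "K (S x) = K x" for x
  proof (cases "x \<in> G")
    case True
    have "(\<integral>y. f i n y \<partial>K (S x)) = (\<integral>y. f i n y \<partial>K x)" for i n
      using LIMSEQ_unique[OF lim[of x i n] lim_S[THEN iffD1, OF lim[of "S x" i n]]] True GS by simp
    then show ?thesis
      using Ksets Ksub by (intro measure_eqI_f) (auto simp: subprob_space_def)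
  qed (simp add: K_def GS)
  have h[measurable]: "(\<lambda>x. \<integral>y. f i n y \<partial>K x) \<in> borel_measurable borel" for i n
  proof -
    have "(\<integral>y. f i n y \<partial>K x) = (if x \<in> G then lim (\<lambda>k. ?a i n k x) else 0)" for x
      using limI[OF lim[of x i n]] by (auto simp: K_def)
    then show ?thesis by simp measurable
  qed
  have K: "K \<in> measurable borel (subprob_algebra borel)"
  proof (rule measurable_subprob_algebra_generated[OF sets_borel_U Int_stable_U])
    have em: "(\<lambda>x. emeasure (K x) (U i)) \<in> borel_measurable borel" for i
    proof -
      have "(\<lambda>x. measure (K x) (U i)) \<in> borel_measurable borel"
        by (rule borel_measurable_LIMSEQ_real[OF _ h[of i]])
          (use Ksub Ksets in \<open>auto intro!: tendsto_measure_U simp: subprob_space_def\<close>)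
      then show ?thesis
        using Ksub by (simp add: finite_measure.emeasure_eq_measure subprob_space_def)
    qed
    then show "(\<lambda>x. emeasure (K x) A) \<in> borel_measurable borel" if "A \<in> range U" for A
      using that by auto
    obtain i where "U i = UNIV" using UNIV_U by fastforce
    then show "(\<lambda>x. emeasure (K x) UNIV) \<in> borel_measurable borel" using em[of i] by simp
  qed (use Ksub Ksets in auto)
  have hb: "\<bar>\<integral>y. f i n y \<partial>K x\<bar> \<le> 1" for i n x
    using Ksub Ksets abs_f_le_1 by (intro subprob_integral_abs_le) (auto simp: measurable_cong_sets[OF Ksets refl])
  have base: "(\<integral>x. w x * (\<integral>y. f i n y \<partial>K x) \<partial>\<kappa>) = (\<integral>x. w x * f i n x \<partial>\<kappa>)"
    if w[measurable]: "w \<in> borel_measurable borel" and w01: "\<And>x. 0 \<le> w x" "\<And>x. w x \<le> 1"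
      and inv: "\<And>x. w (S x) = w x" for w :: "'a \<Rightarrow> real" and i n
  proof (rule LIMSEQ_unique)
    have wa: "\<bar>w x\<bar> \<le> 1" for x using w01[of x] by simp
    have fM: "f i n \<in> borel_measurable \<kappa>" "w \<in> borel_measurable \<kappa>" by measurable
    show "(\<lambda>k. \<integral>x. w x * ?a i n k x \<partial>\<kappa>) \<longlonglongrightarrow> (\<integral>x. w x * (\<integral>y. f i n y \<partial>K x) \<partial>\<kappa>)"
    proof (rule integral_dominated_convergence[where w="\<lambda>_. 1"])
      show "AE x in \<kappa>. (\<lambda>k. w x * ?a i n k x) \<longlonglongrightarrow> w x * (\<integral>y. f i n y \<partial>K x)"
        using aeG by eventually_elim (intro tendsto_mult_left lim)
      show "AE x in \<kappa>. norm (w x * ?a i n k x) \<le> 1" for k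
      proof (rule AE_I2)
        fix x
        have "\<bar>w x\<bar> * \<bar>?a i n k x\<bar> \<le> 1 * 1"
          using wa birkhoff_average_bounded[where f="f i n", OF abs_f_le_1] by (intro mult_mono) auto
        then show "norm (w x * ?a i n k x) \<le> 1" by (simp add: abs_mult)
      qed
    qed auto
    have "\<forall>\<^sub>F k in sequentially. (\<integral>x. w x * ?a i n k x \<partial>\<kappa>) = (\<integral>x. w x * f i n x \<partial>\<kappa>)"
      using eventually_subseq[OF r eventually_gt_at_top[of 0]]
      by eventually_elim (rule integral_invariant_mult_average[OF fM(1) abs_f_le_1 _ fM(2) wa inv])
    then show "(\<lambda>k. \<integral>x. w x * ?a i n k x \<partial>\<kappa>) \<longlonglongrightarrow> (\<integral>x. w x * f i n x \<partial>\<kappa>)"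
      by (rule tendsto_eventually)
  qed
  have "invariant_disintegration U f \<kappa> S K r"
  proof
    show "AE x in \<kappa>. \<forall>i n. (\<lambda>k. ?a i n k x) \<longlonglongrightarrow> (\<integral>y. f i n y \<partial>K x)"
      using aeG by eventually_elim (simp add: lim)
    show "(\<integral>x. w x * (\<integral>y. g y \<partial>K x) \<partial>\<kappa>) = (\<integral>x. w x * g x \<partial>\<kappa>)"
      if "w \<in> borel_measurable borel" "g \<in> borel_measurable borel" "\<And>x. \<bar>w x\<bar> \<le> C" "\<And>x. \<bar>g x\<bar> \<le> D"
        "\<And>x. w (S x) = w x" for w g :: "'a \<Rightarrow> real" and C D
      by (rule disintegration_of_determining[OF prob_space_axioms sets_\<kappa> K base that(1,3,5,2,4)])
  qed (use sets_\<kappa> K K_S r in auto)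
  then show ?thesis by blast
qed

end

subsection \<open>Ergodicity of the fibres\<close>

context invariant_disintegration
begin

lemma borel_S [measurable]: "S \<in> measurable borel borel"
  using S_measurable by (simp add: measurable_cong_sets[OF sets_\<kappa> sets_\<kappa>])

lemma space_\<kappa> [simp]: "space \<kappa> = UNIV"
  using sets_eq_imp_space_eq[OF sets_\<kappa>] by simp

lemma measurable_\<kappa>: "g \<in> borel_measurable borel \<Longrightarrow> g \<in> borel_measurable \<kappa>"
  by (simp add: measurable_cong_sets[OF sets_\<kappa> refl])

lemma subprob_K: "subprob_space (K x)" and sets_K: "sets (K x) = sets borel" and space_K: "space (K x) = UNIV"
  using measurable_space[OF K_measurable, of x] sets_eq_imp_space_eq[of "K x" borel]
  by (auto simp: space_subprob_algebra)

lemma measurable_K: "g \<in> borel_measurable borel \<Longrightarrow> g \<in> borel_measurable (K x)"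
  by (simp add: measurable_cong_sets[OF sets_K refl])

lemma integrable_K:
  fixes g :: "'a \<Rightarrow> real"
  assumes "g \<in> borel_measurable borel" "\<And>y. \<bar>g y\<bar> \<le> D"
  shows "integrable (K x) g"
  by (rule subprob_integral_abs_le(1)[OF subprob_K measurable_K[OF assms(1)] assms(2)])

lemma integral_K_bounded:
  fixes g :: "'a \<Rightarrow> real"
  assumes "g \<in> borel_measurable borel" "\<And>y. \<bar>g y\<bar> \<le> D"
  shows "\<bar>\<integral>y. g y \<partial>K x\<bar> \<le> D"
  by (rule subprob_integral_abs_le(2)[OF subprob_K measurable_K[OF assms(1)] assms(2)])

lemma integral_K_measurable [measurable (raw)]:
  fixes g :: "'a \<Rightarrow> real"
  assumes [measurable]: "g \<in> borel_measurable borel"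
  shows "(\<lambda>x. \<integral>y. g y \<partial>K x) \<in> borel_measurable borel"
  by measurable

lemma integral_K:
  fixes g :: "'a \<Rightarrow> real"
  assumes "g \<in> borel_measurable borel" "\<And>y. \<bar>g y\<bar> \<le> D"
  shows "(\<integral>x. (\<integral>y. g y \<partial>K x) \<partial>\<kappa>) = (\<integral>x. g x \<partial>\<kappa>)"
  using disintegration[of "\<lambda>_. 1" g 1 D] assms by simp

lemma AE_eq_0I:
  fixes h :: "'a \<Rightarrow> real"
  assumes h: "h \<in> borel_measurable borel" "\<And>x. 0 \<le> h x" "\<And>x. \<bar>h x\<bar> \<le> D" and "(\<integral>x. h x \<partial>\<kappa>) = 0"
  shows "AE x in \<kappa>. h x = 0"
proof -
  have "integrable \<kappa> h" by (rule bounded_integrable[OF measurable_\<kappa>[OF h(1)] h(3)])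
  with assms show ?thesis by (subst (asm) integral_nonneg_eq_0_iff_AE) auto
qed

text \<open>A fibre is a weak-* limit and could have lost mass. But the masses of the fibres are at
  most 1 and integrate to the mass 1 of \<kappa>, so almost no fibre has lost any.\<close>

lemma AE_prob_K: "AE x in \<kappa>. prob_space (K x)"
proof -
  let ?m = "\<lambda>x. \<integral>y. (1::real) \<partial>K x"
  have m: "?m \<in> borel_measurable borel" "\<And>x. \<bar>?m x\<bar> \<le> 1"
    using integral_K_measurable[of "\<lambda>_. 1"] integral_K_bounded[of "\<lambda>_. 1" 1] by auto
  have "AE x in \<kappa>. 1 - ?m x = 0"
  proof (rule AE_eq_0I)
    show "(\<lambda>x. 1 - ?m x) \<in> borel_measurable borel" using m(1) by measurable
    show "0 \<le> 1 - ?m x" "\<bar>1 - ?m x\<bar> \<le> 2" for x using m(2)[of x] by linarith+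
    have "integrable \<kappa> ?m" by (rule bounded_integrable[OF measurable_\<kappa>[OF m(1)] m(2)])
    then have "(\<integral>x. 1 - ?m x \<partial>\<kappa>) = (\<integral>x. 1 \<partial>\<kappa>) - (\<integral>x. ?m x \<partial>\<kappa>)"
      by (intro Bochner_Integration.integral_diff) auto
    also have "(\<integral>x. ?m x \<partial>\<kappa>) = (\<integral>x. 1 \<partial>\<kappa>)" by (rule integral_K[where D=1]) auto
    finally show "(\<integral>x. 1 - ?m x \<partial>\<kappa>) = 0" by simp
  qed
  then show ?thesis
  proof eventually_elim
    case (elim x)
    interpret subprob_space "K x" by (rule subprob_K)
    show ?case using elim by (intro prob_spaceI) (simp add: emeasure_eq_measure)
  qed
qed

lemma AE_K_null:
  assumes N: "N \<in> sets borel" "measure \<kappa> N = 0"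
  shows "AE x in \<kappa>. measure (K x) N = 0"
proof -
  let ?g = "indicator N :: 'a \<Rightarrow> real"
  have g: "?g \<in> borel_measurable borel" "\<And>x. \<bar>?g x\<bar> \<le> 1" using N by auto
  have "AE x in \<kappa>. (\<integral>y. ?g y \<partial>K x) = 0"
  proof (rule AE_eq_0I)
    show "(\<integral>x. (\<integral>y. ?g y \<partial>K x) \<partial>\<kappa>) = 0"
      using integral_K[OF g] N by (simp add: sets_\<kappa>)
  qed (use g integral_K_measurable[OF g(1)] integral_K_bounded[OF g] in auto)
  then show ?thesis using N by (simp add: sets_K space_K)
qed

lemma AE_K_AE:
  assumes P: "Measurable.pred borel P" and ae: "AE x in \<kappa>. P x"
  shows "AE x in \<kappa>. AE y in K x. P y"
proof -
  have N: "{x. \<not> P x} \<in> sets borel" using P by (simp add: pred_def Collect_neg_eq)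
  have "measure \<kappa> {x. \<not> P x} = 0"
    using ae N by (subst (asm) AE_iff_measurable[of "{x. \<not> P x}"]) (auto simp: sets_\<kappa> measure_def)
  from AE_K_null[OF N this] show ?thesis
  proof eventually_elim
    case (elim x)
    interpret subprob_space "K x" by (rule subprob_K)
    show ?case using elim N
      by (subst AE_iff_measurable[of "{x. \<not> P x}"]) (auto simp: sets_K space_K emeasure_eq_measure)
  qed
qed

text \<open>Any function of \<open>x\<close> that depends only on \<open>K x\<close> is \<open>S\<close>-invariant and hence admissible as a weight
  in the disintegration identity; both of the following facts come from choosing it as its own weight.\<close>

lemma AE_K_invariant: "AE x in \<kappa>. distr (K x) borel S = K x"
proof -
  have "AE x in \<kappa>. (\<integral>y. f i n (S y) \<partial>K x) = (\<integral>y. f i n y \<partial>K x)" for i n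
  proof -
    let ?g = "\<lambda>y. f i n (S y) - f i n y"
    let ?d = "\<lambda>x. \<integral>y. ?g y \<partial>K x"
    have g: "?g \<in> borel_measurable borel" by measurable
    have gb: "\<bar>?g y\<bar> \<le> 1" for y
      using f_nonneg[of i n y] f_le_1[of i n y] f_nonneg[of i n "S y"] f_le_1[of i n "S y"] by linarith
    have d: "?d \<in> borel_measurable borel" "\<And>x. \<bar>?d x\<bar> \<le> 1" "\<And>x. ?d (S x) = ?d x"
      using integral_K_measurable[OF g] integral_K_bounded[OF g gb] by (auto simp: K_S)
    \<comment> \<open>With weight \<open>?d\<close> the square integral turns into the integral of
      \<open>?d * (f i n \<circ> S - f i n)\<close>, which vanishes because both \<kappa> and
      \<open>?d\<close> are invariant.\<close>
    have "(\<integral>x. ?d x * ?d x \<partial>\<kappa>) = (\<integral>x. ?d x * ?g x \<partial>\<kappa>)"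
      by (rule disintegration[OF d(1) g d(2) gb d(3)])
    also have "\<dots> = (\<integral>x. ?d x * f i n (S x) \<partial>\<kappa>) - (\<integral>x. ?d x * f i n x \<partial>\<kappa>)"
    proof -
      have b: "\<bar>?d x * f i n z\<bar> \<le> 1" for x z
        using mult_mono[OF d(2)[of x] abs_f_le_1[of i n z]] by (simp add: abs_mult)
      have "integrable \<kappa> (\<lambda>x. ?d x * f i n (S x))" "integrable \<kappa> (\<lambda>x. ?d x * f i n x)"
        by (rule bounded_integrable[OF measurable_\<kappa> b]; use d(1) in measurable)+
      then show ?thesis by (simp add: right_diff_distrib)
    qed
    also have "(\<integral>x. ?d x * f i n (S x) \<partial>\<kappa>) = (\<integral>x. ?d x * f i n x \<partial>\<kappa>)"
    proof -
      have "(\<lambda>x. ?d x * f i n x) \<in> borel_measurable \<kappa>"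
        using d(1) by (intro measurable_\<kappa>) measurable
      from integral_funpow[OF this, of 1] show ?thesis by (simp add: K_S)
    qed
    finally have "(\<integral>x. ?d x * ?d x \<partial>\<kappa>) = 0" by simp
    moreover have "\<bar>?d x * ?d x\<bar> \<le> 1" for x
      using mult_mono[OF d(2)[of x] d(2)[of x]] by (simp add: abs_mult)
    ultimately have "AE x in \<kappa>. ?d x * ?d x = 0"
      using d(1) by (intro AE_eq_0I) auto
    then show ?thesis
    proof eventually_elim
      case (elim x)
      have "integrable (K x) (\<lambda>y. f i n (S y))" "integrable (K x) (f i n)"
        by (rule integrable_K[OF _ abs_f_le_1]; measurable)+
      with elim show ?case by simp
    qed
  qed
  then have "AE x in \<kappa>. \<forall>i n. (\<integral>y. f i n (S y) \<partial>K x) = (\<integral>y. f i n y \<partial>K x)"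
    by (simp add: AE_all_countable)
  then show ?thesis
  proof eventually_elim
    case (elim x)
    interpret subprob_space "K x" by (rule subprob_K)
    have S: "S \<in> measurable (K x) borel" by (simp add: measurable_cong_sets[OF sets_K refl])
    show ?case
      using elim by (intro measure_eqI_f finite_measure_distr S)
        (auto simp: sets_K finite_measure_axioms integral_distr[OF S f_measurable])
  qed
qed

lemma AE_K_constant: "AE x in \<kappa>. AE y in K x. \<forall>i n. (\<integral>z. f i n z \<partial>K y) = (\<integral>z. f i n z \<partial>K x)"
proof -
  have "AE x in \<kappa>. AE y in K x. (\<integral>z. f i n z \<partial>K y) = (\<integral>z. f i n z \<partial>K x)" for i n
  proof -
    let ?h = "\<lambda>x. \<integral>z. f i n z \<partial>K x"
    have h[measurable]: "?h \<in> borel_measurable borel" by (rule integral_K_measurable) measurable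
    have hb: "\<bar>?h x\<bar> \<le> 1" for x by (rule integral_K_bounded[OF f_measurable abs_f_le_1])
    have h2: "(\<lambda>x. ?h x * ?h x) \<in> borel_measurable borel" by measurable
    have hb2: "\<bar>?h x * ?h x\<bar> \<le> 1" for x
      using mult_mono[OF hb[of x] hb[of x]] by (simp add: abs_mult)
    let ?V = "\<lambda>x. \<integral>y. (?h y - ?h x)\<^sup>2 \<partial>K x"
    let ?k1 = "\<lambda>x. \<integral>y. ?h y \<partial>K x" and ?k2 = "\<lambda>x. \<integral>y. ?h y * ?h y \<partial>K x" and ?k0 = "\<lambda>x. \<integral>y. (1::real) \<partial>K x"
    \<comment> \<open>Expanding the square makes every term accessible to the disintegration
      identity: \<open>?k2\<close>, \<open>?h * ?k1\<close> and \<open>?h * ?h * ?k0\<close> all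
      have the same integral over \<kappa>, and the coefficients 1, -2, 1 cancel.\<close>
    have "(\<integral>y. (?h y - c)\<^sup>2 \<partial>K x) = ?k2 x - 2 * (c * ?k1 x) + (c * c) * ?k0 x" for c x
    proof -
      interpret subprob_space "K x" by (rule subprob_K)
      have i: "integrable (K x) ?h" "integrable (K x) (\<lambda>y. ?h y * ?h y)"
        using integrable_K[OF h hb] integrable_K[OF h2 hb2] by auto
      have "(\<integral>y. (?h y - c)\<^sup>2 \<partial>K x) = (\<integral>y. ?h y * ?h y - (2 * c) * ?h y + c * c \<partial>K x)"
        by (intro Bochner_Integration.integral_cong) (auto simp: power2_eq_square algebra_simps)
      also have "\<dots> = ?k2 x - (2 * c) * ?k1 x + (c * c) * ?k0 x"
        using i by simp
      finally show ?thesis by simp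
    qed
    then have expand: "?V x = ?k2 x - 2 * (?h x * ?k1 x) + (?h x * ?h x) * ?k0 x" for x .
    have Ih: "(\<integral>x. ?h x * ?k1 x \<partial>\<kappa>) = (\<integral>x. ?h x * ?h x \<partial>\<kappa>)"
      by (rule disintegration[OF h h hb hb]) (simp add: K_S)
    have Ih2: "(\<integral>x. ?k2 x \<partial>\<kappa>) = (\<integral>x. ?h x * ?h x \<partial>\<kappa>)"
      by (rule integral_K[OF h2 hb2])
    have I0: "(\<integral>x. (?h x * ?h x) * ?k0 x \<partial>\<kappa>) = (\<integral>x. (?h x * ?h x) * 1 \<partial>\<kappa>)"
      by (rule disintegration[OF h2 _ hb2, where D=1]) (auto simp: K_S)
    have k: "?k1 \<in> borel_measurable borel" "?k2 \<in> borel_measurable borel" "?k0 \<in> borel_measurable borel"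
      using integral_K_measurable[OF h] integral_K_measurable[OF h2] integral_K_measurable[of "\<lambda>_. 1"] by auto
    have kb: "\<bar>?k1 x\<bar> \<le> 1" "\<bar>?k2 x\<bar> \<le> 1" "\<bar>?k0 x\<bar> \<le> 1" for x
      using integral_K_bounded[OF h hb] integral_K_bounded[OF h2 hb2] integral_K_bounded[of "\<lambda>_. 1" 1] by auto
    have b1: "\<bar>?h x * ?k1 x\<bar> \<le> 1" and b0: "\<bar>(?h x * ?h x) * ?k0 x\<bar> \<le> 1" for x
      using mult_mono[OF hb[of x] kb(1)[of x]] mult_mono[OF hb2[of x] kb(3)[of x]] by (simp_all add: abs_mult)
    have int: "integrable \<kappa> ?k2" "integrable \<kappa> (\<lambda>x. ?h x * ?k1 x)" "integrable \<kappa> (\<lambda>x. (?h x * ?h x) * ?k0 x)"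
      by (rule bounded_integrable[OF measurable_\<kappa> kb(2)] bounded_integrable[OF measurable_\<kappa> b1]
          bounded_integrable[OF measurable_\<kappa> b0]; use h k in measurable)+
    have Vm: "?V \<in> borel_measurable borel"
      unfolding expand using h k by measurable
    have Vb: "\<bar>?V x\<bar> \<le> 4" for x
      unfolding expand using b1[of x] b0[of x] kb(2)[of x] by linarith
    have "(\<integral>x. ?V x \<partial>\<kappa>) = (\<integral>x. ?k2 x \<partial>\<kappa>) - 2 * (\<integral>x. ?h x * ?k1 x \<partial>\<kappa>) + (\<integral>x. (?h x * ?h x) * ?k0 x \<partial>\<kappa>)"
      unfolding expand using int
      by (subst Bochner_Integration.integral_add; (subst Bochner_Integration.integral_diff)?) auto
    also have "\<dots> = 0" unfolding Ih Ih2 I0 by simp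
    finally have "AE x in \<kappa>. ?V x = 0"
      by (intro AE_eq_0I[OF Vm _ Vb]) auto
    then show ?thesis
    proof eventually_elim
      case (elim x)
      have m: "(\<lambda>y. (?h y - ?h x)\<^sup>2) \<in> borel_measurable borel" by measurable
      have "\<bar>(?h y - ?h x)\<^sup>2\<bar> \<le> 4" for y
      proof -
        have "\<bar>?h y - ?h x\<bar> \<le> 2" using hb[of x] hb[of y] by linarith
        from power_mono[OF this, of 2] show ?thesis by simp
      qed
      then have "integrable (K x) (\<lambda>y. (?h y - ?h x)\<^sup>2)" by (rule integrable_K[OF m])
      from integral_nonneg_eq_0_iff_AE[OF this] elim have "AE y in K x. (?h y - ?h x)\<^sup>2 = 0" by simp
      then show ?case by simp
    qed
  qed
  then show ?thesis by (simp add: AE_all_countable)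
qed

text \<open>On almost every fibre L the orbit averages converge to constants, namely the integrals
  over L itself. The indicator of an invariant set A passes through these averages, so in the limit
  A is independent of every Borel set under L; taking A itself gives L(A) = L(A)^2.\<close>

theorem AE_ergodic_K: "AE x in \<kappa>. ergodic_prob_measure S (K x)"
proof -
  let ?a = "\<lambda>i n k x. birkhoff_average S (f i n) (r k) x"
  have am[measurable]: "birkhoff_average S (f i n) k \<in> borel_measurable borel" for i n k
    by (rule birkhoff_average_measurable[OF borel_S f_measurable])
  have [measurable]: "Measurable.pred borel (\<lambda>y. (\<lambda>k. ?a i n k y) \<longlonglongrightarrow> (\<integral>z. f i n z \<partial>K y))" for i n
  proof -
    \<comment> \<open>Convergence to a limit that varies with \<open>y\<close> is split into the
      Cauchy property and an equation for \<open>lim\<close>, each of which is a measurable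
      condition.\<close>
    have eq: "(\<lambda>k. ?a i n k y) \<longlonglongrightarrow> (\<integral>z. f i n z \<partial>K y) \<longleftrightarrow>
       Cauchy (\<lambda>k. ?a i n k y) \<and> lim (\<lambda>k. ?a i n k y) = (\<integral>z. f i n z \<partial>K y)" for y
      unfolding Cauchy_convergent_iff by (metis convergentI convergent_LIMSEQ_iff limI)
    have [measurable]: "Measurable.pred borel (\<lambda>y. Cauchy (\<lambda>k. ?a i n k y))"
      unfolding pred_def by (rule sets_Collect_Cauchy) (rule am)
    show ?thesis unfolding eq by measurable
  qed
  have "AE x in \<kappa>. AE y in K x. \<forall>i n. (\<lambda>k. ?a i n k y) \<longlonglongrightarrow> (\<integral>z. f i n z \<partial>K y)"
    by (rule AE_K_AE[OF _ average_tendsto]) measurable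
  with AE_K_constant AE_K_invariant AE_prob_K show ?thesis
  proof eventually_elim
    case (elim x)
    let ?L = "K x"
    interpret L: prob_space ?L by (rule elim(3))
    have S_L: "S \<in> measurable ?L ?L"
      by (simp add: measurable_cong_sets[OF sets_K sets_K])
    have "distr ?L ?L S = ?L"
      using elim(2) by (metis distr_cong sets_K)
    with S_L interpret mp: measure_preserving ?L S by unfold_locales
    have lim: "AE y in ?L. (\<lambda>k. ?a i n k y) \<longlonglongrightarrow> (\<integral>z. f i n z \<partial>?L)" for i n
      using elim(1,4) by eventually_elim metis
    have "measure ?L A = 0 \<or> measure ?L A = 1" if A: "A \<in> sets borel" and inv: "S -` A = A" for A
    proof -
      have A_L[measurable]: "A \<in> sets ?L" using A by (simp add: sets_K)
      have fL: "f i n \<in> borel_measurable ?L" for i n by (rule measurable_K[OF f_measurable])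
      have ind: "indicator A (S y) = (indicator A y :: real)" for y
        using inv by (auto simp: indicator_def)
      have eq: "(\<integral>y. indicator A y * f i n y \<partial>?L) = measure ?L A * (\<integral>z. f i n z \<partial>?L)" for i n
      proof (rule LIMSEQ_unique)
        have "\<forall>\<^sub>F k in sequentially. (\<integral>y. indicator A y * ?a i n k y \<partial>?L) = (\<integral>y. indicator A y * f i n y \<partial>?L)"
          using eventually_subseq[OF r_mono eventually_gt_at_top[of 0]]
          by eventually_elim
            (rule mp.integral_invariant_mult_average[where f="f i n" and w="indicator A" and C=1 and D=1];
              use fL abs_f_le_1 ind in auto)
        then show "(\<lambda>k. \<integral>y. indicator A y * ?a i n k y \<partial>?L) \<longlonglongrightarrow> (\<integral>y. indicator A y * f i n y \<partial>?L)"
          by (rule tendsto_eventually)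
        have "(\<lambda>k. \<integral>y. indicator A y * ?a i n k y \<partial>?L) \<longlonglongrightarrow> (\<integral>y. indicator A y * (\<integral>z. f i n z \<partial>?L) \<partial>?L)"
        proof (rule integral_dominated_convergence[where w="\<lambda>_. 1"])
          show "AE y in ?L. (\<lambda>k. indicator A y * ?a i n k y) \<longlonglongrightarrow> indicator A y * (\<integral>z. f i n z \<partial>?L)"
            using lim[of i n] by eventually_elim (intro tendsto_mult_left)
          show "AE y in ?L. norm (indicator A y * ?a i n k y) \<le> 1" for k
            using birkhoff_average_bounded[where f="f i n", OF abs_f_le_1]
            by (intro AE_I2) (auto simp: indicator_def)
        qed (use measurable_K[OF am] in auto)
        then show "(\<lambda>k. \<integral>y. indicator A y * ?a i n k y \<partial>?L) \<longlonglongrightarrow> measure ?L A * (\<integral>z. f i n z \<partial>?L)"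
          using A_L by (simp add: space_K)
      qed
      let ?M = "density ?L (\<lambda>y. ennreal (indicator A y))" and ?N = "density ?L (\<lambda>_. ennreal (measure ?L A))"
      have M_A: "emeasure ?M B = emeasure ?L (A \<inter> B)" if "B \<in> sets borel" for B
        using that A_L by (subst emeasure_density) (auto simp: sets_K ennreal_indicator indicator_inter_arith[symmetric])
      have N_A: "emeasure ?N B = ennreal (measure ?L A) * emeasure ?L B" if "B \<in> sets borel" for B
        using that by (subst emeasure_density) (auto simp: sets_K nn_integral_cmult)
      have "?M = ?N"
      proof (rule measure_eqI_f)
        show "(\<integral>y. f i n y \<partial>?M) = (\<integral>y. f i n y \<partial>?N)" for i n
          using eq[of i n] fL[of i n] by (subst (1 2) integral_density) auto
        show "finite_measure ?M" "finite_measure ?N"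
          using M_A[of UNIV] N_A[of UNIV]
          by (auto intro!: finite_measureI simp: space_K L.emeasure_eq_measure ennreal_mult_eq_top_iff)
      qed (auto simp: sets_K)
      then have "emeasure ?L A = ennreal (measure ?L A) * emeasure ?L A"
        using M_A[OF A] N_A[OF A] by simp
      then have "measure ?L A = measure ?L A * measure ?L A"
        by (simp add: L.emeasure_eq_measure flip: ennreal_mult)
      then show ?thesis by simp
    qed
    then show ?case
      using L.prob_space_axioms elim(2) by (simp add: ergodic_prob_measure_def invariant_measure_def sets_K)
  qed
qed

end

text \<open>Almost every fibre of \<kappa> is ergodic and, like \<kappa>, null on \<open>Z\<close>,
  so it equals \<mu>; integrating the constant family of fibres gives back \<kappa>. The assumption
  \<open>unique\<close> is the form in which (3) enters: an ergodic measure other than \<mu> gives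
  \<open>Z\<close> mass 1, not 0.\<close>

theorem invariant_measure_unique_off_null_set:
  fixes \<kappa> \<mu> :: "'a::{t2_space, second_countable_topology} measure"
  assumes lc: "locally_compact_space (euclidean :: 'a topology)"
    and \<kappa>: "prob_space \<kappa>" "invariant_measure S \<kappa>"
    and Z: "Z \<in> sets borel" "measure \<kappa> Z = 0"
    and unique: "\<And>\<rho>. ergodic_prob_measure S \<rho> \<Longrightarrow> measure \<rho> Z = 0 \<Longrightarrow> \<rho> = \<mu>"
  shows "\<kappa> = \<mu>"
proof -
  obtain U :: "nat \<Rightarrow> 'a set" and f where "determining_Cc_family U f"
    using determining_Cc_family_exists[OF lc] by blast
  then interpret determining_Cc_family U f .
  have sets_\<kappa>: "sets \<kappa> = sets borel" and S: "S \<in> measurable borel borel" and inv: "distr \<kappa> borel S = \<kappa>"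
    using \<kappa>(2) by (auto simp: invariant_measure_def)
  have "measure_preserving \<kappa> S"
  proof -
    interpret prob_space \<kappa> by fact
    show ?thesis
      using S inv distr_cong[OF refl sets_\<kappa> refl, where f=S]
      by unfold_locales (auto simp: measurable_cong_sets[OF sets_\<kappa> sets_\<kappa>])
  qed
  then obtain K r where "invariant_disintegration U f \<kappa> S K r"
    using invariant_disintegration_exists[OF lc _ sets_\<kappa>] by blast
  then interpret invariant_disintegration U f \<kappa> S K r .
  have K\<mu>: "AE x in \<kappa>. K x = \<mu>"
    using AE_ergodic_K AE_K_null[OF Z] by eventually_elim (rule unique)
  \<comment> \<open>One fibre equal to \<mu> is needed to learn that \<mu> is a finite Borel
    measure.\<close>
  have "\<exists>x. K x = \<mu>"
  proof (rule ccontr)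
    assume "\<nexists>x. K x = \<mu>"
    with K\<mu> have "AE x in \<kappa>. False" by simp
    then show False by (simp add: AE_False)
  qed
  then obtain x where "K x = \<mu>" by blast
  then have \<mu>: "sets \<mu> = sets borel" "finite_measure \<mu>"
    using sets_K[of x] subprob_K[of x] by (auto simp: subprob_space_def)
  show ?thesis
  proof (rule measure_eqI_f[OF finite_measure_axioms sets_\<kappa> \<mu>(2,1)])
    fix i n
    have "(\<integral>x. f i n x \<partial>\<kappa>) = (\<integral>x. (\<integral>y. f i n y \<partial>K x) \<partial>\<kappa>)"
      by (rule integral_K[OF f_measurable abs_f_le_1, symmetric])
    also have "\<dots> = (\<integral>x. (\<integral>y. f i n y \<partial>\<mu>) \<partial>\<kappa>)"
      using K\<mu> by (intro integral_cong_AE measurable_\<kappa>) (auto elim: eventually_mono)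
    finally show "(\<integral>x. f i n x \<partial>\<kappa>) = (\<integral>y. f i n y \<partial>\<mu>)" using prob_space by simp
  qed
qed

subsection \<open>Orbits with good times\<close>

text \<open>A window from N / l to N inside \<open>A\<close> already fills a proportion 1 - 1 / l of
  the integers up to N, and \<open>N \<ge> l\<close> makes such N arbitrarily late as l
  grows.\<close>

lemma upper_density_eq_1I:
  assumes "\<And>l. 1 \<le> l \<Longrightarrow> \<exists>N\<ge>l. \<forall>m. 1 \<le> m \<and> m \<le> N \<and> N \<le> l * m \<longrightarrow> m \<in> A"
  shows "upper_density A = 1"
proof -
  let ?d = "\<lambda>N. ereal (real (card (A \<inter> {1..N})) / real N)"
  have card_le: "card (A \<inter> {1..N}) \<le> N" for N
    using card_mono[of "{1..N}" "A \<inter> {1..N}"] by simp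
  have "limsup ?d \<le> 1"
    using card_le by (intro Limsup_bounded always_eventually allI) (auto simp: divide_le_eq_1)
  moreover have "1 \<le> limsup ?d"
  proof (rule ccontr)
    assume "\<not> 1 \<le> limsup ?d"
    then have "limsup ?d < 1" by (simp only: not_le)
    from ereal_dense2[OF this] obtain c :: real where c: "limsup ?d < ereal c" "ereal c < 1"
      by (elim exE conjE) (rule that)
    then obtain N0 where N0: "\<And>N. N0 \<le> N \<Longrightarrow> ?d N < ereal c"
      using Limsup_lessD[OF c(1)] by (auto simp: eventually_sequentially)
    have "0 < 1 - c" using c(2) by (simp add: one_ereal_def)
    then obtain l0 where l0: "1 / real (Suc l0) < 1 - c" using nat_approx_posE by blast
    define l where "l = max N0 (Suc l0)"
    have l: "1 \<le> l" "N0 \<le> l" "1 / real l < 1 - c"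
      using l0 by (auto simp: l_def max_def intro: le_less_trans[OF _ l0] simp: frac_le)
    obtain N where N: "l \<le> N" "\<And>m. 1 \<le> m \<Longrightarrow> m \<le> N \<Longrightarrow> N \<le> l * m \<Longrightarrow> m \<in> A"
      using assms[OF l(1)] by blast
    have "{N div l<..N} \<subseteq> A \<inter> {1..N}"
    proof
      fix m assume m: "m \<in> {N div l<..N}"
      have "N < l * m"
        using m l(1) by (simp add: div_less_iff_less_mult mult.commute)
      with m N show "m \<in> A \<inter> {1..N}" by auto
    qed
    from card_mono[OF _ this] have "N - N div l \<le> card (A \<inter> {1..N})" by simp
    moreover have "real (N div l) \<le> real N / real l" by (rule of_nat_div_le_of_nat)
    moreover have "N div l \<le> N" by simp
    ultimately have "real N - real N / real l \<le> real (card (A \<inter> {1..N}))"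
      by linarith
    then have "(real N - real N / real l) / real N \<le> real (card (A \<inter> {1..N})) / real N"
      by (rule divide_right_mono) simp
    also have "(real N - real N / real l) / real N = 1 - 1 / real l"
      using N(1) l(1) by (simp add: field_simps)
    finally have "c < real (card (A \<inter> {1..N})) / real N" using l(3) by linarith
    with N0[of N] N(1) l(2) show False by simp
  qed
  ultimately show ?thesis unfolding upper_density_def by (rule antisym)
qed

text \<open>No uniform approximation of \<psi> by the \<open>f i n\<close> is involved. A
  subsequence along which the integrals of \<psi> stay away from the claimed limit would have a
  weak-* convergent subsequence, and its limit agrees with \<open>L\<close> on the determining
  family.\<close>

lemma (in determining_Cc_family) weak_star_conv_of_determining:
  assumes lc: "locally_compact_space (euclidean :: 'a topology)"
    and M: "\<And>n. sets (M n) = sets borel" "\<And>n. finite_measure (M n)" "\<And>n. measure (M n) UNIV \<le> 1"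
    and L: "sets L = sets borel" "finite_measure L"
    and lim: "\<And>i n. (\<lambda>k. \<integral>x. f i n x \<partial>M k) \<longlonglongrightarrow> (\<integral>x. f i n x \<partial>L)"
  shows "weak_star_conv M L"
  unfolding weak_star_conv_def
proof (rule ballI, rule ccontr)
  fix \<psi> :: "'a \<Rightarrow> real" assume \<psi>: "\<psi> \<in> Cc"
  assume "\<not> (\<lambda>n. \<integral>x. \<psi> x \<partial>M n) \<longlonglongrightarrow> (\<integral>x. \<psi> x \<partial>L)"
  then obtain e where e0: "0 < e" "\<not> (\<forall>\<^sub>F n in sequentially. dist (\<integral>x. \<psi> x \<partial>M n) (\<integral>x. \<psi> x \<partial>L) < e)"
    unfolding tendsto_iff by blast
  then have e: "0 < e" "\<exists>\<^sub>F n in sequentially. e \<le> dist (\<integral>x. \<psi> x \<partial>M n) (\<integral>x. \<psi> x \<partial>L)"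
    by (simp_all add: not_eventually not_less)
  define B where "B = {n. e \<le> dist (\<integral>x. \<psi> x \<partial>M n) (\<integral>x. \<psi> x \<partial>L)}"
  have inf: "infinite B"
    using e(2) unfolding B_def cofinite_eq_sequentially[symmetric] frequently_cofinite .
  define m where "m = enumerate B"
  have m: "strict_mono m" "m k \<in> B" for k
    using strict_mono_enumerate[OF inf] enumerate_in_set[OF inf] by (auto simp: m_def)
  obtain s N where s: "strict_mono s" and N: "sets N = sets borel" "finite_measure N"
      and conv: "weak_star_conv ((M \<circ> m) \<circ> s) N"
    using weak_star_sequentially_compact[where M="M \<circ> m", OF lc] M by (metis comp_apply)
  have ms: "strict_mono (m \<circ> s)" using m(1) s by (rule strict_mono_o)
  have "N = L"
  proof (rule measure_eqI_f[OF N(2,1) L(2,1)])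
    fix i n
    have "(\<lambda>k. \<integral>x. f i n x \<partial>M ((m \<circ> s) k)) \<longlonglongrightarrow> (\<integral>x. f i n x \<partial>L)"
      using LIMSEQ_subseq_LIMSEQ[OF lim[of i n] ms] by (simp add: o_def)
    moreover have "(\<lambda>k. \<integral>x. f i n x \<partial>M ((m \<circ> s) k)) \<longlonglongrightarrow> (\<integral>x. f i n x \<partial>N)"
      using conv f_Cc[of i n] by (simp add: weak_star_conv_def)
    ultimately show "(\<integral>x. f i n x \<partial>N) = (\<integral>x. f i n x \<partial>L)" by (rule LIMSEQ_unique[rotated])
  qed
  then have "(\<lambda>k. \<integral>x. \<psi> x \<partial>M ((m \<circ> s) k)) \<longlonglongrightarrow> (\<integral>x. \<psi> x \<partial>L)"
    using conv \<psi> by (simp add: weak_star_conv_def)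
  then have "\<forall>\<^sub>F k in sequentially. dist (\<integral>x. \<psi> x \<partial>M ((m \<circ> s) k)) (\<integral>x. \<psi> x \<partial>L) < e"
    using e(1) by (rule tendstoD)
  moreover have "\<not> dist (\<integral>x. \<psi> x \<partial>M ((m \<circ> s) k)) (\<integral>x. \<psi> x \<partial>L) < e" for k
    using m(2)[of "s k"] by (simp add: B_def)
  ultimately show False by simp
qed

section \<open>Test functions adapted to a null set and to tightness\<close>

lemma compact_null_small_Cc:
  fixes \<mu> :: "'a::{t2_space, second_countable_topology} measure"
  assumes lc: "locally_compact_space (euclidean :: 'a topology)"
    and \<mu>: "finite_measure \<mu>" "sets \<mu> = sets borel"
    and K: "compact K" "measure \<mu> K = 0" and e: "0 < e"
  shows "\<exists>F\<in>Cc. (\<forall>x. 0 \<le> F x \<and> F x \<le> (1::real)) \<and> (\<forall>x\<in>K. F x = 1) \<and> (\<integral>x. F x \<partial>\<mu>) < e"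
proof -
  interpret finite_measure \<mu> by fact
  obtain \<eta> :: "'a \<Rightarrow> real" where \<eta>: "\<eta> \<in> Cc" "\<forall>x. 0 \<le> \<eta> x \<and> \<eta> x \<le> 1" "\<forall>x\<in>K. \<eta> x = 1"
    using Urysohn_Cc[OF lc K(1) open_UNIV] by auto
  have "open (- K)" using K(1) by (simp add: compact_imp_closed open_Compl)
  from open_indicator_limit_Cc[OF lc this]
  obtain \<psi> :: "nat \<Rightarrow> 'a \<Rightarrow> real" where \<psi>: "\<forall>n. \<psi> n \<in> Cc" "\<forall>n x. 0 \<le> \<psi> n x \<and> \<psi> n x \<le> 1"
      "\<forall>n x. x \<notin> - K \<longrightarrow> \<psi> n x = 0" "\<forall>x. (\<lambda>n. \<psi> n x) \<longlonglongrightarrow> indicator (- K) x"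
    by (elim exE conjE) (rule that)
  \<comment> \<open>The factor \<open>1 - \<psi> n\<close> equals 1 on \<open>K\<close> and tends to
    0 off \<open>K\<close>, while the cutoff \<open>\<eta>\<close> supplies compact support.
    Dominated convergence thus takes the place of outer regularity.\<close>
  define F where "F n x = \<eta> x * (1 - \<psi> n x)" for n x
  have F: "F n \<in> Cc" for n
  proof (rule CcI_dominated[OF _ \<eta>(1)])
    show "continuous_on UNIV (F n)"
      unfolding F_def using \<eta>(1) \<psi>(1) by (intro continuous_intros) (auto simp: Cc_def)
  qed (simp add: F_def)
  have F01: "0 \<le> F n x" "F n x \<le> 1" for n x
    using \<eta>(2) \<psi>(2) by (auto simp: F_def intro!: mult_le_one)
  have Kb: "K \<in> sets \<mu>" using K(1) by (simp add: \<mu>(2) borel_compact)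
  have "(\<lambda>n. \<integral>x. F n x \<partial>\<mu>) \<longlonglongrightarrow> (\<integral>x. indicator K x \<partial>\<mu>)"
  proof (rule integral_dominated_convergence[where w="\<lambda>_. 1"])
    have "(\<lambda>n. F n x) \<longlonglongrightarrow> \<eta> x * (1 - indicator (- K) x)" for x
      unfolding F_def using \<psi>(4) by (intro tendsto_intros) auto
    moreover have "\<eta> x * (1 - indicator (- K) x) = indicator K x" for x
      using \<eta>(3) by (auto simp: indicator_def)
    ultimately show "AE x in \<mu>. (\<lambda>n. F n x) \<longlonglongrightarrow> indicator K x" by simp
  qed (use Kb borel_compact[OF K(1)] F01 Cc_measurable[OF F] in \<open>auto simp: measurable_cong_sets[OF \<mu>(2) refl]\<close>)
  then have "(\<lambda>n. \<integral>x. F n x \<partial>\<mu>) \<longlonglongrightarrow> 0" using Kb K(2) by simp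
  then have "\<forall>\<^sub>F n in sequentially. (\<integral>x. F n x \<partial>\<mu>) < e" using e by (rule order_tendstoD)
  then obtain n where "(\<integral>x. F n x \<partial>\<mu>) < e" by (auto simp: eventually_sequentially)
  moreover have "\<forall>x\<in>K. F n x = 1" using \<eta>(3) \<psi>(3) by (simp add: F_def)
  ultimately show ?thesis using F F01 by (intro bexI[of _ "F n"]) auto
qed

lemma Cc_approximates_1:
  fixes \<mu> :: "'a::{t2_space, second_countable_topology} measure"
  assumes lc: "locally_compact_space (euclidean :: 'a topology)"
    and \<mu>: "prob_space \<mu>" "sets \<mu> = sets borel" and e: "0 < e"
  shows "\<exists>g\<in>Cc. (\<forall>x. 0 \<le> g x \<and> g x \<le> (1::real)) \<and> 1 - e < (\<integral>x. g x \<partial>\<mu>)"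
proof -
  interpret prob_space \<mu> by fact
  have [simp]: "space \<mu> = UNIV" using sets_eq_imp_space_eq[OF \<mu>(2)] by simp
  from open_indicator_limit_Cc[OF lc open_UNIV]
  obtain \<psi> :: "nat \<Rightarrow> 'a \<Rightarrow> real" where \<psi>: "\<forall>n. \<psi> n \<in> Cc" "\<forall>n x. 0 \<le> \<psi> n x \<and> \<psi> n x \<le> 1"
      "\<forall>x. (\<lambda>n. \<psi> n x) \<longlonglongrightarrow> indicator UNIV x"
    by (elim exE conjE) (rule that)
  have "\<psi> n \<in> borel_measurable borel" for n using \<psi>(1) Cc_measurable by blast
  then have "(\<lambda>n. \<integral>x. \<psi> n x \<partial>\<mu>) \<longlonglongrightarrow> measure \<mu> UNIV"
    using \<psi> finite_measure_axioms
    by (intro tendsto_integral_indicator) (auto simp: measurable_cong_sets[OF \<mu>(2) refl] \<mu>(2))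
  then have "(\<lambda>n. \<integral>x. \<psi> n x \<partial>\<mu>) \<longlonglongrightarrow> 1" using prob_space by simp
  then have "\<forall>\<^sub>F n in sequentially. 1 - e < (\<integral>x. \<psi> n x \<partial>\<mu>)" using e by (intro order_tendstoD) auto
  then obtain n where "1 - e < (\<integral>x. \<psi> n x \<partial>\<mu>)" by (auto simp: eventually_sequentially)
  with \<psi> show ?thesis by (intro bexI[of _ "\<psi> n"]) auto
qed

text \<open>The set \<open>Z\<close> is the union of the \<open>K i\<close>. The assumption \<open>good\<close> says that for infinitely many \<open>j\<close> the
  empirical measure at time \<open>n j\<close> gives little mass to neighbourhoods of \<open>Z\<close> and of infinity.\<close>

locale good_orbit =
  fixes y :: "nat \<Rightarrow> 'a::{t2_space, second_countable_topology}" and \<mu> :: "'a measure" and S :: "'a \<Rightarrow> 'a"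
    and K :: "nat \<Rightarrow> 'a set" and F g :: "nat \<Rightarrow> 'a \<Rightarrow> real" and n :: "nat \<Rightarrow> nat" and C :: real
  assumes lc: "locally_compact_space (euclidean :: 'a topology)"
    and \<mu>: "prob_space \<mu>" "sets \<mu> = sets borel"
    and limit_invariant: "\<And>\<kappa>. weak_star_limit_point (cesaro_measure (\<lambda>n. return borel (y n))) \<kappa> \<Longrightarrow>
      invariant_measure S \<kappa>"
    and unique: "\<And>\<rho>. ergodic_prob_measure S \<rho> \<Longrightarrow> measure \<rho> (\<Union>i. K i) = 0 \<Longrightarrow> \<rho> = \<mu>"
    and K: "\<And>i. compact (K i)" "incseq K"
    and F: "\<And>i. F i \<in> Cc" "\<And>i x. 0 \<le> F i x" "\<And>i x. x \<in> K i \<Longrightarrow> 1 \<le> F i x"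
    and g: "\<And>i. g i \<in> Cc" "\<And>i x. 0 \<le> g i x" "\<And>i x. g i x \<le> 1"
    and n_mono: "strict_mono n"
    and good: "\<exists>\<^sub>\<infinity>j. \<forall>i\<le>j. (\<Sum>m=1..n j. F i (y m) + (1 - g i (y m))) / n j \<le> C / 2 ^ i"
begin

abbreviation avg :: "nat \<Rightarrow> ('a \<Rightarrow> real) \<Rightarrow> real" where
  "avg N \<psi> \<equiv> (\<Sum>m=1..N. \<psi> (y m)) / N"

abbreviation emp :: "nat \<Rightarrow> 'a measure" where
  "emp \<equiv> cesaro_measure (\<lambda>n. return borel (y n))"

definition good_time :: "nat \<Rightarrow> bool" where
  "good_time j \<longleftrightarrow> (\<forall>i\<le>j. avg (n j) (\<lambda>x. F i x + (1 - g i x)) \<le> C / 2 ^ i)"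

lemma integral_emp: "\<psi> \<in> Cc \<Longrightarrow> 0 < N \<Longrightarrow> (\<integral>x. \<psi> x \<partial>emp N) = avg N \<psi>"
  using Cc_bounded[of \<psi>] integral_empirical_measure[OF Cc_measurable, of \<psi> _ N y] by metis

text \<open>The summands are nonnegative, so cutting the sum at \<open>m\<close> only decreases it,
  while the divisor shrinks by a factor of at most \<open>l\<close>. Both parts of the bound follow
  since neither \<open>avg m (F i)\<close> nor \<open>1 - avg m (g i)\<close> can be
  negative.\<close>

lemma good_window:
  fixes l :: nat
  assumes "good_time j" "i \<le> j" "0 < m" "m \<le> n j" "n j \<le> l * m"
  shows "avg m (F i) \<le> l * C / 2 ^ i" "1 - l * C / 2 ^ i \<le> avg m (g i)"
proof -
  let ?H = "\<lambda>x. F i x + (1 - g i x)"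
  have H: "0 \<le> ?H x" for x using F(2)[of i x] g(3)[of i x] by simp
  have nj: "0 < n j" using assms by simp
  have "(\<Sum>k=1..m. ?H (y k)) \<le> (\<Sum>k=1..n j. ?H (y k))"
    using assms(4) H by (intro sum_mono2) auto
  also have "\<dots> \<le> n j * (C / 2 ^ i)"
    using assms(1,2) nj by (auto simp: good_time_def pos_divide_le_eq mult.commute)
  finally have 1: "(\<Sum>k=1..m. ?H (y k)) \<le> n j * (C / 2 ^ i)" .
  have "0 \<le> (\<Sum>k=1..m. ?H (y k))" using H by (intro sum_nonneg)
  then have "0 \<le> n j * (C / 2 ^ i)" using 1 by linarith
  then have C0: "0 \<le> C / 2 ^ i" using nj mult_le_cancel_left_pos[of "real (n j)" 0 "C / 2 ^ i"] by simp
  have "real (n j) * (C / 2 ^ i) \<le> (l * m) * (C / 2 ^ i)"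
    using assms(5) C0 by (intro mult_right_mono) (auto simp flip: of_nat_mult)
  with 1 have "(\<Sum>k=1..m. ?H (y k)) \<le> (l * C / 2 ^ i) * m"
    by (simp add: mult_ac)
  then have HH: "avg m ?H \<le> l * C / 2 ^ i"
    using assms(3) by (simp add: pos_divide_le_eq)
  have split: "avg m ?H = avg m (F i) + (1 - avg m (g i))"
    using assms(3) by (simp add: sum.distrib sum_subtractf add_divide_distrib diff_divide_distrib)
  have "avg m (g i) \<le> (\<Sum>k=1..m. 1) / m" using g(3) by (intro divide_right_mono sum_mono) auto
  then have "avg m (g i) \<le> 1" using assms(3) by simp
  moreover have "0 \<le> avg m (F i)" using F(2) by (intro divide_nonneg_nonneg sum_nonneg) auto
  ultimately show "avg m (F i) \<le> l * C / 2 ^ i" "1 - l * C / 2 ^ i \<le> avg m (g i)"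
    using HH split by linarith+
qed

lemma limit_point_eq:
  fixes l :: nat
  assumes m: "strict_mono m" and j: "\<And>k. k \<le> j k" "\<And>k. good_time (j k)"
    and window: "\<And>k. m k \<le> n (j k)" "\<And>k. n (j k) \<le> l * m k"
    and L: "sets L = sets borel" "finite_measure L" "measure L UNIV \<le> 1"
    and conv: "weak_star_conv (emp \<circ> m) L"
  shows "L = \<mu>"
proof -
  interpret L: finite_measure L by (rule L(2))
  have space_L: "space L = UNIV" using sets_eq_imp_space_eq[OF L(1)] by simp
  have inv: "invariant_measure S L"
    using limit_invariant L m conv by (auto simp: weak_star_limit_point_def)
  have pos: "0 < m k" if "0 < k" for k
    using strict_mono_imp_increasing[OF m, of k] that by linarith
  have lim: "(\<lambda>k. avg (m k) \<psi>) \<longlonglongrightarrow> (\<integral>x. \<psi> x \<partial>L)" if "\<psi> \<in> Cc" for \<psi>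
  proof (rule Lim_transform_eventually)
    show "(\<lambda>k. \<integral>x. \<psi> x \<partial>emp (m k)) \<longlonglongrightarrow> (\<integral>x. \<psi> x \<partial>L)"
      using conv that by (simp add: weak_star_conv_def)
    show "\<forall>\<^sub>F k in sequentially. (\<integral>x. \<psi> x \<partial>emp (m k)) = avg (m k) \<psi>"
      using eventually_gt_at_top[of 0] by eventually_elim (rule integral_emp[OF that pos])
  qed
  have FL: "(\<integral>x. F i x \<partial>L) \<le> l * C / 2 ^ i" for i
  proof (rule LIMSEQ_le_const2[OF lim[OF F(1)]])
    \<comment> \<open>Level \<open>i\<close> is controlled as soon as \<open>j k \<ge> i\<close>;
      the successor also ensures \<open>k > 0\<close> and with it \<open>m k > 0\<close>.\<close>
    have "avg (m k) (F i) \<le> l * C / 2 ^ i" if "Suc i \<le> k" for k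
      using that j(1)[of k] pos[of k] by (intro good_window(1)[OF j(2)[of k]] window) auto
    then show "\<exists>N. \<forall>k\<ge>N. avg (m k) (F i) \<le> l * C / 2 ^ i" by blast
  qed
  have gL: "1 - l * C / 2 ^ i \<le> (\<integral>x. g i x \<partial>L)" for i
  proof (rule LIMSEQ_le_const[OF lim[OF g(1)]])
    have "1 - l * C / 2 ^ i \<le> avg (m k) (g i)" if "Suc i \<le> k" for k
      using that j(1)[of k] pos[of k] by (intro good_window(2)[OF j(2)[of k]] window) auto
    then show "\<exists>N. \<forall>k\<ge>N. 1 - l * C / 2 ^ i \<le> avg (m k) (g i)" by blast
  qed
  have to0: "(\<lambda>i. l * C / 2 ^ i) \<longlonglongrightarrow> 0"
    using tendsto_mult_left[OF LIMSEQ_realpow_zero[of "1/2"], of "l * C"]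
    by (simp add: power_divide)
  have Kb: "K i \<in> sets L" for i using K(1) by (simp add: L(1) borel_compact)
  \<comment> \<open>The bound at level \<open>i\<close> is fixed and positive in general. Since
    \<open>K\<close> increases, every later level \<open>p\<close> bounds the same set, and its
    bound tends to 0.\<close>
  have "measure L (K i) \<le> l * C / 2 ^ p" if "i \<le> p" for i p
  proof -
    have "measure L (K i) \<le> measure L (K p)"
      using K(2) that Kb by (intro L.finite_measure_mono) (auto simp: incseq_def)
    also have "\<dots> = (\<integral>x. indicator (K p) x \<partial>L)" using Kb by (simp add: space_L)
    also have "\<dots> \<le> (\<integral>x. F p x \<partial>L)"
    proof (rule integral_mono)
      show "integrable L (indicator (K p) :: 'a \<Rightarrow> real)"
        using Kb by (intro integrable_real_indicator) (auto simp: L.emeasure_eq_measure)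
    qed (use F Cc_integrable[OF F(1) L(2,1)] in \<open>auto simp: indicator_def\<close>)
    also note FL[of p]
    finally show ?thesis .
  qed
  then have "measure L (K i) \<le> 0" for i
    by (intro LIMSEQ_le_const[OF to0]) blast
  then have "emeasure L (K i) = 0" for i
    by (simp add: L.emeasure_eq_measure measure_le_0_iff)
  then have null: "measure L (\<Union>i. K i) = 0"
    using emeasure_UN_eq_0[of L K] Kb by (simp add: measure_def image_subset_iff)
  \<comment> \<open>No mass has escaped: \<open>g i \<le> 1\<close> has integral over
    \<open>L\<close> at least \<open>1 - l * C / 2 ^ i\<close>.\<close>
  have "1 - 0 \<le> measure L UNIV"
  proof (rule LIMSEQ_le_const2[OF tendsto_diff[OF tendsto_const to0]])
    have "(\<integral>x. g i x \<partial>L) \<le> (\<integral>x. 1 \<partial>L)" for i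
      using g Cc_integrable[OF g(1) L(2,1)] by (intro integral_mono) auto
    then show "\<exists>N. \<forall>i\<ge>N. 1 - l * C / 2 ^ i \<le> measure L UNIV"
      using gL by (auto simp: space_L intro: order_trans)
  qed
  with L(3) have "prob_space L"
    by (intro prob_spaceI) (simp add: space_L L.emeasure_eq_measure)
  then show "L = \<mu>"
    using Kb null by (intro invariant_measure_unique_off_null_set[OF lc _ inv _ null unique]) (auto simp: L(1)[symmetric])
qed

text \<open>The one parameter \<open>l\<close> controls lateness, window ratio, number of test
  functions and precision at once. If every late good time had a bad time in its window, the
  empirical measures at these bad times would have a limit point, which by
  \<open>limit_point_eq\<close> is \<mu>, against badness.\<close>

lemma window_approximation:
  fixes \<psi> :: "nat \<Rightarrow> 'a \<Rightarrow> real" and l :: nat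
  assumes \<psi>: "\<And>i. \<psi> i \<in> Cc" and l: "1 \<le> l"
  shows "\<exists>N\<ge>l. \<forall>m. 1 \<le> m \<and> m \<le> N \<and> N \<le> l * m \<longrightarrow> (\<forall>i\<le>l. \<bar>avg m (\<psi> i) - (\<integral>x. \<psi> i x \<partial>\<mu>)\<bar> < 1 / l)"
proof (rule ccontr)
  assume neg: "\<not> ?thesis"
  define bad where "bad m \<longleftrightarrow> (\<exists>i\<le>l. 1 / l \<le> \<bar>avg m (\<psi> i) - (\<integral>x. \<psi> i x \<partial>\<mu>)\<bar>)" for m
  have ex: "\<exists>j m. B \<le> j \<and> B \<le> m \<and> good_time j \<and> m \<le> n j \<and> n j \<le> l * m \<and> bad m" for B
  proof -
    have "\<exists>\<^sub>\<infinity>j. good_time j" using good by (simp add: good_time_def)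
    \<comment> \<open>The summand \<open>l\<close> makes \<open>n j\<close> a legitimate
      counterexample to \<open>neg\<close>, \<open>B\<close> gives \<open>j \<ge> B\<close>, and
      \<open>l * B\<close> gives \<open>m \<ge> B\<close> because
      \<open>l * B \<le> n j \<le> l * m\<close>.\<close>
    then obtain j where j: "l * B + B + l \<le> j" "good_time j" unfolding INFM_nat_le by blast
    have nj: "j \<le> n j" by (rule strict_mono_imp_increasing[OF n_mono])
    then have "l \<le> n j" using j(1) by linarith
    with neg have "\<not> (\<forall>m. 1 \<le> m \<and> m \<le> n j \<and> n j \<le> l * m \<longrightarrow> (\<forall>i\<le>l. \<bar>avg m (\<psi> i) - (\<integral>x. \<psi> i x \<partial>\<mu>)\<bar> < 1 / l))"
      by blast
    then obtain m where m: "m \<le> n j" "n j \<le> l * m" "bad m"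
      unfolding bad_def not_less[symmetric] by blast
    have "l * B \<le> l * m" using m(2) nj j(1) by linarith
    then have "B \<le> m" using l by simp
    with j m show ?thesis by (intro exI[of _ j] exI[of _ m]) auto
  qed
  define P where "P k q \<longleftrightarrow> k \<le> fst q \<and> good_time (fst q) \<and> snd q \<le> n (fst q) \<and> n (fst q) \<le> l * snd q \<and> bad (snd q)"
    for k :: nat and q :: "nat \<times> nat"
  have "\<exists>q. \<forall>k. P k (q k) \<and> snd (q k) < snd (q (Suc k))"
  \<comment> \<open>Successive choices, not independent ones, make the bad times strictly
    increasing, as a weak-* limit point requires.\<close>
  proof (rule dependent_nat_choice)
    show "\<exists>q. P 0 q" using ex[of 0] by (auto simp: P_def)
    show "\<exists>q'. P (Suc k) q' \<and> snd q < snd q'" for q k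
    proof -
      obtain j m where "Suc (k + snd q) \<le> j" "Suc (k + snd q) \<le> m" "good_time j" "m \<le> n j" "n j \<le> l * m" "bad m"
        using ex[of "Suc (k + snd q)"] by blast
      then show ?thesis by (intro exI[of _ "(j, m)"]) (simp add: P_def)
    qed
  qed
  then obtain q where q: "\<And>k. P k (q k)" "\<And>k. snd (q k) < snd (q (Suc k))" by blast
  define m j where "m k = snd (q k)" and "j k = fst (q k)" for k
  have m: "strict_mono m" using q(2) by (simp add: strict_mono_Suc_iff m_def)
  have P: "k \<le> j k" "good_time (j k)" "m k \<le> n (j k)" "n (j k) \<le> l * m k" "bad (m k)" for k
    using q(1)[of k] by (auto simp: P_def m_def j_def)
  have emp: "sets ((emp \<circ> m) k) = sets borel" "finite_measure ((emp \<circ> m) k)" "measure ((emp \<circ> m) k) UNIV \<le> 1" for k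
    by (simp_all add: finite_empirical_measure empirical_measure_UNIV_le)
  obtain s L where s: "strict_mono s" and L: "sets L = sets borel" "finite_measure L" "measure L UNIV \<le> 1"
    and conv: "weak_star_conv ((emp \<circ> m) \<circ> s) L"
    using weak_star_sequentially_compact[where M="emp \<circ> m", OF lc emp] by metis
  have ms: "strict_mono (m \<circ> s)" using m s by (rule strict_mono_o)
  have "L = \<mu>"
  proof (rule limit_point_eq[OF ms, where j="j \<circ> s" and l=l])
    show "k \<le> (j \<circ> s) k" for k
      using strict_mono_imp_increasing[OF s, of k] P(1)[of "s k"] by simp
  qed (use P L conv in \<open>auto simp: o_assoc\<close>)
  have "\<forall>\<^sub>F k in sequentially. \<forall>i\<in>{..l}. \<bar>avg (m (s k)) (\<psi> i) - (\<integral>x. \<psi> i x \<partial>\<mu>)\<bar> < 1 / l"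
  proof (intro eventually_ball_finite ballI finite_atMost)
    fix i
    have "(\<lambda>k. \<integral>x. \<psi> i x \<partial>emp (m (s k))) \<longlonglongrightarrow> (\<integral>x. \<psi> i x \<partial>\<mu>)"
      using conv \<psi>[of i] \<open>L = \<mu>\<close> by (simp add: weak_star_conv_def)
    then have "\<forall>\<^sub>F k in sequentially. dist (\<integral>x. \<psi> i x \<partial>emp (m (s k))) (\<integral>x. \<psi> i x \<partial>\<mu>) < 1 / l"
      using l by (intro tendstoD) auto
    then show "\<forall>\<^sub>F k in sequentially. \<bar>avg (m (s k)) (\<psi> i) - (\<integral>x. \<psi> i x \<partial>\<mu>)\<bar> < 1 / l"
      using eventually_gt_at_top[of 0]
    proof eventually_elim
      case (elim k)
      have "0 < m (s k)" using strict_mono_imp_increasing[OF ms, of k] elim(2) by simp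
      with elim(1) show ?case by (simp add: integral_emp[OF \<psi>] dist_real_def)
    qed
  qed
  then obtain k where "\<forall>i\<in>{..l}. \<bar>avg (m (s k)) (\<psi> i) - (\<integral>x. \<psi> i x \<partial>\<mu>)\<bar> < 1 / l"
    by (auto simp: eventually_sequentially)
  then show False using P(5)[of "s k"] by (force simp: bad_def)
qed

theorem generic_along_upper_density_1:
  "\<exists>A\<subseteq>{1..}. upper_density A = 1 \<and>
    (\<forall>\<psi>\<in>Cc. ((\<lambda>N. (1 / real N) * (\<Sum>n=1..N. \<psi> (y n))) \<longlongrightarrow> (\<integral>x. \<psi> x \<partial>\<mu>)) (inf sequentially (principal A)))"
proof -
  obtain U :: "nat \<Rightarrow> 'a set" and f where "determining_Cc_family U f"
    using determining_Cc_family_exists[OF lc] by blast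
  then interpret determining_Cc_family U f .
  interpret \<mu>: prob_space \<mu> by (rule \<mu>(1))
  define \<phi> where "\<phi> j = f (fst (prod_decode j)) (snd (prod_decode j))" for j
  have \<phi>: "\<phi> j \<in> Cc" for j by (simp add: \<phi>_def f_Cc)
  have "\<exists>N. \<forall>l::nat\<ge>1. l \<le> N l \<and> (\<forall>m. 1 \<le> m \<and> m \<le> N l \<and> N l \<le> l * m \<longrightarrow>
      (\<forall>i\<le>l. \<bar>avg m (\<phi> i) - (\<integral>x. \<phi> i x \<partial>\<mu>)\<bar> < 1 / l))"
    using window_approximation[of \<phi>, OF \<phi>] by metis
  then obtain N where N: "\<And>l::nat. 1 \<le> l \<Longrightarrow> l \<le> N l"
      "\<And>(l::nat) m i. 1 \<le> l \<Longrightarrow> 1 \<le> m \<Longrightarrow> m \<le> N l \<Longrightarrow> N l \<le> l * m \<Longrightarrow> i \<le> l \<Longrightarrow>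
        \<bar>avg m (\<phi> i) - (\<integral>x. \<phi> i x \<partial>\<mu>)\<bar> < 1 / l"
    by metis
  \<comment> \<open>Each \<open>l\<close> contributes the window of ratio \<open>l\<close> that ends
    at \<open>N l\<close>; these suffice for the density, and the precision improves with
    \<open>l\<close>.\<close>
  define A where "A = {m. 1 \<le> m \<and> (\<exists>l\<ge>1. m \<le> N l \<and> N l \<le> l * m)}"
  have dens: "upper_density A = 1"
  proof (rule upper_density_eq_1I)
    fix l :: nat assume l: "1 \<le> l"
    show "\<exists>N\<ge>l. \<forall>m. 1 \<le> m \<and> m \<le> N \<and> N \<le> l * m \<longrightarrow> m \<in> A"
      using N(1)[OF l] l by (intro exI[of _ "N l"]) (auto simp: A_def)
  qed
  have close: "\<exists>m0. \<forall>m\<ge>m0. m \<in> A \<longrightarrow> \<bar>avg m (\<phi> i) - (\<integral>x. \<phi> i x \<partial>\<mu>)\<bar> < e" if e: "0 < e" for i e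
  proof -
    obtain l0 where l0: "1 / real (Suc l0) < e" using nat_approx_posE[OF e] by blast
    \<comment> \<open>Beyond the right ends of the finitely many windows with index up to
      \<open>l0 + i\<close>, an element of \<open>A\<close> lies in a window with larger index.
      There the \<open>i\<close>-th test function is included and the error is below
      \<open>1 / Suc l0\<close>.\<close>
    show ?thesis
    proof (intro exI[of _ "Suc (\<Sum>l\<le>l0 + i. N l)"] allI impI)
      fix m assume m: "Suc (\<Sum>l\<le>l0 + i. N l) \<le> m" "m \<in> A"
      then obtain l where l: "1 \<le> m" "1 \<le> l" "m \<le> N l" "N l \<le> l * m" by (auto simp: A_def)
      have "\<not> l \<le> l0 + i"
      proof
        assume "l \<le> l0 + i"
        then have "N l \<le> (\<Sum>l\<le>l0 + i. N l)" by (intro member_le_sum) auto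
        with m(1) l(3) show False by linarith
      qed
      then have "\<bar>avg m (\<phi> i) - (\<integral>x. \<phi> i x \<partial>\<mu>)\<bar> < 1 / l" "1 / real l \<le> 1 / real (Suc l0)"
        using N(2)[OF l(2,1,3,4), of i] by (auto intro!: frac_le)
      with l0 show "\<bar>avg m (\<phi> i) - (\<integral>x. \<phi> i x \<partial>\<mu>)\<bar> < e" by linarith
    qed
  qed
  have "((\<lambda>N. (1 / real N) * (\<Sum>n=1..N. \<psi> (y n))) \<longlongrightarrow> (\<integral>x. \<psi> x \<partial>\<mu>)) (inf sequentially (principal A))"
    if \<psi>: "\<psi> \<in> Cc" for \<psi>
  proof (rule tendstoI, rule ccontr)
    fix e :: real assume e: "0 < e"
    assume "\<not> (\<forall>\<^sub>F N in inf sequentially (principal A). dist ((1 / real N) * (\<Sum>n=1..N. \<psi> (y n))) (\<integral>x. \<psi> x \<partial>\<mu>) < e)"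
    then have fr: "\<exists>\<^sub>F N in sequentially. N \<in> A \<and> \<not> dist (avg N \<psi>) (\<integral>x. \<psi> x \<partial>\<mu>) < e"
      by (simp add: eventually_inf_principal frequently_def)
    define B where "B = {N. N \<in> A \<and> \<not> dist (avg N \<psi>) (\<integral>x. \<psi> x \<partial>\<mu>) < e}"
    have inf: "infinite B"
      using fr unfolding B_def cofinite_eq_sequentially[symmetric] frequently_cofinite .
    define m where "m = enumerate B"
    have m: "strict_mono m" "m k \<in> B" for k
      using strict_mono_enumerate[OF inf] enumerate_in_set[OF inf] by (auto simp: m_def)
    have mA: "m k \<in> A" "0 < m k" for k using m(2)[of k] by (auto simp: B_def A_def)
    have "weak_star_conv (emp \<circ> m) \<mu>"
    proof (rule weak_star_conv_of_determining[OF lc])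
      fix i n
      have "(\<lambda>k. avg (m k) (\<phi> j)) \<longlonglongrightarrow> (\<integral>x. \<phi> j x \<partial>\<mu>)" for j
      proof (rule tendstoI)
        fix e :: real assume "0 < e"
        from close[OF this, of j] obtain m0 where m0: "\<And>m. m0 \<le> m \<Longrightarrow> m \<in> A \<Longrightarrow> \<bar>avg m (\<phi> j) - (\<integral>x. \<phi> j x \<partial>\<mu>)\<bar> < e"
          by blast
        show "\<forall>\<^sub>F k in sequentially. dist (avg (m k) (\<phi> j)) (\<integral>x. \<phi> j x \<partial>\<mu>) < e"
          using eventually_ge_at_top[of m0]
        proof eventually_elim
          case (elim k)
          then have "m0 \<le> m k" using strict_mono_imp_increasing[OF m(1), of k] by linarith
          then show ?case using m0 mA(1) by (simp add: dist_real_def)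
        qed
      qed
      from this[of "prod_encode (i, n)"]
      show "(\<lambda>k. \<integral>x. f i n x \<partial>(emp \<circ> m) k) \<longlonglongrightarrow> (\<integral>x. f i n x \<partial>\<mu>)"
        using integral_emp[OF f_Cc mA(2)] by (simp add: \<phi>_def)
    qed (use \<mu> \<mu>.finite_measure_axioms in \<open>auto simp: finite_empirical_measure empirical_measure_UNIV_le\<close>)
    then have "(\<lambda>k. \<integral>x. \<psi> x \<partial>emp (m k)) \<longlonglongrightarrow> (\<integral>x. \<psi> x \<partial>\<mu>)"
      using \<psi> by (simp add: weak_star_conv_def)
    then have "(\<lambda>k. avg (m k) \<psi>) \<longlonglongrightarrow> (\<integral>x. \<psi> x \<partial>\<mu>)"
      using integral_emp[OF \<psi> mA(2)] by simp
    then have "\<forall>\<^sub>F k in sequentially. dist (avg (m k) \<psi>) (\<integral>x. \<psi> x \<partial>\<mu>) < e"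
      using e by (rule tendstoD)
    moreover have "\<not> dist (avg (m k) \<psi>) (\<integral>x. \<psi> x \<partial>\<mu>) < e" for k
      using m(2)[of k] by (simp add: B_def)
    ultimately show False by simp
  qed
  with dens show ?thesis by (intro exI[of _ A]) (auto simp: A_def)
qed

end

subsection \<open>Selection of good times\<close>

text \<open>Bounded expectations of one weighted sum \<open>q j\<close> over all levels up to
  \<open>j\<close> make its lower limit finite almost everywhere by Fatou. So \<open>q j\<close>
  stays below a constant infinitely often, and each nonnegative term is bounded by the sum; handling
  all levels in one sum is what makes them small at the same times.\<close>

lemma (in prob_space) AE_infinitely_often_small:
  fixes b :: "nat \<Rightarrow> nat \<Rightarrow> 'a \<Rightarrow> real"
  assumes b: "\<And>i N. integrable M (b i N)" "\<And>i N x. 0 \<le> b i N x"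
    and small: "\<And>i. \<forall>\<^sub>F N in sequentially. (\<integral>x. b i N x \<partial>M) \<le> (1/4) ^ i"
  shows "\<exists>n. strict_mono n \<and> (AE x in M. \<exists>C. \<exists>\<^sub>\<infinity>j. \<forall>i\<le>j. b i (n j) x \<le> C / 2 ^ i)"
proof -
  obtain N0 where N0: "\<And>i N. N0 i \<le> N \<Longrightarrow> (\<integral>x. b i N x \<partial>M) \<le> (1/4) ^ i"
    using small unfolding eventually_sequentially by metis
  define n where "n j = j + (\<Sum>i\<le>j. N0 i)" for j
  have n: "strict_mono n" by (intro strict_mono_Suc_iff[THEN iffD2]) (simp add: n_def)
  have N0n: "N0 i \<le> n j" if "i \<le> j" for i j
    using member_le_sum[of i "{..j}" N0] that by (simp add: n_def)
  \<comment> \<open>The rate \<open>4 ^ -i\<close> is spent in two halves: after the weight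
    \<open>2 ^ i\<close> the expectations still sum to at most 2, and dividing a bound on
    \<open>q\<close> by the weight leaves the decay \<open>2 ^ -i\<close>.\<close>
  define q where "q j x = (\<Sum>i\<le>j. 2 ^ i * b i (n j) x)" for j x
  have q0: "0 \<le> q j x" for j x unfolding q_def using b(2) by (intro sum_nonneg mult_nonneg_nonneg) auto
  have qint: "integrable M (q j)" for j unfolding q_def using b(1) by auto
  have "(\<integral>x. q j x \<partial>M) \<le> 2" for j
  proof -
    have "(\<integral>x. q j x \<partial>M) = (\<Sum>i\<le>j. 2 ^ i * (\<integral>x. b i (n j) x \<partial>M))"
      unfolding q_def using b(1) by simp
    also have "\<dots> \<le> (\<Sum>i\<le>j. (1/2) ^ i)"
    proof (rule sum_mono)
      fix i assume "i \<in> {..j}"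
      then have "2 ^ i * (\<integral>x. b i (n j) x \<partial>M) \<le> 2 ^ i * (1/4) ^ i"
        using N0n by (intro mult_left_mono N0) auto
      then show "2 ^ i * (\<integral>x. b i (n j) x \<partial>M) \<le> (1/2) ^ i"
        by (simp flip: power_mult_distrib)
    qed
    also have "\<dots> \<le> (\<Sum>i. (1/2) ^ i)" by (intro sum_le_suminf) auto
    also have "\<dots> = 2" by (simp add: suminf_geometric)
    finally show ?thesis .
  qed
  then have "(\<integral>\<^sup>+x. ennreal (q j x) \<partial>M) \<le> 2" for j
    using qint q0 by (simp add: nn_integral_eq_integral ennreal_le_iff flip: ennreal_numeral)
  then have "liminf (\<lambda>j. \<integral>\<^sup>+x. ennreal (q j x) \<partial>M) \<le> liminf (\<lambda>j::nat. 2)"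
    by (intro Liminf_mono always_eventually allI)
  then have "liminf (\<lambda>j. \<integral>\<^sup>+x. ennreal (q j x) \<partial>M) \<le> 2" by (simp add: Liminf_const)
  moreover have "(\<integral>\<^sup>+x. liminf (\<lambda>j. ennreal (q j x)) \<partial>M) \<le> liminf (\<lambda>j. \<integral>\<^sup>+x. ennreal (q j x) \<partial>M)"
    using qint by (intro nn_integral_liminf) auto
  ultimately have "(\<integral>\<^sup>+x. liminf (\<lambda>j. ennreal (q j x)) \<partial>M) \<le> 2" by (rule order_trans[rotated])
  then have "(\<integral>\<^sup>+x. liminf (\<lambda>j. ennreal (q j x)) \<partial>M) \<noteq> \<infinity>" by (auto simp: top_unique)
  moreover have "(\<lambda>x. liminf (\<lambda>j. ennreal (q j x))) \<in> borel_measurable M"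
    using qint by (intro borel_measurable_liminf) auto
  ultimately have "AE x in M. liminf (\<lambda>j. ennreal (q j x)) \<noteq> \<infinity>"
    by (intro nn_integral_noteq_infinite)
  then have "AE x in M. \<exists>C. \<exists>\<^sub>\<infinity>j. \<forall>i\<le>j. b i (n j) x \<le> C / 2 ^ i"
  proof eventually_elim
    case (elim x)
    then obtain C where C: "0 \<le> C" "liminf (\<lambda>j. ennreal (q j x)) = ennreal C"
      by (cases "liminf (\<lambda>j. ennreal (q j x))" rule: ennreal_cases) auto
    have "\<exists>\<^sub>\<infinity>j. q j x < C + 1"
    proof (rule ccontr)
      assume "\<not> (\<exists>\<^sub>\<infinity>j. q j x < C + 1)"
      then have "\<forall>\<^sub>F j in sequentially. ennreal (C + 1) \<le> ennreal (q j x)"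
        by (simp add: frequently_def not_less cofinite_eq_sequentially) (auto elim: eventually_mono intro: ennreal_leI)
      then have "ennreal (C + 1) \<le> liminf (\<lambda>j. ennreal (q j x))" by (rule Liminf_bounded)
      then show False using C by (simp add: ennreal_le_iff)
    qed
    then have "\<exists>\<^sub>\<infinity>j. \<forall>i\<le>j. b i (n j) x \<le> (C + 1) / 2 ^ i"
    proof (rule frequently_elim1)
      fix j assume j: "q j x < C + 1"
      show "\<forall>i\<le>j. b i (n j) x \<le> (C + 1) / 2 ^ i"
      proof (intro allI impI)
        fix i assume "i \<le> j"
        then have "2 ^ i * b i (n j) x \<le> q j x"
          unfolding q_def using b(2) by (intro member_le_sum) auto
        with j show "b i (n j) x \<le> (C + 1) / 2 ^ i" by (simp add: field_simps)
      qed
    qed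
    then show ?case by blast
  qed
  with n show ?thesis by blast
qed

theorem theorem1p2:
  fixes \<mu> \<nu> :: "'a::{t2_space, second_countable_topology} measure"
    and T :: "nat \<Rightarrow> 'a \<Rightarrow> 'a" and S :: "'a \<Rightarrow> 'a"
  assumes X: "standard_borel_prob_space \<mu>"
    and T: "\<And>n. n \<ge> 1 \<Longrightarrow> continuous_on UNIV (T n)"
    and S: "continuous_on UNIV S" "ergodic_prob_measure S \<mu>"
    and \<nu>: "sets \<nu> = sets borel" "prob_space \<nu>"
    and 1: "weak_star_conv (cesaro_measure (\<lambda>n. distr \<nu> borel (T n))) \<mu>"
    and 2: "AE x in \<nu>. \<forall>\<kappa>. weak_star_limit_point (cesaro_measure (\<lambda>n. return borel (T n x))) \<kappa>
              \<longrightarrow> invariant_measure S \<kappa>"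
    and 3: "\<exists>Z\<in>sets borel. sigma_compact Z \<and> measure \<mu> Z = 0 \<and>
              (\<forall>\<kappa>. ergodic_prob_measure S \<kappa> \<and> \<kappa> \<noteq> \<mu> \<longrightarrow> measure \<kappa> Z = 1)"
  shows "AE x in \<nu>. \<exists>A \<subseteq> {1..}. upper_density A = 1 \<and>
           (\<forall>\<psi>\<in>Cc. ((\<lambda>N. (1 / real N) * (\<Sum>n=1..N. \<psi> (T n x))) \<longlongrightarrow> (\<integral>y. \<psi> y \<partial>\<mu>))
                       (inf sequentially (principal A)))"
proof -
  have lc: "locally_compact_space (euclidean :: 'a topology)" and \<mu>: "prob_space \<mu>" "sets \<mu> = sets borel"
    using X by (auto simp: standard_borel_prob_space_def)
  interpret \<mu>: prob_space \<mu> by (rule \<mu>(1))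
  interpret \<nu>: prob_space \<nu> by (rule \<nu>(2))
  obtain Z where Z: "Z \<in> sets borel" "sigma_compact Z" "measure \<mu> Z = 0"
      "\<forall>\<kappa>. ergodic_prob_measure S \<kappa> \<and> \<kappa> \<noteq> \<mu> \<longrightarrow> measure \<kappa> Z = 1"
    using 3 by blast
  obtain K0 where K0: "\<And>i::nat. compact (K0 i)" "Z = (\<Union>i. K0 i)"
    using Z(2) by (auto simp: sigma_compact_def)
  \<comment> \<open>Partial unions make the compact pieces increasing, so that smallness at high
    levels reaches every fixed piece.\<close>
  define K where "K i = (\<Union>j\<le>i. K0 j)" for i
  have K: "compact (K i)" for i unfolding K_def using K0(1) by (intro compact_UN) auto
  have K_mono: "incseq K" unfolding K_def incseq_def by (auto intro: order_trans)
  have KZ: "(\<Union>i. K i) = Z" unfolding K_def K0(2) by auto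
  have K_null: "measure \<mu> (K i) = 0" for i
    using \<mu>.finite_measure_mono[of "K i" Z] Z(1,3) KZ \<mu>(2) measure_nonneg[of \<mu> "K i"] by auto
  \<comment> \<open>Half of \<open>(1/4) ^ i\<close> is reserved for \<open>1 - g i\<close>.\<close>
  have "\<exists>F\<in>Cc. (\<forall>x. 0 \<le> F x \<and> F x \<le> (1::real)) \<and> (\<forall>x\<in>K i. F x = 1) \<and> (\<integral>x. F x \<partial>\<mu>) < (1/4) ^ i / 2" for i
    by (rule compact_null_small_Cc[OF lc \<mu>.finite_measure_axioms \<mu>(2) K K_null]) simp
  then obtain F :: "nat \<Rightarrow> 'a \<Rightarrow> real" where F: "\<And>i. F i \<in> Cc" "\<And>i x. 0 \<le> F i x \<and> F i x \<le> 1"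
      "\<And>i x. x \<in> K i \<Longrightarrow> F i x = 1" "\<And>i. (\<integral>x. F i x \<partial>\<mu>) < (1/4) ^ i / 2"
    by metis
  have "\<exists>g\<in>Cc. (\<forall>x. 0 \<le> g x \<and> g x \<le> (1::real)) \<and> 1 - (1/4) ^ i / 2 < (\<integral>x. g x \<partial>\<mu>)" for i :: nat
    by (rule Cc_approximates_1[OF lc \<mu>]) simp
  then obtain g :: "nat \<Rightarrow> 'a \<Rightarrow> real" where g: "\<And>i. g i \<in> Cc" "\<And>i x. 0 \<le> g i x \<and> g i x \<le> 1"
      "\<And>i. 1 - (1/4) ^ i / 2 < (\<integral>x. g i x \<partial>\<mu>)"
    by metis
  have T_meas: "T n \<in> measurable \<nu> borel" if "1 \<le> n" for n
    using borel_measurable_continuous_onI[OF T[OF that]] by (simp add: measurable_cong_sets[OF \<nu>(1) refl])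
  have psiT: "integrable \<nu> (\<lambda>x. \<psi> (T n x))" if \<psi>: "\<psi> \<in> Cc" and n: "1 \<le> n" for \<psi> :: "'a \<Rightarrow> real" and n
  proof -
    obtain C where "\<And>x. \<bar>\<psi> x\<bar> \<le> C" using Cc_bounded[OF \<psi>] by blast
    then show ?thesis
      using measurable_compose[OF T_meas[OF n] Cc_measurable[OF \<psi>]]
      by (intro \<nu>.integrable_const_bound[where B=C]) auto
  qed
  have avg_lim: "(\<lambda>N. \<integral>x. (\<Sum>m=1..N. \<psi> (T m x)) / N \<partial>\<nu>) \<longlonglongrightarrow> (\<integral>x. \<psi> x \<partial>\<mu>)" if \<psi>: "\<psi> \<in> Cc" for \<psi>
  proof (rule Lim_transform_eventually)
    show "(\<lambda>N. \<integral>x. \<psi> x \<partial>cesaro_measure (\<lambda>n. distr \<nu> borel (T n)) N) \<longlonglongrightarrow> (\<integral>x. \<psi> x \<partial>\<mu>)"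
      using 1 \<psi> by (simp add: weak_star_conv_def)
    obtain C where C: "\<And>x. \<bar>\<psi> x\<bar> \<le> C" using Cc_bounded[OF \<psi>] by blast
    show "\<forall>\<^sub>F N in sequentially. (\<integral>x. \<psi> x \<partial>cesaro_measure (\<lambda>n. distr \<nu> borel (T n)) N) =
        (\<integral>x. (\<Sum>m=1..N. \<psi> (T m x)) / N \<partial>\<nu>)"
      using eventually_gt_at_top[of 0]
    proof eventually_elim
      case (elim N)
      have "(\<integral>x. \<psi> x \<partial>cesaro_measure (\<lambda>n. distr \<nu> borel (T n)) N) = (\<Sum>n=1..N. \<integral>x. \<psi> x \<partial>distr \<nu> borel (T n)) / N"
        by (rule integral_cesaro_measure[OF _ Cc_measurable[OF \<psi>] C elim])
          (simp add: \<nu>.prob_space_distr T_meas)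
      also have "\<dots> = (\<Sum>n=1..N. \<integral>x. \<psi> (T n x) \<partial>\<nu>) / N"
        using T_meas Cc_measurable[OF \<psi>] by (intro arg_cong2[where f="(/)"] sum.cong refl integral_distr) auto
      also have "\<dots> = (\<integral>x. (\<Sum>m=1..N. \<psi> (T m x)) / N \<partial>\<nu>)"
        using psiT[OF \<psi>] by (subst integral_divide_zero, subst Bochner_Integration.integral_sum) auto
      finally show ?case .
    qed
  qed
  define b where "b i N x = (\<Sum>m=1..N. F i (T m x) + (1 - g i (T m x))) / N" for i N x
  have b_int: "integrable \<nu> (b i N)" for i N
    unfolding b_def using psiT[OF F(1)] psiT[OF g(1)]
    by (intro integrable_divide_zero Bochner_Integration.integrable_sum Bochner_Integration.integrable_add
        Bochner_Integration.integrable_diff) auto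
  have b0: "0 \<le> b i N x" for i N x
    unfolding b_def using F(2) g(2) by (intro divide_nonneg_nonneg sum_nonneg add_nonneg_nonneg) auto
  have b_small: "\<forall>\<^sub>F N in sequentially. (\<integral>x. b i N x \<partial>\<nu>) \<le> (1/4) ^ i" for i
  proof -
    have "\<forall>\<^sub>F N in sequentially. (\<integral>x. (\<Sum>m=1..N. F i (T m x)) / N \<partial>\<nu>) < (1/4) ^ i / 2"
      by (rule order_tendstoD(2)[OF avg_lim[OF F(1)] F(4)])
    moreover have "\<forall>\<^sub>F N in sequentially. 1 - (1/4) ^ i / 2 < (\<integral>x. (\<Sum>m=1..N. g i (T m x)) / N \<partial>\<nu>)"
      by (rule order_tendstoD(1)[OF avg_lim[OF g(1)] g(3)])
    ultimately show ?thesis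
      using eventually_gt_at_top[of 0]
    proof eventually_elim
      case (elim N)
      have "b i N x = (\<Sum>m=1..N. F i (T m x)) / N + (1 - (\<Sum>m=1..N. g i (T m x)) / N)" for x
        using elim(3) by (simp add: b_def sum.distrib sum_subtractf add_divide_distrib diff_divide_distrib)
      moreover have "integrable \<nu> (\<lambda>x. (\<Sum>m=1..N. F i (T m x)) / N)" "integrable \<nu> (\<lambda>x. (\<Sum>m=1..N. g i (T m x)) / N)"
        using psiT[OF F(1)] psiT[OF g(1)]
        by (auto intro!: integrable_divide_zero Bochner_Integration.integrable_sum)
      ultimately have "(\<integral>x. b i N x \<partial>\<nu>) =
          (\<integral>x. (\<Sum>m=1..N. F i (T m x)) / N \<partial>\<nu>) + (1 - (\<integral>x. (\<Sum>m=1..N. g i (T m x)) / N \<partial>\<nu>))"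
        by (simp add: \<nu>.prob_space)
      with elim(1,2) show ?case by linarith
    qed
  qed
  obtain n where n: "strict_mono n" "AE x in \<nu>. \<exists>C. \<exists>\<^sub>\<infinity>j. \<forall>i\<le>j. b i (n j) x \<le> C / 2 ^ i"
    using \<nu>.AE_infinitely_often_small[of b, OF b_int b0 b_small] by (elim exE conjE) (rule that)
  from n(2) 2 show ?thesis
  proof eventually_elim
    case (elim x)
    then obtain C where C: "\<exists>\<^sub>\<infinity>j. \<forall>i\<le>j. b i (n j) x \<le> C / 2 ^ i" by blast
    have "good_orbit (\<lambda>n. T n x) \<mu> S K F g n C"
    proof
      show "invariant_measure S \<kappa>" if "weak_star_limit_point (cesaro_measure (\<lambda>n. return borel (T n x))) \<kappa>" for \<kappa>
        using elim(2) that by blast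
      \<comment> \<open>The dichotomy in (3): an ergodic measure other than \<mu> would have mass 1
        on \<open>Z\<close>.\<close>
      show "\<rho> = \<mu>" if "ergodic_prob_measure S \<rho>" "measure \<rho> (\<Union>i. K i) = 0" for \<rho>
        using Z(4) that KZ by force
      show "\<exists>\<^sub>\<infinity>j. \<forall>i\<le>j. (\<Sum>m=1..n j. F i (T m x) + (1 - g i (T m x))) / n j \<le> C / 2 ^ i"
        using C by (simp add: b_def)
    qed (use lc \<mu> K K_mono F g n(1) in auto)
    then show ?case by (rule good_orbit.generic_along_upper_density_1)
  qed
qed

end
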